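(* Let $0<H<1$, $0<K\leq 1$ and $T>0$. Let $\{W_t^{H,K}, 0\leq t\leq T\}$ be a bifractional Brownian motion with parameters $H,K$, and let $Y^{(2)}_t=2^{-K/2}W^{HK}(t)$, $0\leq t\leq T$, where $W^{HK}$ is a fractional Brownian motion with Hurst index $HK$. Then, for any non-decreasing convex function $g:\mathbb{R}_+\to\mathbb{R}$, $$E\Big[g\Big(\sup_{0\leq t,s\leq T}(W_t^{H,K}-W_s^{H,K})\Big)\Big]\geq E\Big[g\Big(\sup_{0\leq t,s\leq T}(Y_t^{(2)}-Y_s^{(2)})\Big)\Big]$$ and $$E\Big[\sup_{0\leq t\leq T}W_t^{H,K}\Big]\geq E\Big[\sup_{0\leq t\leq T}Y_t^{(2)}\Big].$$
   Context: A bifractional Brownian motion with parameters $H\in(0,1)$, $K\in(0,1]$ is a centered Gaussian process $\{W_t^{H,K},t\geq 0\}$ with covariance function $$C_H(s,t)=\frac{1}{2^K}\big[(t^{2H}+s^{2H})^K-|s-t|^{2HK}\big].$$ A fractional Brownian motion with Hurst index $h\in(0,1)$ is a centered Gaussian process with covariance function $\frac12(t^{2h}+s^{2h}-|t-s|^{2h})$; here $h=HK$. All processes are assumed to have almost surely continuous sample paths on $[0,T]$. $\mathbb{R}_+=[0,\infty)$. *)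

theory Defs
  imports "HOL-Probability.Probability"
begin

text \<open>Gaussian laws on the real line; a standard deviation of zero gives a point mass.\<close>

definition gaussian_rv :: "'a measure \<Rightarrow> ('a \<Rightarrow> real) \<Rightarrow> bool" where
  "gaussian_rv M X \<longleftrightarrow> X \<in> borel_measurable M \<and>
     (\<exists>\<mu> \<sigma>. 0 < \<sigma> \<and> distributed M lborel X (\<lambda>x. ennreal (normal_density \<mu> \<sigma> x))
            \<or> \<sigma> = 0 \<and> distr M borel X = return borel \<mu>)"

definition gaussian_process ::
  "'a measure \<Rightarrow> real set \<Rightarrow> (real \<Rightarrow> 'a \<Rightarrow> real) \<Rightarrow> bool" where
  "gaussian_process M I X \<longleftrightarrow>
     (\<forall>J c. finite J \<and> J \<subseteq> I \<longrightarrow> gaussian_rv M (\<lambda>\<omega>. \<Sum>t\<in>J. c t * X t \<omega>))"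

definition cov :: "'a measure \<Rightarrow> ('a \<Rightarrow> real) \<Rightarrow> ('a \<Rightarrow> real) \<Rightarrow> real" where
  "cov M X Y =
     (\<integral>\<omega>. (X \<omega> - (\<integral>\<omega>'. X \<omega>' \<partial>M)) * (Y \<omega> - (\<integral>\<omega>'. Y \<omega>' \<partial>M)) \<partial>M)"

definition centered_gaussian_process ::
  "'a measure \<Rightarrow> real set \<Rightarrow> (real \<Rightarrow> real \<Rightarrow> real) \<Rightarrow> (real \<Rightarrow> 'a \<Rightarrow> real) \<Rightarrow> bool" where
  "centered_gaussian_process M I C X \<longleftrightarrow> gaussian_process M I X \<and>
     (\<forall>t\<in>I. (\<integral>\<omega>. X t \<omega> \<partial>M) = 0) \<and>
     (\<forall>s\<in>I. \<forall>t\<in>I. cov M (X s) (X t) = C s t)"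

definition bifractional_cov :: "real \<Rightarrow> real \<Rightarrow> real \<Rightarrow> real \<Rightarrow> real" where
  "bifractional_cov H K s t =
     1 / 2 powr K * ((t powr (2 * H) + s powr (2 * H)) powr K - \<bar>s - t\<bar> powr (2 * H * K))"

definition fractional_cov :: "real \<Rightarrow> real \<Rightarrow> real \<Rightarrow> real" where
  "fractional_cov h s t = 1 / 2 * (t powr (2 * h) + s powr (2 * h) - \<bar>t - s\<bar> powr (2 * h))"

definition bifractional_brownian_motion ::
  "'a measure \<Rightarrow> real set \<Rightarrow> real \<Rightarrow> real \<Rightarrow> (real \<Rightarrow> 'a \<Rightarrow> real) \<Rightarrow> bool" where
  "bifractional_brownian_motion M I H K W \<longleftrightarrow>
     centered_gaussian_process M I (bifractional_cov H K) W"

definition fractional_brownian_motion ::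
  "'a measure \<Rightarrow> real set \<Rightarrow> real \<Rightarrow> (real \<Rightarrow> 'a \<Rightarrow> real) \<Rightarrow> bool" where
  "fractional_brownian_motion M I h B \<longleftrightarrow>
     centered_gaussian_process M I (fractional_cov h) B"

definition ae_continuous_paths ::
  "'a measure \<Rightarrow> real set \<Rightarrow> (real \<Rightarrow> 'a \<Rightarrow> real) \<Rightarrow> bool" where
  "ae_continuous_paths M I X \<longleftrightarrow> (AE \<omega> in M. continuous_on I (\<lambda>t. X t \<omega>))"

text \<open>Expectation with values in the extended reals. The Bochner integral would assign the value
  0 to a non-integrable function such as \<open>g (sup \<dots>)\<close> for a fast growing \<open>g\<close>, whose expectation
  is \<open>\<infinity>\<close>. The difference is meaningful when one of the two parts is finite, which holds for
  variables almost surely bounded below. The value depends only on the almost-sure class of \<open>f\<close>,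
  so the values of a supremum on the null set of discontinuous paths do not matter.\<close>

definition ext_expectation :: "'a measure \<Rightarrow> ('a \<Rightarrow> real) \<Rightarrow> ereal" where
  "ext_expectation M f =
     enn2ereal (\<integral>\<^sup>+ \<omega>. ennreal (f \<omega>) \<partial>M) - enn2ereal (\<integral>\<^sup>+ \<omega>. ennreal (- f \<omega>) \<partial>M)"

end

theory Submission
  imports Defs "HOL-Real_Asymp.Real_Asymp"
begin

text \<open>
  The increments of \<open>W\<close> dominate those of \<open>Y\<close> in \<open>L\<^sup>2\<close> (Houdre and Villa), so the claim is an instance
  of the Sudakov--Fernique inequality in the convex form.  Both processes are reduced to finite
  grids.  There the oscillation is replaced by \<open>ln (\<kappa> + (\<Sum>i\<in>J. \<Sum>j\<in>J. exp (x i - x j)))\<close>, which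
  up to scaling is a smooth convex version of \<open>max c (osc x)\<close>, whose Hessian has nonpositive off-diagonal entries and zero row
  sums.  Gaussian integration by parts shows that its expectation grows along a polygon that is
  tangent to the quarter circle leading from one Gaussian vector to an independent copy of the
  other.  Hinge functions generate the increasing convex order, which gives all \<open>g\<close>; the
  supremum of the process itself has half the expectation of the oscillation, by symmetry.
\<close>

section \<open>Uniqueness of the law of a random vector\<close>

text \<open>The classical proof differentiates the expectation along the quarter circle, under the
  integral sign. Here a tangent step replaces the derivative: convexity makes the first-order term a
  lower bound for the whole increment, and integration by parts gives that term its sign. The price
  is that a step of angle \<open>pi / (2 * n)\<close> enlarges the radius by
  \<open>1 / cos (pi / (2 * n))\<close>; the \<open>n\<close>-th power of this factor tends to 1, so
  the loss disappears in the limit. Gaussian vectors are known only through their linear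
  combinations, and covariances may be singular (the processes vanish at time 0), so there is no
  joint density to work with. Joint laws are identified by characteristic functions instead, and
  integration by parts is reduced to one dimension by regression. The level \<open>c\<close> enters
  the smoothing through \<kappa> = \<open>exp (b * c)\<close>, because comparing the expectations of
  \<open>max c (oscillation J x)\<close> for all \<open>c\<close> amounts to comparing all hinges.
  Expectations of \<open>g\<close> may be infinite; subtracting \<open>g 0\<close> keeps the
  argument within nonnegative integrals.\<close>

lemma weighted_Levy_uniqueness:
  fixes w X :: "'a \<Rightarrow> real" and w' X' :: "'b \<Rightarrow> real"
  assumes "prob_space M" "prob_space N"
    and X [measurable]: "X \<in> borel_measurable M" and X' [measurable]: "X' \<in> borel_measurable N"
    and w [measurable]: "w \<in> borel_measurable M" and w' [measurable]: "w' \<in> borel_measurable N"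
    and w_pos: "\<And>x. 0 \<le> w x" and w_le: "\<And>x. w x \<le> C"
    and w'_pos: "\<And>x. 0 \<le> w' x" and w'_le: "\<And>x. w' x \<le> C"
    and char: "\<And>a. (\<integral>x. w x * iexp (a * X x) \<partial>M) = (\<integral>x. w' x * iexp (a * X' x) \<partial>N)"
    and A [measurable]: "A \<in> sets borel"
  shows "(\<integral>x. w x * indicator A (X x) \<partial>M) = (\<integral>x. w' x * indicator A (X' x) \<partial>N)"
proof -
  interpret M: prob_space M by fact
  interpret N: prob_space N by fact
  have iw: "integrable M w" 
    by (rule M.integrable_const_bound[where B=C]) (use w_pos w_le in auto)
  have iw': "integrable N w'" 
    by (rule N.integrable_const_bound[where B=C]) (use w'_pos w'_le in auto)
  define m where "m = (\<integral>x. w x \<partial>M)"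
  have "complex_of_real (\<integral>x. w x \<partial>M) = complex_of_real (\<integral>x. w' x \<partial>N)"
    using char[of 0] by simp
  hence m': "m = (\<integral>x. w' x \<partial>N)" by (simp add: m_def)
  have "m \<ge> 0" unfolding m_def using w_pos by simp
  show ?thesis
  proof (cases "m = 0")
    case True
    have "AE x in M. w x = 0"
      using True iw w_pos by (subst (asm) m_def, subst (asm) integral_nonneg_eq_0_iff_AE) auto
    moreover have "AE x in N. w' x = 0"
      using True iw' w'_pos by (subst (asm) m', subst (asm) integral_nonneg_eq_0_iff_AE) auto
    ultimately have "(\<integral>x. w x * indicator A (X x) \<partial>M) = (\<integral>x. 0 \<partial>M)"
      "(\<integral>x. w' x * indicator A (X' x) \<partial>N) = (\<integral>x. 0 \<partial>N)"
      by (intro integral_cong_AE; auto elim!: eventually_mono)+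
    thus ?thesis by simp
  next
    case False
    with \<open>m \<ge> 0\<close> have m: "m > 0" by simp
    \<comment> \<open>Divided by their common mass \<open>m\<close>, the weights are probability
      densities, so the ordinary uniqueness theorem applies to the reweighted laws. The facts are
      stated for an arbitrary space because both sides need them.\<close>
    have *: "real_distribution (distr (density M (\<lambda>x. ennreal (w x / m))) borel X)"
      "char (distr (density M (\<lambda>x. ennreal (w x / m))) borel X) t = (\<integral>x. w x * iexp (t * X x) \<partial>M) / m"
      "measure (distr (density M (\<lambda>x. ennreal (w x / m))) borel X) A = (\<integral>x. w x * indicator A (X x) \<partial>M) / m"
      if "prob_space M" and [measurable]: "X \<in> borel_measurable M" "w \<in> borel_measurable M"
        and w_pos: "\<And>x. 0 \<le> w x" and iw: "integrable M w" and mw: "m = (\<integral>x. w x \<partial>M)"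
      for M :: "'c measure" and X w t
    proof -
      interpret P: prob_space M by fact
      have "emeasure (density M (\<lambda>x. ennreal (w x / m))) (space M) = (\<integral>\<^sup>+x. ennreal (w x / m) \<partial>M)"
        by (subst emeasure_density) (auto intro!: nn_integral_cong)
      also have "\<dots> = ennreal (\<integral>x. w x / m \<partial>M)"
        using w_pos m iw by (intro nn_integral_eq_integral) auto
      also have "\<dots> = 1" using m mw by simp
      finally interpret D: prob_space "density M (\<lambda>x. ennreal (w x / m))"
        by (intro prob_spaceI) simp
      show "real_distribution (distr (density M (\<lambda>x. ennreal (w x / m))) borel X)"
        by (intro D.real_distribution_distr) simp
      show "char (distr (density M (\<lambda>x. ennreal (w x / m))) borel X) t = (\<integral>x. w x * iexp (t * X x) \<partial>M) / m"
        unfolding char_def using w_pos m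
        by (simp add: integral_distr integral_density scaleR_conv_of_real)
      have "measure (distr (density M (\<lambda>x. ennreal (w x / m))) borel X) A
          = (\<integral>x. indicator A (X x) \<partial>density M (\<lambda>x. ennreal (w x / m)))"
        using integral_distr[of X "density M (\<lambda>x. ennreal (w x / m))" borel "indicator A :: real \<Rightarrow> real"] by simp
      also have "\<dots> = (\<integral>x. w x / m * indicator A (X x) \<partial>M)"
        using w_pos m by (subst integral_density) auto
      finally show "measure (distr (density M (\<lambda>x. ennreal (w x / m))) borel X) A = (\<integral>x. w x * indicator A (X x) \<partial>M) / m"
        by simp
    qed
    note DM = *[OF assms(1) X w w_pos iw m_def] and DN = *[OF assms(2) X' w' w'_pos iw' m']
    have "distr (density M (\<lambda>x. ennreal (w x / m))) borel X = distr (density N (\<lambda>x. ennreal (w' x / m))) borel X'"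
      by (rule Levy_uniqueness[OF DM(1) DN(1)]) (simp add: fun_eq_iff DM(2) DN(2) char del: of_real_mult)
    with DM(3) DN(3) m show ?thesis by simp
  qed
qed

lemma integral_plus_sum_divide:
  fixes p q r :: "'a \<Rightarrow> complex"
  assumes "integrable M p" "integrable M q" "integrable M r"
  shows "(\<integral>x. p x + (q x + r x) / z \<partial>M) = (\<integral>x. p x \<partial>M) + ((\<integral>x. q x \<partial>M) + (\<integral>x. r x \<partial>M)) / z"
    and "(\<integral>x. p x + (q x - r x) / z \<partial>M) = (\<integral>x. p x \<partial>M) + ((\<integral>x. q x \<partial>M) - (\<integral>x. r x \<partial>M)) / z"
  using assms by simp_all

lemma integral_Complex:
  fixes p q :: "'a \<Rightarrow> real"
  assumes "integrable M p" "integrable M q"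
  shows "(\<integral>x. complex_of_real (p x) + \<i> * complex_of_real (q x) \<partial>M)
    = complex_of_real (\<integral>x. p x \<partial>M) + \<i> * complex_of_real (\<integral>x. q x \<partial>M)"
  using assms by simp

text \<open>Induction on the coordinates, the weight absorbing the indicators of those already
  treated. The factor \<open>iexp (S c x)\<close> of the remaining coordinates would be the natural
  weight for coordinate \<open>k\<close>, but the one-dimensional result needs nonnegative weights.
  It is therefore replaced by \<open>w * (1 + cos S)\<close> and \<open>w * (1 + sin S)\<close>,
  which lie between 0 and 2.\<close>

lemma weighted_vector_Levy_uniqueness:
  fixes w :: "'a \<Rightarrow> real" and w' :: "'b \<Rightarrow> real" and X :: "'i \<Rightarrow> 'a \<Rightarrow> real" and X' :: "'i \<Rightarrow> 'b \<Rightarrow> real"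
  assumes "finite J" "prob_space M" "prob_space N"
    and "\<And>j. j \<in> J \<Longrightarrow> X j \<in> borel_measurable M" "\<And>j. j \<in> J \<Longrightarrow> X' j \<in> borel_measurable N"
    and "w \<in> borel_measurable M" "w' \<in> borel_measurable N"
    and "\<And>x. 0 \<le> w x" "\<And>x. w x \<le> 1" "\<And>x. 0 \<le> w' x" "\<And>x. w' x \<le> 1"
    and "\<And>c. (\<integral>x. w x * iexp (\<Sum>j\<in>J. c j * X j x) \<partial>M) = (\<integral>x. w' x * iexp (\<Sum>j\<in>J. c j * X' j x) \<partial>N)"
    and "\<And>j. j \<in> J \<Longrightarrow> A j \<in> sets borel"
  shows "(\<integral>x. w x * (\<Prod>j\<in>J. indicator (A j) (X j x)) \<partial>M)
       = (\<integral>x. w' x * (\<Prod>j\<in>J. indicator (A j) (X' j x)) \<partial>N)"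
  using assms
proof (induction J arbitrary: w w' rule: finite_induct)
  case empty
  have "complex_of_real (\<integral>x. w x \<partial>M) = complex_of_real (\<integral>x. w' x \<partial>N)"
    using empty(11)[of undefined] by simp
  thus ?case by simp
next
  case (insert k J)
  interpret M: prob_space M by fact
  interpret N: prob_space N by fact
  note [measurable] = insert.prems(5,6)
  have [measurable]: "X k \<in> borel_measurable M" "X' k \<in> borel_measurable N" "A k \<in> sets borel"
    using insert.prems by auto
  define S where "S c x = (\<Sum>j\<in>J. c j * X j x)" for c x
  define S' where "S' c x = (\<Sum>j\<in>J. c j * X' j x)" for c x
  have [measurable]: "S c \<in> borel_measurable M" "S' c \<in> borel_measurable N" for c
    unfolding S_def S'_def using insert.prems by auto
  have joint: "(\<integral>x. w x * iexp (a * X k x + S c x) \<partial>M) = (\<integral>x. w' x * iexp (a * X' k x + S' c x) \<partial>N)" for a c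
  proof -
    have e: "(\<Sum>j\<in>insert k J. (c(k:=a)) j * Z j x) = a * Z k x + (\<Sum>j\<in>J. c j * Z j x)" 
      for Z :: "'i \<Rightarrow> 'c \<Rightarrow> real" and x
      using insert.hyps by (simp, intro sum.cong) auto
    from insert.prems(11)[of "c(k:=a)"] show ?thesis unfolding e S_def S'_def .
  qed
  have int: "integrable M (\<lambda>x. complex_of_real (w x) * iexp (f x))" 
    if "f \<in> borel_measurable M" for f
    by (rule M.integrable_const_bound[where B=1])
       (use that insert.prems(7,8) in \<open>auto simp: norm_mult\<close>)
  have int': "integrable N (\<lambda>x. complex_of_real (w' x) * iexp (f x))" 
    if "f \<in> borel_measurable N" for f
    by (rule N.integrable_const_bound[where B=1])
       (use that insert.prems(9,10) in \<open>auto simp: norm_mult\<close>)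
  have joint0: "(\<integral>x. w x * iexp (a * X k x) \<partial>M) = (\<integral>x. w' x * iexp (a * X' k x) \<partial>N)" for a
    using joint[of a "\<lambda>_. 0"] by (simp add: S_def S'_def)
  have ind0: "(\<integral>x. w x * indicator (A k) (X k x) \<partial>M) = (\<integral>x. w' x * indicator (A k) (X' k x) \<partial>N)"
    by (rule weighted_Levy_uniqueness[where C=1]) (use insert.prems joint0 in auto)
  have joint_neg: "(\<integral>x. w x * iexp (a * X k x - S c x) \<partial>M) = (\<integral>x. w' x * iexp (a * X' k x - S' c x) \<partial>N)" for a c
  proof -
    have "S (\<lambda>j. - c j) x = - S c x" "S' (\<lambda>j. - c j) y = - S' c y" for x y
      by (simp_all add: S_def S'_def sum_negf)
    thus ?thesis using joint[of a "\<lambda>j. - c j"] by simp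
  qed
  \<comment> \<open>Euler's formulas turn the transforms of the new weights into values of the joint
    transform at \<open>c\<close>, \<open>0\<close> and \<open>- c\<close>.\<close>
  have cos_eq: "complex_of_real (u * (1 + cos s)) * iexp t
     = u * iexp t + (u * iexp (t + s) + u * iexp (t - s)) / 2" for u s t
    by (simp add: complex_eq_iff cos_add cos_diff sin_add sin_diff Re_exp Im_exp algebra_simps)
  have sin_eq: "complex_of_real (u * (1 + sin s)) * iexp t
     = u * iexp t + (u * iexp (t + s) - u * iexp (t - s)) / (2 * \<i>)" for u s t
    by (simp add: complex_eq_iff cos_add cos_diff sin_add sin_diff Re_exp Im_exp algebra_simps Re_divide Im_divide power2_eq_square)
  have C: "(\<integral>x. (w x * (1 + cos (S c x))) * indicator (A k) (X k x) \<partial>M)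
     = (\<integral>x. (w' x * (1 + cos (S' c x))) * indicator (A k) (X' k x) \<partial>N)" for c
  proof (rule weighted_Levy_uniqueness[where C=2])
    fix a :: real
    show "(\<integral>x. complex_of_real (w x * (1 + cos (S c x))) * iexp (a * X k x) \<partial>M)
     = (\<integral>x. complex_of_real (w' x * (1 + cos (S' c x))) * iexp (a * X' k x) \<partial>N)"
      unfolding cos_eq
      by (subst integral_plus_sum_divide(1), (intro int; measurable)+,
          subst integral_plus_sum_divide(1), (intro int'; measurable)+,
          simp only: joint joint0 joint_neg)
    have "1 + cos s \<ge> 0" for s :: real using cos_ge_minus_one[of s] by linarith
    thus "0 \<le> w x * (1 + cos (S c x))" "0 \<le> w' y * (1 + cos (S' c y))" for x y
      using insert.prems(7-10) by (simp_all add: mult_nonneg_nonneg)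
    have "1 + cos s \<le> 2" "1 + cos s \<ge> 0" for s :: real using cos_le_one[of s] cos_ge_minus_one[of s] by linarith+
    thus "w x * (1 + cos (S c x)) \<le> 2" "w' y * (1 + cos (S' c y)) \<le> 2" for x y
      using mult_mono[of "w x" 1 "1 + cos (S c x)" 2] mult_mono[of "w' y" 1 "1 + cos (S' c y)" 2]
        insert.prems(7-10) by auto
  qed (use insert.prems in auto)
  have D: "(\<integral>x. (w x * (1 + sin (S c x))) * indicator (A k) (X k x) \<partial>M)
     = (\<integral>x. (w' x * (1 + sin (S' c x))) * indicator (A k) (X' k x) \<partial>N)" for c
  proof (rule weighted_Levy_uniqueness[where C=2])
    fix a :: real
    show "(\<integral>x. complex_of_real (w x * (1 + sin (S c x))) * iexp (a * X k x) \<partial>M)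
     = (\<integral>x. complex_of_real (w' x * (1 + sin (S' c x))) * iexp (a * X' k x) \<partial>N)"
      unfolding sin_eq
      by (subst integral_plus_sum_divide(2), (intro int; measurable)+,
          subst integral_plus_sum_divide(2), (intro int'; measurable)+,
          simp only: joint joint0 joint_neg)
    have "1 + sin s \<ge> 0" for s :: real using sin_ge_minus_one[of s] by linarith
    thus "0 \<le> w x * (1 + sin (S c x))" "0 \<le> w' y * (1 + sin (S' c y))" for x y
      using insert.prems(7-10) by (simp_all add: mult_nonneg_nonneg)
    have "1 + sin s \<le> 2" "1 + sin s \<ge> 0" for s :: real using sin_le_one[of s] sin_ge_minus_one[of s] by linarith+
    thus "w x * (1 + sin (S c x)) \<le> 2" "w' y * (1 + sin (S' c y)) \<le> 2" for x y
      using mult_mono[of "w x" 1 "1 + sin (S c x)" 2] mult_mono[of "w' y" 1 "1 + sin (S' c y)" 2]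
        insert.prems(7-10) by auto
  qed (use insert.prems in auto)
  have intb: "integrable M (\<lambda>x. w x * indicator (A k) (X k x) * f x)" 
    if [measurable]: "f \<in> borel_measurable M" and "\<And>x. \<bar>f x\<bar> \<le> 1" for f
  proof (rule M.integrable_const_bound[where B=1])
    have "\<bar>w x * indicator (A k) (X k x)\<bar> * \<bar>f x\<bar> \<le> 1 * 1" for x
      using that insert.prems(7,8) by (intro mult_mono) (auto simp: indicator_def)
    thus "AE x in M. norm (w x * indicator (A k) (X k x) * f x) \<le> 1" by (simp add: abs_mult)
  qed simp
  have intb': "integrable N (\<lambda>x. w' x * indicator (A k) (X' k x) * f x)" 
    if [measurable]: "f \<in> borel_measurable N" and "\<And>x. \<bar>f x\<bar> \<le> 1" for f
  proof (rule N.integrable_const_bound[where B=1])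
    have "\<bar>w' x * indicator (A k) (X' k x)\<bar> * \<bar>f x\<bar> \<le> 1 * 1" for x
      using that insert.prems(9,10) by (intro mult_mono) (auto simp: indicator_def)
    thus "AE x in N. norm (w' x * indicator (A k) (X' k x) * f x) \<le> 1" by (simp add: abs_mult)
  qed simp
  have sw: "u * (1 + s) * i = u * i * 1 + u * i * s" for u s i :: real by (simp add: algebra_simps)
  have splitM: "(\<integral>x. w x * (1 + f x) * indicator (A k) (X k x) \<partial>M)
      = (\<integral>x. w x * indicator (A k) (X k x) \<partial>M) + (\<integral>x. w x * indicator (A k) (X k x) * f x \<partial>M)"
    if "f \<in> borel_measurable M" "\<And>x. \<bar>f x\<bar> \<le> 1" for f
    unfolding sw using intb[of "\<lambda>_. 1"] intb[OF that] by simp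
  have splitN: "(\<integral>x. w' x * (1 + f x) * indicator (A k) (X' k x) \<partial>N)
      = (\<integral>x. w' x * indicator (A k) (X' k x) \<partial>N) + (\<integral>x. w' x * indicator (A k) (X' k x) * f x \<partial>N)"
    if "f \<in> borel_measurable N" "\<And>x. \<bar>f x\<bar> \<le> 1" for f
    unfolding sw using intb'[of "\<lambda>_. 1"] intb'[OF that] by simp
  \<comment> \<open>The constant 1 in the weight contributes equally on both sides by
    \<open>ind0\<close>. Removing it leaves the real and imaginary parts of the transform under the
    weight \<open>w x * indicator (A k) (X k x)\<close>, which again takes values in
    \<open>[0, 1]\<close>.\<close>
  have C': "(\<integral>x. w x * indicator (A k) (X k x) * cos (S c x) \<partial>M)
     = (\<integral>x. w' x * indicator (A k) (X' k x) * cos (S' c x) \<partial>N)" for c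
    using C[of c] ind0 splitM[of "\<lambda>x. cos (S c x)"] splitN[of "\<lambda>x. cos (S' c x)"] by simp
  have D': "(\<integral>x. w x * indicator (A k) (X k x) * sin (S c x) \<partial>M)
     = (\<integral>x. w' x * indicator (A k) (X' k x) * sin (S' c x) \<partial>N)" for c
    using D[of c] ind0 splitM[of "\<lambda>x. sin (S c x)"] splitN[of "\<lambda>x. sin (S' c x)"] by simp
  have iexp_eq: "complex_of_real u * iexp t = complex_of_real (u * cos t) + \<i> * complex_of_real (u * sin t)" for u t
    by (simp add: complex_eq_iff Re_exp Im_exp)
  have "(\<integral>x. w x * indicator (A k) (X k x) * (\<Prod>j\<in>J. indicator (A j) (X j x)) \<partial>M)
       = (\<integral>x. w' x * indicator (A k) (X' k x) * (\<Prod>j\<in>J. indicator (A j) (X' j x)) \<partial>N)"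
  proof (rule insert.IH)
    fix c :: "'i \<Rightarrow> real"
    have "(\<integral>x. complex_of_real (w x * indicator (A k) (X k x)) * iexp (S c x) \<partial>M)
        = complex_of_real (\<integral>x. w x * indicator (A k) (X k x) * cos (S c x) \<partial>M)
          + \<i> * complex_of_real (\<integral>x. w x * indicator (A k) (X k x) * sin (S c x) \<partial>M)"
      unfolding iexp_eq
      by (rule integral_Complex; rule intb; simp)
    also have "\<dots> = (\<integral>x. complex_of_real (w' x * indicator (A k) (X' k x)) * iexp (S' c x) \<partial>N)"
      unfolding iexp_eq C' D'
      by (rule integral_Complex[symmetric]; rule intb'; simp)
    finally show "(\<integral>x. complex_of_real (w x * indicator (A k) (X k x)) * iexp (\<Sum>j\<in>J. c j * X j x) \<partial>M)
      = (\<integral>x. complex_of_real (w' x * indicator (A k) (X' k x)) * iexp (\<Sum>j\<in>J. c j * X' j x) \<partial>N)"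
      unfolding S_def S'_def .
  qed (use insert.prems in \<open>auto simp: indicator_def\<close>)
  thus ?case using insert.hyps by (simp add: mult.assoc)
qed

text \<open>Measurable rectangles determine a finite measure on a finite product; their
  probabilities are compared by the previous lemma with weight 1.\<close>

lemma vector_Levy_uniqueness:
  fixes X :: "'i \<Rightarrow> 'a \<Rightarrow> real" and X' :: "'i \<Rightarrow> 'b \<Rightarrow> real"
  assumes J: "finite J" and "prob_space M" "prob_space N"
    and X [measurable]: "\<And>j. j \<in> J \<Longrightarrow> X j \<in> borel_measurable M" 
    and X' [measurable]: "\<And>j. j \<in> J \<Longrightarrow> X' j \<in> borel_measurable N"
    and char: "\<And>c. (\<integral>x. iexp (\<Sum>j\<in>J. c j * X j x) \<partial>M) = (\<integral>x. iexp (\<Sum>j\<in>J. c j * X' j x) \<partial>N)"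
  shows "distr M (Pi\<^sub>M J (\<lambda>_. borel)) (\<lambda>\<omega>. \<lambda>j\<in>J. X j \<omega>) = distr N (Pi\<^sub>M J (\<lambda>_. borel)) (\<lambda>\<omega>. \<lambda>j\<in>J. X' j \<omega>)"
proof (rule measure_eqI_PiM_finite[where I=J and M="\<lambda>_. borel"])
  interpret M: prob_space M by fact
  interpret N: prob_space N by fact
  have mX [measurable]: "(\<lambda>\<omega>. \<lambda>j\<in>J. X j \<omega>) \<in> measurable M (Pi\<^sub>M J (\<lambda>_. borel))" 
    by (rule measurable_restrict) simp
  have mX' [measurable]: "(\<lambda>\<omega>. \<lambda>j\<in>J. X' j \<omega>) \<in> measurable N (Pi\<^sub>M J (\<lambda>_. borel))" 
    by (rule measurable_restrict) simp
  interpret DM: prob_space "distr M (Pi\<^sub>M J (\<lambda>_. borel)) (\<lambda>\<omega>. \<lambda>j\<in>J. X j \<omega>)"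
    by (rule M.prob_space_distr) simp
  interpret DN: prob_space "distr N (Pi\<^sub>M J (\<lambda>_. borel)) (\<lambda>\<omega>. \<lambda>j\<in>J. X' j \<omega>)"
    by (rule N.prob_space_distr) simp
  show "finite J" by fact
  show "emeasure (distr M (Pi\<^sub>M J (\<lambda>_. borel)) (\<lambda>\<omega>. \<lambda>j\<in>J. X j \<omega>)) (Pi\<^sub>E J (\<lambda>_. UNIV)) \<noteq> \<infinity>"
    by (simp add: DM.emeasure_finite)
  show "range (\<lambda>_::nat. Pi\<^sub>E J (\<lambda>_. UNIV)) \<subseteq> prod_algebra J (\<lambda>_. borel :: real measure)"
    using J by (auto intro!: prod_algebraI_finite)
  fix A :: "'i \<Rightarrow> real set" assume A: "\<And>i. i \<in> J \<Longrightarrow> A i \<in> sets borel"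
  have P: "Pi\<^sub>E J A \<in> sets (Pi\<^sub>M J (\<lambda>_. borel))" using J A by (intro sets_PiM_I_finite) auto
  have ind: "indicator (Pi\<^sub>E J A) (\<lambda>j\<in>J. Z j) = (\<Prod>j\<in>J. indicator (A j) (Z j) :: real)" for Z
    using J by (auto simp: indicator_def PiE_def Pi_def prod.If_cases intro!: prod_zero)
  have "measure (distr M (Pi\<^sub>M J (\<lambda>_. borel)) (\<lambda>\<omega>. \<lambda>j\<in>J. X j \<omega>)) (Pi\<^sub>E J A) = 
      (\<integral>x. 1 * (\<Prod>j\<in>J. indicator (A j) (X j x)) \<partial>M)"
    using P integral_distr[OF mX, of "indicator (Pi\<^sub>E J A) :: _ \<Rightarrow> real"] by (simp add: ind)
  also have "\<dots> = (\<integral>x. 1 * (\<Prod>j\<in>J. indicator (A j) (X' j x)) \<partial>N)"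
    by (rule weighted_vector_Levy_uniqueness) (use assms A in auto)
  also have "\<dots> = measure (distr N (Pi\<^sub>M J (\<lambda>_. borel)) (\<lambda>\<omega>. \<lambda>j\<in>J. X' j \<omega>)) (Pi\<^sub>E J A)"
    using P integral_distr[OF mX', of "indicator (Pi\<^sub>E J A) :: _ \<Rightarrow> real"] by (simp add: ind)
  finally show "emeasure (distr M (Pi\<^sub>M J (\<lambda>_. borel)) (\<lambda>\<omega>. \<lambda>j\<in>J. X j \<omega>)) (Pi\<^sub>E J A)
     = emeasure (distr N (Pi\<^sub>M J (\<lambda>_. borel)) (\<lambda>\<omega>. \<lambda>j\<in>J. X' j \<omega>)) (Pi\<^sub>E J A)"
    by (simp add: DM.emeasure_eq_measure DN.emeasure_eq_measure)
qed (auto simp: space_PiM)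

section \<open>Centered Gaussian vectors\<close>

text \<open>A point mass at 0 is the image of the standard normal law under multiplication by
  \<open>\<sigma> = 0\<close>, so one formula covers both cases of \<open>gaussian_rv\<close> from
  here on.\<close>

lemma (in prob_space) gaussian_rv_std:
  assumes "gaussian_rv M X" "expectation X = 0"
  obtains \<sigma> where "0 \<le> \<sigma>" "distr M borel X = distr std_normal_distribution borel (\<lambda>x. \<sigma> * x)"
proof -
  have [measurable]: "X \<in> borel_measurable M" using assms(1) by (simp add: gaussian_rv_def)
  interpret S: real_distribution std_normal_distribution by (rule real_dist_normal_dist)
  from assms(1) consider \<mu> \<sigma> where "0 < \<sigma>" "distributed M lborel X (\<lambda>x. ennreal (normal_density \<mu> \<sigma> x))"
    | \<mu> where "distr M borel X = return borel \<mu>"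
    unfolding gaussian_rv_def by blast
  thus ?thesis
  proof cases
    case 1
    hence "\<mu> = 0" using normal_distributed_expectation[OF 1] assms(2) by simp
    with 1 have "distributed M lborel (\<lambda>x. X x / \<sigma>) std_normal_density"
      using normal_standard_normal_convert[of \<sigma> X \<mu>] by simp
    hence "distr M lborel (\<lambda>x. X x / \<sigma>) = std_normal_distribution"
      by (rule distributed_distr_eq_density)
    hence "distr std_normal_distribution borel (\<lambda>x. \<sigma> * x) = distr (distr M lborel (\<lambda>x. X x / \<sigma>)) borel (\<lambda>x. \<sigma> * x)"
      by simp
    also have "\<dots> = distr M borel X"
      using \<open>0 < \<sigma>\<close> by (subst distr_distr) (auto simp: comp_def)
    finally show ?thesis using that[of \<sigma>] \<open>0 < \<sigma>\<close> by simp
  next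
    case 2
    have "expectation X = (\<integral>x. x \<partial>distr M borel X)" by (simp add: integral_distr)
    also have "\<dots> = \<mu>" unfolding 2 by (simp add: integral_return)
    finally have "\<mu> = 0" using assms(2) by simp
    moreover have "distr std_normal_distribution borel (\<lambda>x. 0 * x) = return borel 0"
      using S.distr_const[of 0 borel] by simp
    ultimately show ?thesis using that[of 0] 2 by simp
  qed
qed

text \<open>The normal density satisfies \<open>\<phi>' x = - x * \<phi> x\<close>, so the integral
  of \<open>(f * \<phi>)'\<close> is the difference of the two sides. It vanishes because
  \<open>f\<close> is bounded and \<open>\<phi>\<close> tends to 0 at both ends.\<close>

lemma std_normal_Stein:
  fixes f f' :: "real \<Rightarrow> real"
  assumes f: "\<And>x. (f has_real_derivative f' x) (at x)" and f': "\<And>x. isCont f' x"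
    and bnd: "\<And>x. \<bar>f x\<bar> \<le> C" "\<And>x. \<bar>f' x\<bar> \<le> C"
  shows "(\<integral>x. x * f x \<partial>std_normal_distribution) = (\<integral>x. f' x \<partial>std_normal_distribution)"
proof -
  have cf: "isCont f x" for x using f by (rule DERIV_isCont)
  have [measurable]: "f \<in> borel_measurable borel" "f' \<in> borel_measurable borel"
    using cf f' by (auto intro!: borel_measurable_continuous_onI continuous_at_imp_continuous_on)
  have i1: "integrable lborel (\<lambda>x. std_normal_density x * f' x)"
    by (rule Bochner_Integration.integrable_bound[OF integrable_mult_right[OF integrable_normal_density[of 1 0], of C]])
       (use bnd(2) in \<open>auto simp: abs_mult mult.commute intro!: mult_mono order_trans[OF bnd(2)]\<close>)
  have i2: "integrable lborel (\<lambda>x. std_normal_density x * (x * f x))"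
    by (rule Bochner_Integration.integrable_bound[OF integrable_mult_right[OF integrable_std_normal_moment_abs[of 1], of C]])
       (use bnd(1) in \<open>auto simp: abs_mult mult_ac intro!: mult_mono order_trans[OF bnd(1)]\<close>)
  define F where "F x = f x * std_normal_density x" for x
  have dphi: "(std_normal_density has_real_derivative - x * std_normal_density x) (at x)" for x
  proof -
    have "((\<lambda>x. c * exp (- x\<^sup>2 / 2)) has_real_derivative - x * (c * exp (- x\<^sup>2 / 2))) (at x)" for c
      by (auto intro!: derivative_eq_intros)
    thus ?thesis unfolding std_normal_density_def .
  qed
  have dF: "(F has_real_derivative (f' x * std_normal_density x - x * (f x * std_normal_density x))) (at x)" for x
    unfolding F_def by (rule DERIV_cong[OF DERIV_mult[OF f dphi]]) simp
  have "(F \<longlongrightarrow> 0) at_top" "(F \<longlongrightarrow> 0) at_bot"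
  proof -
    have "((\<lambda>x. C * std_normal_density x) \<longlongrightarrow> 0) at_top" "((\<lambda>x. C * std_normal_density x) \<longlongrightarrow> 0) at_bot"
      unfolding std_normal_density_def by real_asymp+
    moreover have "norm (F x) \<le> C * std_normal_density x" for x
      unfolding F_def by (auto simp: abs_mult intro!: mult_right_mono bnd)
    ultimately show "(F \<longlongrightarrow> 0) at_top" "(F \<longlongrightarrow> 0) at_bot"
      by - (rule Lim_null_comparison[where g="\<lambda>x. C * std_normal_density x"]; simp)+
  qed
  hence "(LBINT x=-\<infinity>..\<infinity>. f' x * std_normal_density x - f x * (x * std_normal_density x)) = 0 - 0"
    using i1 i2 dphi
    by (intro interval_integral_FTC_integrable[where F=F])
       (auto simp: dF has_real_derivative_iff_has_vector_derivative[symmetric] ereal_tendsto_simps set_integrable_def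
         mult_ac intro!: continuous_intros f' cf DERIV_isCont[OF dphi])
  hence "(\<integral>x. std_normal_density x * f' x - std_normal_density x * (x * f x) \<partial>lborel) = 0"
    by (simp add: interval_lebesgue_integral_def set_lebesgue_integral_def mult_ac)
  thus ?thesis using i1 i2 by (simp add: integral_density)
qed

locale gaussian_vector = prob_space M for M :: "'a measure" +
  fixes J :: "'i set" and X :: "'i \<Rightarrow> 'a \<Rightarrow> real"
  assumes finite_J: "finite J"
    and gaussian: "\<And>c. gaussian_rv M (\<lambda>\<omega>. \<Sum>j\<in>J. c j * X j \<omega>)"
    and centered: "\<And>j. j \<in> J \<Longrightarrow> expectation (X j) = 0"
begin

definition lin :: "('i \<Rightarrow> real) \<Rightarrow> 'a \<Rightarrow> real" where "lin c \<omega> = (\<Sum>j\<in>J. c j * X j \<omega>)"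

lemma lin_unit: "j \<in> J \<Longrightarrow> lin (\<lambda>i. if i = j then 1 else 0) = X j"
  using finite_J by (auto simp: lin_def fun_eq_iff if_distrib if_distribR cong: if_cong)

lemma lin_measurable [measurable]: "lin c \<in> borel_measurable M"
  using gaussian[of c] by (simp add: gaussian_rv_def lin_def[abs_def])

lemma X_measurable [measurable]: "j \<in> J \<Longrightarrow> X j \<in> borel_measurable M"
  using lin_measurable[of "\<lambda>i. if i = j then 1 else 0"] lin_unit by simp

lemma gaussian_integrable:
  assumes "gaussian_rv M Y" "expectation Y = 0"
  shows "integrable M Y" "integrable M (\<lambda>\<omega>. (Y \<omega>)\<^sup>2)"
proof -
  from gaussian_rv_std[OF assms] obtain \<sigma> 
    where "distr M borel Y = distr std_normal_distribution borel (\<lambda>x. \<sigma> * x)" by blast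
  moreover have [measurable]: "Y \<in> borel_measurable M" using assms by (simp add: gaussian_rv_def)
  ultimately have *: "integrable M (\<lambda>\<omega>. f (Y \<omega>)) = integrable std_normal_distribution (\<lambda>x. f (\<sigma> * x))"
    if [measurable]: "f \<in> borel_measurable borel" for f :: "real \<Rightarrow> real"
    using integrable_distr_eq[of Y M borel f] integrable_distr_eq[of "\<lambda>x. \<sigma> * x" std_normal_distribution borel f]
    by simp
  show "integrable M Y" "integrable M (\<lambda>\<omega>. (Y \<omega>)\<^sup>2)"
    using *[of "\<lambda>x. x"] *[of "\<lambda>x. x\<^sup>2"] integrable_std_normal_distribution_moment[of 1]
      integrable_std_normal_distribution_moment[of 2] by (simp_all add: power_mult_distrib)
qed

lemma X_gaussian: "j \<in> J \<Longrightarrow> gaussian_rv M (X j)"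
  using gaussian[of "\<lambda>i. if i = j then 1 else 0"] lin_unit[of j] by (simp add: lin_def[abs_def])

lemma X_integrable: "j \<in> J \<Longrightarrow> integrable M (X j)"
  and X_square_integrable: "j \<in> J \<Longrightarrow> integrable M (\<lambda>\<omega>. (X j \<omega>)\<^sup>2)"
  using gaussian_integrable[OF X_gaussian centered] by blast+

lemma lin_expectation: "expectation (lin c) = 0"
  unfolding lin_def[abs_def] using X_integrable centered
  by (subst Bochner_Integration.integral_sum) (auto simp: )

lemma lin_square_integrable: "integrable M (\<lambda>\<omega>. (lin c \<omega>)\<^sup>2)"
  using gaussian_integrable(2)[of "lin c"] gaussian[of c] lin_expectation[of c] by (simp add: lin_def[abs_def])

lemma lin_mult_integrable: "integrable M (\<lambda>\<omega>. lin c \<omega> * lin d \<omega>)"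
proof (rule Bochner_Integration.integrable_bound)
  show "integrable M (\<lambda>\<omega>. (lin c \<omega>)\<^sup>2 + (lin d \<omega>)\<^sup>2)"
    using lin_square_integrable by simp
  have "\<bar>a * b\<bar> \<le> a\<^sup>2 + b\<^sup>2" for a b :: real
    using sum_squares_bound[of "\<bar>a\<bar>" "\<bar>b\<bar>"] abs_ge_zero[of "a * b"] unfolding abs_mult power2_abs by linarith
  thus "AE \<omega> in M. norm (lin c \<omega> * lin d \<omega>) \<le> norm ((lin c \<omega>)\<^sup>2 + (lin d \<omega>)\<^sup>2)"
    by simp
qed simp

lemma X_mult_integrable: "i \<in> J \<Longrightarrow> j \<in> J \<Longrightarrow> integrable M (\<lambda>\<omega>. X i \<omega> * X j \<omega>)"
  using lin_mult_integrable[of "\<lambda>k. if k = i then 1 else 0" "\<lambda>k. if k = j then 1 else 0"] lin_unit by simp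

text \<open>The law of the whole vector depends only on the variances of its linear combinations;
  identities in law below are reduced to equalities of variances.\<close>

lemma char_lin: "(\<integral>\<omega>. iexp (lin c \<omega>) \<partial>M) = exp (- expectation (\<lambda>\<omega>. (lin c \<omega>)\<^sup>2) / 2)"
proof -
  from gaussian_rv_std[of "lin c"] gaussian[of c] lin_expectation[of c] obtain \<sigma> where \<sigma>: "0 \<le> \<sigma>"
    and distr: "distr M borel (lin c) = distr std_normal_distribution borel (\<lambda>x. \<sigma> * x)"
    unfolding lin_def[abs_def] by blast
  have "(\<integral>\<omega>. iexp (lin c \<omega>) \<partial>M) = (\<integral>x. iexp x \<partial>distr M borel (lin c))"
    by (simp add: integral_distr)
  also have "\<dots> = char std_normal_distribution \<sigma>"
    unfolding distr char_def by (simp add: integral_distr)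
  also have "\<dots> = exp (- (\<sigma>\<^sup>2) / 2)" by (simp add: char_std_normal_distribution)
  also have "\<sigma>\<^sup>2 = (\<integral>x. x\<^sup>2 \<partial>distr std_normal_distribution borel (\<lambda>x. \<sigma> * x))"
    using std_normal_distribution_even_moments(1)[of 1] 
    by (simp add: integral_distr power_mult_distrib)
  also have "\<dots> = expectation (\<lambda>\<omega>. (lin c \<omega>)\<^sup>2)"
    unfolding distr[symmetric] by (simp add: integral_distr)
  finally show ?thesis by simp
qed

section \<open>Stein's identity and multivariate Gaussian integration by parts\<close>

lemma Stein:
  fixes f f' :: "real \<Rightarrow> real"
  assumes k: "k \<in> J" and f: "\<And>x. (f has_real_derivative f' x) (at x)" and f': "\<And>x. isCont f' x"
    and bnd: "\<And>x. \<bar>f x\<bar> \<le> C" "\<And>x. \<bar>f' x\<bar> \<le> C"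
  shows "expectation (\<lambda>\<omega>. X k \<omega> * f (X k \<omega>)) = expectation (\<lambda>\<omega>. (X k \<omega>)\<^sup>2) * expectation (\<lambda>\<omega>. f' (X k \<omega>))"
proof -
  have cf: "isCont f x" for x using f by (rule DERIV_isCont)
  have [measurable]: "f \<in> borel_measurable borel" "f' \<in> borel_measurable borel"
    using cf f' by (auto intro!: borel_measurable_continuous_onI continuous_at_imp_continuous_on)
  from gaussian_rv_std[OF X_gaussian[OF k] centered[OF k]] obtain \<sigma> where \<sigma>: "0 \<le> \<sigma>"
    and distr: "distr M borel (X k) = distr std_normal_distribution borel (\<lambda>x. \<sigma> * x)" by blast
  note [measurable] = X_measurable[OF k]
  have *: "expectation (\<lambda>\<omega>. g (X k \<omega>)) = (\<integral>x. g (\<sigma> * x) \<partial>std_normal_distribution)" 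
    if [measurable]: "g \<in> borel_measurable borel" for g :: "real \<Rightarrow> real"
    using integral_distr[of "X k" M borel g] integral_distr[of "\<lambda>x. \<sigma> * x" std_normal_distribution borel g]
    unfolding distr by simp
  have "((\<lambda>x. f (\<sigma> * x)) has_real_derivative \<sigma> * f' (\<sigma> * x)) (at x)" for x
    by (rule DERIV_cong[OF DERIV_chain2[OF f]]) (auto intro!: derivative_eq_intros)
  moreover have "isCont (\<lambda>x. \<sigma> * f' (\<sigma> * x)) x" for x
    by (intro continuous_intros isCont_o2[OF _ f'])
  \<comment> \<open>A single constant has to bound both the rescaled function and its derivative,
    whence the maximum.\<close>
  moreover have "\<bar>f (\<sigma> * x)\<bar> \<le> max C (\<sigma> * C)" "\<bar>\<sigma> * f' (\<sigma> * x)\<bar> \<le> max C (\<sigma> * C)" for x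
    using bnd(1)[of "\<sigma> * x"] mult_left_mono[OF bnd(2)[of "\<sigma> * x"] \<sigma>] \<sigma> by (auto simp: abs_mult)
  ultimately have "(\<integral>x. x * f (\<sigma> * x) \<partial>std_normal_distribution) = (\<integral>x. \<sigma> * f' (\<sigma> * x) \<partial>std_normal_distribution)"
    by (rule std_normal_Stein)
  moreover have "expectation (\<lambda>\<omega>. (X k \<omega>)\<^sup>2) = \<sigma>\<^sup>2"
    using std_normal_distribution_even_moments(1)[of 1] by (subst *) (simp_all add: power_mult_distrib)
  moreover have "expectation (\<lambda>\<omega>. X k \<omega> * f (X k \<omega>)) = (\<integral>x. \<sigma> * x * f (\<sigma> * x) \<partial>std_normal_distribution)"
    using *[of "\<lambda>x. x * f x"] by simp
  ultimately show ?thesis using *[of f'] by (simp add: power2_eq_square mult.assoc)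
qed

lemma lin_mult_expectation: "k \<in> J \<Longrightarrow> expectation (\<lambda>\<omega>. lin c \<omega> * X k \<omega>) = (\<Sum>j\<in>J. c j * expectation (\<lambda>\<omega>. X k \<omega> * X j \<omega>))"
  unfolding lin_def sum_distrib_right using X_mult_integrable
  by (subst Bochner_Integration.integral_sum) (auto simp: mult_ac intro!: sum.cong)

lemma vector_measurable [measurable]: "(\<lambda>\<omega>. \<lambda>j\<in>J. X j \<omega>) \<in> measurable M (Pi\<^sub>M J (\<lambda>_. borel))"
  by (rule measurable_restrict) simp

text \<open>Subtracting from the vector its regression on one coordinate makes it independent of that
  coordinate.\<close>

lemma distr_regression:
  assumes k: "k \<in> J" and pos: "expectation (\<lambda>\<omega>. (X k \<omega>)\<^sup>2) \<noteq> 0"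
    and b: "\<And>j. b j = expectation (\<lambda>\<omega>. X k \<omega> * X j \<omega>) / expectation (\<lambda>\<omega>. (X k \<omega>)\<^sup>2)"
  shows "distr M (Pi\<^sub>M J (\<lambda>_. borel)) (\<lambda>\<omega>. \<lambda>j\<in>J. X j \<omega>)
    = distr (M \<Otimes>\<^sub>M M) (Pi\<^sub>M J (\<lambda>_. borel)) (\<lambda>p. \<lambda>j\<in>J. b j * X k (fst p) + (X j (snd p) - b j * X k (snd p)))"
proof (rule vector_Levy_uniqueness[OF finite_J])
  interpret MM: pair_prob_space M M ..
  show "prob_space M" "prob_space (M \<Otimes>\<^sub>M M)" by unfold_locales
  note [measurable] = X_measurable[OF k]
  show "(\<lambda>p. b j * X k (fst p) + (X j (snd p) - b j * X k (snd p))) \<in> borel_measurable (M \<Otimes>\<^sub>M M)" if "j \<in> J" for j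
  proof -
    note [measurable] = X_measurable[OF that]
    show ?thesis by measurable
  qed
  fix c :: "'i \<Rightarrow> real"
  define V where "V = expectation (\<lambda>\<omega>. (X k \<omega>)\<^sup>2)"
  \<comment> \<open>\<open>\<beta>\<close> is the regression coefficient of \<open>lin c\<close> on
    \<open>X k\<close>; \<open>c1\<close> produces the regressed part \<open>\<beta> * X k\<close>
    and \<open>c2\<close> the residual.\<close>
  define \<beta> where "\<beta> = (\<Sum>j\<in>J. c j * b j)"
  define c1 where "c1 i = (if i = k then \<beta> else 0)" for i
  define c2 where "c2 i = c i - c1 i" for i
  have c1: "lin c1 \<omega> = \<beta> * X k \<omega>" for \<omega>
    using finite_J k by (auto simp: lin_def c1_def if_distribR if_distrib[of "\<lambda>x. x * _"] cong: if_cong)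
  have c2: "lin c2 \<omega> = lin c \<omega> - \<beta> * X k \<omega>" for \<omega>
    unfolding c1[symmetric] by (simp add: lin_def c2_def left_diff_distrib sum_subtractf)
  have sum: "(\<Sum>j\<in>J. c j * (b j * X k (fst p) + (X j (snd p) - b j * X k (snd p)))) = lin c1 (fst p) + lin c2 (snd p)" for p
    unfolding c1 c2 by (simp add: lin_def \<beta>_def algebra_simps sum.distrib sum_subtractf sum_distrib_left sum_distrib_right)
  have "expectation (\<lambda>\<omega>. lin c \<omega> * X k \<omega>) = V * \<beta>"
    using pos by (simp add: lin_mult_expectation[OF k] \<beta>_def b sum_distrib_left V_def)
  moreover have "integrable M (\<lambda>\<omega>. lin c \<omega> * X k \<omega>)"
    using lin_mult_integrable[of c "\<lambda>i. if i = k then 1 else 0"] lin_unit[OF k] by simp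
  moreover have "expectation (\<lambda>\<omega>. (lin c2 \<omega>)\<^sup>2) = expectation (\<lambda>\<omega>. (lin c \<omega>)\<^sup>2 + ((\<beta>\<^sup>2 * (X k \<omega>)\<^sup>2) - 2 * \<beta> * (lin c \<omega> * X k \<omega>)))"
    unfolding c2 by (intro Bochner_Integration.integral_cong) (auto simp: power2_eq_square algebra_simps)
  ultimately have "expectation (\<lambda>\<omega>. (lin c2 \<omega>)\<^sup>2) = expectation (\<lambda>\<omega>. (lin c \<omega>)\<^sup>2) + (\<beta>\<^sup>2 * V - 2 * \<beta> * (V * \<beta>))"
    using lin_square_integrable[of c] X_square_integrable[OF k] by (simp add: V_def)
  moreover have "expectation (\<lambda>\<omega>. (lin c1 \<omega>)\<^sup>2) = \<beta>\<^sup>2 * V"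
    unfolding c1 by (simp add: power_mult_distrib V_def)
  \<comment> \<open>Pythagoras: the residual is uncorrelated with \<open>X k\<close>, so the two
    variances, and with them the exponents of the characteristic functions, add up.\<close>
  ultimately have split: "expectation (\<lambda>\<omega>. (lin c1 \<omega>)\<^sup>2) + expectation (\<lambda>\<omega>. (lin c2 \<omega>)\<^sup>2) = expectation (\<lambda>\<omega>. (lin c \<omega>)\<^sup>2)"
    by (simp add: power2_eq_square algebra_simps)
  have exp_half: "exp (- x / 2) * exp (- y / 2) = exp (- (x + y) / 2)" for x y :: real
    unfolding exp_add[symmetric] by (simp add: field_simps)
  have int: "integrable (M \<Otimes>\<^sub>M M) (\<lambda>p. iexp (lin c1 (fst p)) * iexp (lin c2 (snd p)))"
    by (rule MM.integrable_const_bound[where B=1]) (auto simp: norm_mult)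
  have "(\<integral>p. iexp (lin c1 (fst p) + lin c2 (snd p)) \<partial>(M \<Otimes>\<^sub>M M))
      = (\<integral>p. iexp (lin c1 (fst p)) * iexp (lin c2 (snd p)) \<partial>(M \<Otimes>\<^sub>M M))"
    by (simp add: exp_add ring_distribs)
  also have "\<dots> = (\<integral>x. \<integral>y. iexp (lin c1 x) * iexp (lin c2 y) \<partial>M \<partial>M)"
    using MM.integral_fst'[OF int] by simp
  also have "\<dots> = (\<integral>x. iexp (lin c1 x) \<partial>M) * (\<integral>y. iexp (lin c2 y) \<partial>M)"
    by simp
  also have "\<dots> = complex_of_real (exp (- (expectation (\<lambda>\<omega>. (lin c1 \<omega>)\<^sup>2) + expectation (\<lambda>\<omega>. (lin c2 \<omega>)\<^sup>2)) / 2))"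
    unfolding char_lin of_real_mult[symmetric] exp_half ..
  also have "\<dots> = (\<integral>\<omega>. iexp (lin c \<omega>) \<partial>M)" unfolding split char_lin ..
  finally show "(\<integral>\<omega>. iexp (\<Sum>j\<in>J. c j * X j \<omega>) \<partial>M) = 
     (\<integral>p. iexp (\<Sum>j\<in>J. c j * (b j * X k (fst p) + (X j (snd p) - b j * X k (snd p)))) \<partial>(M \<Otimes>\<^sub>M M))"
    unfolding sum by (simp only: lin_def)
qed simp

text \<open>In the product representation of \<open>distr_regression\<close>, freezing the residual
  turns \<open>F\<close> into a function of the single Gaussian variable \<open>X k\<close>,
  evaluated along a line with direction \<open>b\<close>. The one-dimensional identity applies
  there, and \<open>V * b j\<close> is the covariance of \<open>X k\<close> and \<open>X j\<close>.
  This is why differentiability is demanded along lines only.\<close>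

lemma integration_by_parts:
  fixes F :: "('i \<Rightarrow> real) \<Rightarrow> real" and F' :: "'i \<Rightarrow> ('i \<Rightarrow> real) \<Rightarrow> real"
  assumes k: "k \<in> J"
    and F [measurable]: "F \<in> borel_measurable (Pi\<^sub>M J (\<lambda>_. borel))"
    and F' [measurable]: "\<And>j. j \<in> J \<Longrightarrow> F' j \<in> borel_measurable (Pi\<^sub>M J (\<lambda>_. borel))"
    and deriv: "\<And>x b v. ((\<lambda>v. F (\<lambda>j\<in>J. b j * v + x j)) has_real_derivative
        (\<Sum>j\<in>J. b j * F' j (\<lambda>j\<in>J. b j * v + x j))) (at v)"
    and cont: "\<And>x b j v. j \<in> J \<Longrightarrow> isCont (\<lambda>v. F' j (\<lambda>j\<in>J. b j * v + x j)) v"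
    and bnd: "\<And>x. \<bar>F x\<bar> \<le> C" "\<And>j x. j \<in> J \<Longrightarrow> \<bar>F' j x\<bar> \<le> C"
  shows "expectation (\<lambda>\<omega>. X k \<omega> * F (\<lambda>j\<in>J. X j \<omega>))
    = (\<Sum>j\<in>J. expectation (\<lambda>\<omega>. X k \<omega> * X j \<omega>) * expectation (\<lambda>\<omega>. F' j (\<lambda>i\<in>J. X i \<omega>)))"
proof (cases "expectation (\<lambda>\<omega>. (X k \<omega>)\<^sup>2) = 0")
  \<comment> \<open>Without variance there is no regression, but \<open>X k\<close> vanishes almost
    surely and both sides are 0.\<close>
  case True
  note [measurable] = X_measurable[OF k]
  have ae: "AE \<omega> in M. X k \<omega> = 0"
    using True X_square_integrable[OF k] by (simp add: integral_nonneg_eq_0_iff_AE)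
  have "expectation (\<lambda>\<omega>. X k \<omega> * f \<omega>) = 0" if [measurable]: "f \<in> borel_measurable M" for f
  proof -
    have "expectation (\<lambda>\<omega>. X k \<omega> * f \<omega>) = expectation (\<lambda>\<omega>. 0)"
      using ae by (intro integral_cong_AE) auto
    thus ?thesis by simp
  qed
  thus ?thesis by simp
next
  case False
  interpret MM: pair_prob_space M M ..
  note [measurable] = X_measurable[OF k]
  let ?P = "Pi\<^sub>M J (\<lambda>_. borel :: real measure)"
  define V where "V = expectation (\<lambda>\<omega>. (X k \<omega>)\<^sup>2)"
  define b where "b j = expectation (\<lambda>\<omega>. X k \<omega> * X j \<omega>) / V" for j
  have V: "V \<noteq> 0" and bk: "b k = 1" using False by (simp_all add: V_def b_def power2_eq_square)
  define R where "R \<omega> j = X j \<omega> - b j * X k \<omega>" for \<omega> j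
  define X' where "X' p = (\<lambda>j\<in>J. b j * X k (fst p) + R (snd p) j)" for p
  have X'_m [measurable]: "X' \<in> measurable (M \<Otimes>\<^sub>M M) ?P"
    unfolding X'_def R_def
  proof (rule measurable_restrict)
    fix j assume "j \<in> J"
    note [measurable] = X_measurable[OF this]
    show "(\<lambda>p. b j * X k (fst p) + (X j (snd p) - b j * X k (snd p))) \<in> borel_measurable (M \<Otimes>\<^sub>M M)"
      by measurable
  qed
  have distr: "distr M ?P (\<lambda>\<omega>. \<lambda>j\<in>J. X j \<omega>) = distr (M \<Otimes>\<^sub>M M) ?P X'"
    using distr_regression[OF k False, of b] by (simp add: b_def V_def X'_def[abs_def] R_def)
  \<comment> \<open>The residual variable \<open>\<omega>2\<close> is integrated last, so it is
    constant in the inner integral.\<close>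
  have transfer: "expectation (\<lambda>\<omega>. h (\<lambda>j\<in>J. X j \<omega>)) = (\<integral>\<omega>2. \<integral>\<omega>1. h (X' (\<omega>1, \<omega>2)) \<partial>M \<partial>M)"
    if [measurable]: "h \<in> borel_measurable ?P" and int: "integrable M (\<lambda>\<omega>. h (\<lambda>j\<in>J. X j \<omega>))" for h :: "_ \<Rightarrow> real"
  proof -
    have "integrable (distr M ?P (\<lambda>\<omega>. \<lambda>j\<in>J. X j \<omega>)) h"
      using int by (subst integrable_distr_eq) auto
    hence int2: "integrable (M \<Otimes>\<^sub>M M) (\<lambda>p. h (X' p))"
      unfolding distr by (subst (asm) integrable_distr_eq) auto
    have "expectation (\<lambda>\<omega>. h (\<lambda>j\<in>J. X j \<omega>)) = (\<integral>x. h x \<partial>distr M ?P (\<lambda>\<omega>. \<lambda>j\<in>J. X j \<omega>))"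
      by (simp add: integral_distr)
    also have "\<dots> = (\<integral>p. h (X' p) \<partial>(M \<Otimes>\<^sub>M M))" unfolding distr by (simp add: integral_distr)
    also have "\<dots> = (\<integral>\<omega>2. \<integral>\<omega>1. h (X' (\<omega>1, \<omega>2)) \<partial>M \<partial>M)"
      using MM.integral_snd[of "\<lambda>\<omega>1 \<omega>2. h (X' (\<omega>1, \<omega>2))"] int2 by (simp add: case_prod_beta')
    finally show ?thesis .
  qed
  have comp_k [measurable]: "(\<lambda>x. x k) \<in> borel_measurable ?P"
    using k by (rule measurable_component_singleton)
  have int: "integrable M (\<lambda>\<omega>. X k \<omega> * F (\<lambda>j\<in>J. X j \<omega>))"
  proof (rule Bochner_Integration.integrable_bound)
    show "integrable M (\<lambda>\<omega>. C * X k \<omega>)" using X_integrable[OF k] by simp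
    show "AE \<omega> in M. norm (X k \<omega> * F (\<lambda>j\<in>J. X j \<omega>)) \<le> norm (C * X k \<omega>)"
    proof (intro AE_I2)
      fix \<omega>
      have "\<bar>F (\<lambda>j\<in>J. X j \<omega>)\<bar> \<le> \<bar>C\<bar>" using bnd(1)[of "\<lambda>j\<in>J. X j \<omega>"] by linarith
      thus "norm (X k \<omega> * F (\<lambda>j\<in>J. X j \<omega>)) \<le> norm (C * X k \<omega>)"
        unfolding real_norm_def abs_mult by (subst mult.commute) (rule mult_right_mono; simp)
    qed
  qed simp
  have int': "integrable M (\<lambda>\<omega>. F' j (\<lambda>j\<in>J. X j \<omega>))" if "j \<in> J" for j
  proof (rule integrable_const_bound[where B=C])
    note [measurable] = F'[OF that]
    show "(\<lambda>\<omega>. F' j (\<lambda>j\<in>J. X j \<omega>)) \<in> borel_measurable M" by measurable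
  qed (use bnd(2)[OF that] in auto)
  have Stein_k: "(\<integral>\<omega>1. X k \<omega>1 * F (X' (\<omega>1, \<omega>2)) \<partial>M) = V * (\<integral>\<omega>1. (\<Sum>j\<in>J. b j * F' j (X' (\<omega>1, \<omega>2))) \<partial>M)" for \<omega>2
  proof -
    have le: "\<bar>\<Sum>j\<in>J. b j * F' j x\<bar> \<le> (\<Sum>j\<in>J. \<bar>b j\<bar> * C)" for x
      by (rule order_trans[OF sum_abs]) (auto intro!: sum_mono mult_left_mono bnd simp: abs_mult)
    show ?thesis unfolding X'_def fst_conv snd_conv V_def
    proof (rule Stein[OF k, where C="max C (\<Sum>j\<in>J. \<bar>b j\<bar> * C)"])
      show "((\<lambda>v. F (\<lambda>j\<in>J. b j * v + R \<omega>2 j)) has_real_derivative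
          (\<Sum>j\<in>J. b j * F' j (\<lambda>j\<in>J. b j * x + R \<omega>2 j))) (at x)" for x by (rule deriv)
      show "isCont (\<lambda>x. \<Sum>j\<in>J. b j * F' j (\<lambda>j\<in>J. b j * x + R \<omega>2 j)) x" for x
        by (intro continuous_sum continuous_mult continuous_const cont)
      show "\<bar>F (\<lambda>j\<in>J. b j * x + R \<omega>2 j)\<bar> \<le> max C (\<Sum>j\<in>J. \<bar>b j\<bar> * C)" for x
        using bnd(1) by (rule max.coboundedI1)
      show "\<bar>\<Sum>j\<in>J. b j * F' j (\<lambda>j\<in>J. b j * x + R \<omega>2 j)\<bar> \<le> max C (\<Sum>j\<in>J. \<bar>b j\<bar> * C)" for x
        using le by (rule max.coboundedI2)
    qed
  qed
  have iF': "integrable M (\<lambda>\<omega>1. F' j (X' (\<omega>1, \<omega>2)))" if "j \<in> J" "\<omega>2 \<in> space M" for j \<omega>2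
  proof (rule integrable_const_bound[where B=C])
    note [measurable] = F'[OF that(1)]
    show "(\<lambda>\<omega>1. F' j (X' (\<omega>1, \<omega>2))) \<in> borel_measurable M" using that(2) by measurable
  qed (use bnd(2)[OF that(1)] in auto)
  \<comment> \<open>Because \<open>b k = 1\<close>, coordinate \<open>k\<close> has residual 0, so
    \<open>X' (\<omega>1, \<omega>2) k = X k \<omega>1\<close>.\<close>
  have "expectation (\<lambda>\<omega>. X k \<omega> * F (\<lambda>j\<in>J. X j \<omega>)) = (\<integral>\<omega>2. \<integral>\<omega>1. X k \<omega>1 * F (X' (\<omega>1, \<omega>2)) \<partial>M \<partial>M)"
    using transfer[of "\<lambda>x. x k * F x"] int k bk by (simp add: X'_def R_def)
  also have "\<dots> = (\<integral>\<omega>2. (\<Sum>j\<in>J. V * b j * (\<integral>\<omega>1. F' j (X' (\<omega>1, \<omega>2)) \<partial>M)) \<partial>M)"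
    unfolding Stein_k
    by (intro Bochner_Integration.integral_cong refl, subst Bochner_Integration.integral_sum)
       (auto simp: iF' sum_distrib_left mult.assoc)
  also have "\<dots> = (\<Sum>j\<in>J. V * b j * (\<integral>\<omega>2. \<integral>\<omega>1. F' j (X' (\<omega>1, \<omega>2)) \<partial>M \<partial>M))"
  proof (subst Bochner_Integration.integral_sum)
    fix j assume j: "j \<in> J"
    note [measurable] = F'[OF j]
    have "integrable (M \<Otimes>\<^sub>M M) (\<lambda>p. F' j (X' p))"
      by (rule MM.integrable_const_bound[where B=C]) (use bnd(2)[OF j] in auto)
    hence "integrable M (\<lambda>\<omega>2. \<integral>\<omega>1. F' j (X' (\<omega>1, \<omega>2)) \<partial>M)"
      using MM.integrable_snd[of "\<lambda>\<omega>1 \<omega>2. F' j (X' (\<omega>1, \<omega>2))"] by (simp add: case_prod_beta')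
    thus "integrable M (\<lambda>\<omega>2. V * b j * (\<integral>\<omega>1. F' j (X' (\<omega>1, \<omega>2)) \<partial>M))" by simp
  qed simp
  also have "\<dots> = (\<Sum>j\<in>J. expectation (\<lambda>\<omega>. X k \<omega> * X j \<omega>) * expectation (\<lambda>\<omega>. F' j (\<lambda>i\<in>J. X i \<omega>)))"
    using V by (intro sum.cong refl) (simp add: b_def transfer[OF F' int'])
  finally show ?thesis .
qed

text \<open>The characteristic function depends on \<open>c\<close> through a square, hence is
  even.\<close>

lemma distr_uminus:
  "distr M (Pi\<^sub>M J (\<lambda>_. borel)) (\<lambda>\<omega>. \<lambda>j\<in>J. X j \<omega>) = distr M (Pi\<^sub>M J (\<lambda>_. borel)) (\<lambda>\<omega>. \<lambda>j\<in>J. - X j \<omega>)"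
proof (rule vector_Levy_uniqueness[OF finite_J])
  fix c :: "'i \<Rightarrow> real"
  have "(\<Sum>j\<in>J. c j * - X j \<omega>) = lin (\<lambda>j. - c j) \<omega>" for \<omega> by (simp add: lin_def)
  moreover have "(lin (\<lambda>j. - c j) \<omega>)\<^sup>2 = (lin c \<omega>)\<^sup>2" for \<omega> by (simp add: lin_def sum_negf)
  ultimately show "(\<integral>\<omega>. iexp (\<Sum>j\<in>J. c j * X j \<omega>) \<partial>M) = (\<integral>\<omega>. iexp (\<Sum>j\<in>J. c j * - X j \<omega>) \<partial>M)"
    using char_lin[of c] char_lin[of "\<lambda>j. - c j"] by (simp only: lin_def)
qed (simp_all add: prob_space_axioms)

end

section \<open>The smoothed oscillation\<close>

locale log_sum_exp =
  fixes J :: "'i set" and \<kappa> :: real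
  assumes finite_J: "finite J" and nonempty: "J \<noteq> {}" and \<kappa>_nonneg: "0 \<le> \<kappa>"
begin

text \<open>The double sum of \<open>exp (x i - x j)\<close> factors as \<open>P x * Q x\<close>,
  which keeps the derivatives short.\<close>

definition P :: "('i \<Rightarrow> real) \<Rightarrow> real" where "P x = (\<Sum>j\<in>J. exp (x j))"
definition Q :: "('i \<Rightarrow> real) \<Rightarrow> real" where "Q x = (\<Sum>j\<in>J. exp (- x j))"
definition S :: "('i \<Rightarrow> real) \<Rightarrow> real" where "S x = \<kappa> + P x * Q x"
definition G :: "('i \<Rightarrow> real) \<Rightarrow> real" where "G x = ln (S x)"
text \<open>\<open>D i\<close> is the partial derivative of \<open>S\<close>; \<open>dG i\<close>
  and \<open>ddG i j\<close> are the gradient and Hessian entries of \<open>G\<close>, all in closed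
  form. The gradient enters through the tangent inequality \<open>G_convex\<close>, the Hessian
  through \<open>dG_line_deriv\<close>.\<close>

definition D :: "'i \<Rightarrow> ('i \<Rightarrow> real) \<Rightarrow> real" where "D i x = exp (x i) * Q x - exp (- x i) * P x"
definition dG :: "'i \<Rightarrow> ('i \<Rightarrow> real) \<Rightarrow> real" where "dG i x = D i x / S x"
definition ddG :: "'i \<Rightarrow> 'i \<Rightarrow> ('i \<Rightarrow> real) \<Rightarrow> real" where
  "ddG i j x = ((if i = j then exp (x i) * Q x + exp (- x i) * P x else 0)
     - (exp (x i) * exp (- x j) + exp (- x i) * exp (x j))) / S x - D i x * D j x / (S x)\<^sup>2"

lemma P_pos: "0 < P x" and Q_pos: "0 < Q x"
  unfolding P_def Q_def using finite_J nonempty by (auto intro!: sum_pos)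

lemma exp_le_P: "i \<in> J \<Longrightarrow> exp (x i) \<le> P x" and exp_le_Q: "i \<in> J \<Longrightarrow> exp (- x i) \<le> Q x"
  unfolding P_def Q_def using finite_J 
  by (auto intro: member_le_sum[where f="\<lambda>j. exp (x j)"] member_le_sum[where f="\<lambda>j. exp (- x j)"])

lemma S_pos: "0 < S x"
  unfolding S_def using mult_pos_pos[OF P_pos Q_pos] \<kappa>_nonneg by (rule add_nonneg_pos[rotated])

text \<open>All exponentials in the derivatives of \<open>G\<close> are dominated by
  \<open>S\<close>, so those derivatives are bounded uniformly in \<open>x\<close> and
  \<kappa>.\<close>

lemma products_le_S: 
  assumes "i \<in> J" "j \<in> J"
  shows "exp (x i) * Q x \<le> S x" "exp (- x i) * P x \<le> S x" "exp (x i) * exp (- x j) \<le> S x"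
proof -
  have *: "P x * Q x \<le> S x" using \<kappa>_nonneg by (simp add: S_def)
  have "exp (x i) * Q x \<le> P x * Q x"
    using exp_le_P[OF assms(1)] Q_pos by (intro mult_right_mono) (auto intro: less_imp_le)
  moreover have "exp (- x i) * P x \<le> Q x * P x"
    using exp_le_Q[OF assms(1)] P_pos by (intro mult_right_mono) (auto intro: less_imp_le)
  moreover have "exp (x i) * exp (- x j) \<le> P x * Q x"
    using exp_le_P[OF assms(1)] exp_le_Q[OF assms(2)] P_pos by (intro mult_mono) (auto intro: less_imp_le)
  ultimately show "exp (x i) * Q x \<le> S x" "exp (- x i) * P x \<le> S x" "exp (x i) * exp (- x j) \<le> S x"
    using * by (auto simp: mult.commute)
qed

lemma one_le_S: "1 \<le> S x"
proof -
  from nonempty obtain i where "i \<in> J" by blast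
  from products_le_S(3)[OF this this, of x] show ?thesis by (simp flip: exp_add)
qed

lemma G_nonneg: "0 \<le> G x" using one_le_S by (simp add: G_def)

lemma D_abs_le_S: "i \<in> J \<Longrightarrow> \<bar>D i x\<bar> \<le> S x"
proof -
  assume i: "i \<in> J"
  have "0 \<le> exp (x i) * Q x" "0 \<le> exp (- x i) * P x" using P_pos[of x] Q_pos[of x] by simp_all
  with products_le_S(1,2)[OF i i, of x] show ?thesis unfolding D_def by linarith
qed

lemma dG_bound: "i \<in> J \<Longrightarrow> \<bar>dG i x\<bar> \<le> 1"
  using D_abs_le_S[of i x] S_pos[of x] by (simp add: dG_def)

text \<open>Each of the two parts of the first numerator is at most \<open>2 * S x\<close>, giving
  4; the product of first derivatives adds 1.\<close>

lemma ddG_bound: 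
  assumes "i \<in> J" "j \<in> J" 
  shows "\<bar>ddG i j x\<bar> \<le> 5"
proof -
  define A where "A = (if i = j then exp (x i) * Q x + exp (- x i) * P x else 0)"
  have pos: "0 \<le> exp (x i) * Q x" "0 \<le> exp (- x i) * P x" using P_pos[of x] Q_pos[of x] by simp_all
  have A: "0 \<le> A" "A \<le> 2 * S x"
    using products_le_S(1,2)[OF assms, of x] pos S_pos[of x] by (auto simp: A_def)
  define E where "E = exp (x i) * exp (- x j) + exp (- x i) * exp (x j)"
  have E: "0 \<le> E" "E \<le> 2 * S x"
    using products_le_S(3)[OF assms, of x] products_le_S(3)[OF assms(2,1), of x] by (auto simp: E_def mult.commute)
  have "\<bar>A - E\<bar> \<le> 4 * S x" using A E S_pos[of x] by linarith
  hence 1: "\<bar>(A - E) / S x\<bar> \<le> 4"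
    using S_pos[of x] by (simp add: field_simps)
  have "\<bar>D i x * D j x\<bar> \<le> S x * S x"
    unfolding abs_mult by (intro mult_mono D_abs_le_S assms) (use S_pos[of x] in auto)
  hence 2: "\<bar>D i x * D j x / (S x)\<^sup>2\<bar> \<le> 1"
    using S_pos[of x] by (simp add: power2_eq_square)
  show ?thesis using abs_triangle_ineq4[of "(A - E) / S x" "D i x * D j x / (S x)\<^sup>2"] 1 2
    unfolding ddG_def A_def[symmetric] E_def[symmetric] by linarith
qed

lemma ddG_sym: "ddG i j x = ddG j i x"
  unfolding ddG_def by (auto simp: mult.commute add.commute)

text \<open>With \<open>a = exp (x i)\<close> and \<open>b = exp (x j)\<close>, the mixed terms
  \<open>- (a / b + b / a) * P x * Q x\<close> of \<open>D i x * D j x\<close> cancel the share of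
  \<open>P x * Q x\<close> in \<open>S x\<close>. Only nonnegative terms are left behind the overall
  minus sign.\<close>

lemma ddG_nonpos: 
  assumes "i \<noteq> j" 
  shows "ddG i j x \<le> 0"
proof -
  define a b where "a = exp (x i)" and "b = exp (x j)"
  have ab: "a > 0" "b > 0" and inv: "exp (- x i) = 1 / a" "exp (- x j) = 1 / b"
    by (simp_all add: a_def b_def exp_minus inverse_eq_divide)
  have "(a * (1 / b) + (1 / a) * b) * S x + (a * Q x - 1 / a * P x) * (b * Q x - 1 / b * P x)
     = (a * (1 / b) + (1 / a) * b) * \<kappa> + a * b * (Q x)\<^sup>2 + (P x)\<^sup>2 / (a * b)"
    using ab unfolding S_def by (simp add: field_simps power2_eq_square)
  also have "\<dots> \<ge> 0" using ab \<kappa>_nonneg by simp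
  finally have *: "0 \<le> (a * (1 / b) + (1 / a) * b) * S x + D i x * D j x"
    unfolding D_def inv a_def[symmetric] b_def[symmetric] .
  have "ddG i j x = - ((a * (1 / b) + (1 / a) * b) * S x + D i x * D j x) / (S x)\<^sup>2"
    using assms S_pos[of x] unfolding ddG_def inv a_def[symmetric] b_def[symmetric]
    by (simp add: power2_eq_square diff_divide_distrib add_divide_distrib)
  also have "\<dots> \<le> 0" using * by (simp add: divide_nonpos_nonneg)
  finally show ?thesis .
qed

text \<open>Infinitesimal form of the invariance of \<open>G\<close> under adding one constant to
  all coordinates.\<close>

lemma sum_ddG: 
  assumes "i \<in> J" 
  shows "(\<Sum>j\<in>J. ddG i j x) = 0"
proof -
  have "(\<Sum>j\<in>J. D j x) = P x * Q x - Q x * P x"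
    unfolding D_def sum_subtractf sum_distrib_right[symmetric] by (simp only: P_def Q_def)
  hence D0: "(\<Sum>j\<in>J. D j x) = 0" by simp
  have "(\<Sum>j\<in>J. ddG i j x) = (exp (x i) * Q x + exp (- x i) * P x - (exp (x i) * Q x + exp (- x i) * P x)) / S x - D i x * (\<Sum>j\<in>J. D j x) / (S x)\<^sup>2"
    using assms finite_J 
    by (simp add: ddG_def sum_subtractf sum.distrib sum_divide_distrib[symmetric] sum_distrib_left[symmetric])
       (simp add: P_def Q_def)
  thus ?thesis using D0 by simp
qed

text \<open>Because the rows of the Hessian sum to 0, \<open>\<Delta> i j\<close> may be replaced by
  minus half of \<open>\<Delta> i i + \<Delta> j j - 2 * \<Delta> i j\<close>. So only variances of
  increments matter: the diagonal drops out, and off the diagonal a nonpositive entry meets a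
  nonpositive factor.\<close>

lemma sum_ddG_nonneg:
  assumes "\<And>i j. i \<in> J \<Longrightarrow> j \<in> J \<Longrightarrow> 0 \<le> \<Delta> i i + \<Delta> j j - 2 * \<Delta> i j"
  shows "0 \<le> (\<Sum>i\<in>J. \<Sum>j\<in>J. \<Delta> i j * ddG i j x)"
proof -
  have 1: "(\<Sum>i\<in>J. \<Sum>j\<in>J. \<Delta> i i * ddG i j x) = 0"
    by (rule sum.neutral, rule ballI) (simp add: sum_distrib_left[symmetric] sum_ddG)
  have 2: "(\<Sum>i\<in>J. \<Sum>j\<in>J. \<Delta> j j * ddG i j x) = 0"
    by (subst sum.swap, rule sum.neutral, rule ballI)
       (subst ddG_sym, simp only: sum_distrib_left[symmetric] sum_ddG mult_zero_right)
  have "(\<Sum>i\<in>J. \<Sum>j\<in>J. (\<Delta> i i + \<Delta> j j - 2 * \<Delta> i j) * ddG i j x) \<le> 0"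
  proof (intro sum_nonpos)
    fix i j assume ij: "i \<in> J" "j \<in> J"
    show "(\<Delta> i i + \<Delta> j j - 2 * \<Delta> i j) * ddG i j x \<le> 0"
      using assms[OF ij] ddG_nonpos[of i j x] by (cases "i = j") (auto intro: mult_nonneg_nonpos)
  qed
  also have "(\<Sum>i\<in>J. \<Sum>j\<in>J. (\<Delta> i i + \<Delta> j j - 2 * \<Delta> i j) * ddG i j x)
     = (\<Sum>i\<in>J. \<Sum>j\<in>J. \<Delta> i i * ddG i j x) + (\<Sum>i\<in>J. \<Sum>j\<in>J. \<Delta> j j * ddG i j x) - 2 * (\<Sum>i\<in>J. \<Sum>j\<in>J. \<Delta> i j * ddG i j x)"
    by (simp add: left_diff_distrib distrib_right sum_subtractf sum.distrib sum_distrib_left mult.assoc)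
  finally show ?thesis using 1 2 by simp
qed

text \<open>Jensen's inequality for \<open>exp\<close>, with weights \<open>w i j / S x\<close> at
  the values \<open>t i j\<close> and \<open>\<kappa> / S x\<close> at the value 0. The mean of
  these values is \<open>m\<close>, so that \<open>exp m * S x \<le> S y\<close>.\<close>

lemma G_convex: "G x + (\<Sum>i\<in>J. dG i x * (y i - x i)) \<le> G y"
proof -
  define m where "m = (\<Sum>i\<in>J. dG i x * (y i - x i))"
  define t where "t i j = (y i - x i) - (y j - x j)" for i j
  define w where "w i j = exp (x i) * exp (- x j)" for i j
  have SS: "P z * Q z = (\<Sum>i\<in>J. \<Sum>j\<in>J. exp (z i) * exp (- z j))" for z
    by (simp add: P_def Q_def sum_product)
  have mS: "m * S x = (\<Sum>i\<in>J. \<Sum>j\<in>J. w i j * t i j)"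
  proof -
    define d where "d i = y i - x i" for i
    have "m * S x = (\<Sum>i\<in>J. D i x * d i)"
      using S_pos[of x] by (simp add: m_def dG_def sum_distrib_right d_def)
    also have "\<dots> = (\<Sum>i\<in>J. exp (x i) * d i * Q x - exp (- x i) * d i * P x)"
      by (intro sum.cong refl) (simp add: D_def algebra_simps)
    also have "\<dots> = (\<Sum>i\<in>J. exp (x i) * d i) * Q x - P x * (\<Sum>j\<in>J. exp (- x j) * d j)"
      by (simp only: sum_subtractf sum_distrib_right mult.commute[of "P x"])
    also have "\<dots> = (\<Sum>i\<in>J. \<Sum>j\<in>J. exp (x i) * d i * exp (- x j) - exp (x i) * (exp (- x j) * d j))"
      unfolding P_def Q_def sum_product sum_subtractf ..
    also have "\<dots> = (\<Sum>i\<in>J. \<Sum>j\<in>J. w i j * t i j)"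
      by (intro sum.cong refl) (simp add: w_def t_def d_def algebra_simps)
    finally show ?thesis .
  qed
  \<comment> \<open>Tangent of \<open>exp\<close> at the mean \<open>m\<close>; the linear parts
    cancel after weighting and summing.\<close>
  have e: "exp m * (1 + (s - m)) \<le> exp s" for s
  proof -
    have "exp m * (1 + (s - m)) \<le> exp m * exp (s - m)"
      by (intro mult_left_mono exp_ge_add_one_self) simp
    thus ?thesis by (simp flip: exp_add)
  qed
  have "exp m * S x = \<kappa> * (exp m * (1 + (0 - m))) + (\<Sum>i\<in>J. \<Sum>j\<in>J. w i j * (exp m * (1 + (t i j - m))))"
  proof -
    have "(\<Sum>i\<in>J. \<Sum>j\<in>J. w i j * (exp m * (1 + (t i j - m)))) 
      = (\<Sum>i\<in>J. \<Sum>j\<in>J. exp m * (1 - m) * w i j + exp m * (w i j * t i j))"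
      by (intro sum.cong refl) (simp add: algebra_simps)
    also have "\<dots> = exp m * (1 - m) * (P x * Q x) + exp m * (m * S x)"
      unfolding mS SS w_def by (simp add: sum.distrib sum_distrib_left)
    finally show ?thesis by (simp add: S_def algebra_simps)
  qed
  also have "\<dots> \<le> \<kappa> * exp 0 + (\<Sum>i\<in>J. \<Sum>j\<in>J. w i j * exp (t i j))"
    using \<kappa>_nonneg by (intro add_mono sum_mono mult_left_mono e) (auto simp: w_def)
  also have "(\<Sum>i\<in>J. \<Sum>j\<in>J. w i j * exp (t i j)) = P y * Q y"
    unfolding SS w_def t_def by (intro sum.cong refl) (simp flip: exp_add)
  finally have "exp m * S x \<le> S y" by (simp add: S_def)
  hence "ln (exp m * S x) \<le> ln (S y)" using S_pos[of x] S_pos[of y] by (subst ln_le_cancel_iff) auto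
  thus ?thesis using S_pos[of x] by (simp add: G_def m_def ln_mult)
qed

text \<open>The tangent at \<open>x\<close>, evaluated at the origin, with gradient entries of
  absolute value at most 1. Linear growth gives integrability under Gaussian laws.\<close>

lemma G_upper: "G x \<le> G (\<lambda>_. 0) + (\<Sum>i\<in>J. \<bar>x i\<bar>)"
proof -
  have "(\<Sum>i\<in>J. dG i x * x i) \<le> (\<Sum>i\<in>J. \<bar>x i\<bar>)"
  proof (intro sum_mono)
    fix i assume "i \<in> J"
    have "\<bar>dG i x * x i\<bar> \<le> 1 * \<bar>x i\<bar>"
      unfolding abs_mult by (intro mult_right_mono dG_bound \<open>i \<in> J\<close>) simp
    thus "dG i x * x i \<le> \<bar>x i\<bar>" by linarith
  qed
  thus ?thesis using G_convex[of x "\<lambda>_. 0"] by (simp add: sum_negf)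
qed

text \<open>These lines are the paths along which regression moves the vector in
  \<open>integration_by_parts\<close>.\<close>

lemma dG_line_deriv:
  assumes i: "i \<in> J"
  shows "((\<lambda>v. dG i (\<lambda>j. b j * v + x j)) has_real_derivative (\<Sum>j\<in>J. b j * ddG i j (\<lambda>j. b j * v + x j))) (at v)"
proof -
  define z where "z v j = b j * v + x j" for v j
  have e: "((\<lambda>v. exp (z v j)) has_real_derivative b j * exp (z v j)) (at v)" for v j
    unfolding z_def by (auto intro!: derivative_eq_intros)
  have e': "((\<lambda>v. exp (- z v j)) has_real_derivative - (b j * exp (- z v j))) (at v)" for v j
    unfolding z_def by (auto intro!: derivative_eq_intros)
  define P' Q' where "P' = (\<Sum>j\<in>J. b j * exp (z v j))" and "Q' = - (\<Sum>j\<in>J. b j * exp (- z v j))"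
  have dP: "((\<lambda>v. P (z v)) has_real_derivative P') (at v)"
    unfolding P_def P'_def by (intro DERIV_sum e)
  have dQ: "((\<lambda>v. Q (z v)) has_real_derivative Q') (at v)"
    unfolding Q_def Q'_def sum_negf[symmetric] by (intro DERIV_sum e')
  define D' where "D' = b i * exp (z v i) * Q (z v) + exp (z v i) * Q' + b i * exp (- z v i) * P (z v) - exp (- z v i) * P'"
  have dD: "((\<lambda>v. D i (z v)) has_real_derivative D') (at v)"
    unfolding D_def D'_def by (rule DERIV_cong[OF DERIV_diff[OF DERIV_mult[OF e dQ] DERIV_mult[OF e' dP]]]) (simp add: algebra_simps)
  have SD: "P' * Q (z v) + P (z v) * Q' = (\<Sum>j\<in>J. b j * D j (z v))"
    unfolding P'_def Q'_def D_def by (simp add: right_diff_distrib sum_subtractf sum_distrib_left sum_distrib_right mult_ac)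
  have dS: "((\<lambda>v. S (z v)) has_real_derivative (\<Sum>j\<in>J. b j * D j (z v))) (at v)"
    unfolding S_def SD[symmetric] by (rule DERIV_cong[OF DERIV_add[OF DERIV_const DERIV_mult[OF dP dQ]]]) (simp add: algebra_simps)
  have D'_eq: "D' = (\<Sum>j\<in>J. b j * ((if i = j then exp (z v i) * Q (z v) + exp (- z v i) * P (z v) else 0)
     - (exp (z v i) * exp (- z v j) + exp (- z v i) * exp (z v j))))"
    using finite_J i unfolding D'_def P'_def Q'_def
    by (simp add: right_diff_distrib sum_subtractf distrib_left sum.distrib if_distrib[of "\<lambda>x. b _ * x"] 
        sum_distrib_left mult_ac cong: if_cong)
  have "((\<lambda>v. dG i (z v)) has_real_derivative (D' * S (z v) - D i (z v) * (\<Sum>j\<in>J. b j * D j (z v))) / (S (z v) * S (z v))) (at v)"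
    unfolding dG_def by (rule DERIV_divide[OF dD dS]) (use S_pos[of "z v"] in simp)
  also have "(D' * S (z v) - D i (z v) * (\<Sum>j\<in>J. b j * D j (z v))) / (S (z v) * S (z v))
     = D' / S (z v) - D i (z v) * (\<Sum>j\<in>J. b j * D j (z v)) / (S (z v))\<^sup>2"
    using S_pos[of "z v"] by (simp add: diff_divide_distrib power2_eq_square)
  also have "\<dots> = (\<Sum>j\<in>J. b j * ddG i j (z v))"
  proof -
    have "(\<Sum>j\<in>J. b j * ddG i j (z v)) = (\<Sum>j\<in>J. b j * ((if i = j then exp (z v i) * Q (z v) + exp (- z v i) * P (z v) else 0)
       - (exp (z v i) * exp (- z v j) + exp (- z v i) * exp (z v j))) / S (z v) - D i (z v) * (b j * D j (z v)) / (S (z v))\<^sup>2)"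
      unfolding ddG_def by (intro sum.cong refl) (simp only: right_diff_distrib times_divide_eq_right mult.left_commute)
    thus ?thesis unfolding D'_eq
      by (simp only: sum_subtractf sum_divide_distrib sum_distrib_left)
  qed
  finally show ?thesis unfolding z_def .
qed

lemma ddG_line_cont: "isCont (\<lambda>v. ddG i j (\<lambda>j. b j * v + x j)) v"
proof -
  define z where "z v j = b j * v + x j" for v j
  have [continuous_intros]: "isCont (\<lambda>v. z v j) v" for v j
    unfolding z_def by (intro continuous_intros)
  have [continuous_intros]: "isCont (\<lambda>v. P (z v)) v" "isCont (\<lambda>v. Q (z v)) v" for v
    unfolding P_def Q_def by (intro continuous_intros)+
  have "isCont (\<lambda>v. ddG i j (z v)) v"
    unfolding ddG_def D_def S_def using S_pos[of "z v"]
    by (cases "i = j"; simp; intro continuous_intros) (auto simp: S_def)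
  thus ?thesis unfolding z_def .
qed

lemma measurable_G:
  assumes [measurable]: "\<And>j. j \<in> J \<Longrightarrow> (\<lambda>\<omega>. Z \<omega> j) \<in> borel_measurable M"
  shows "(\<lambda>\<omega>. G (Z \<omega>)) \<in> borel_measurable M"
    and "i \<in> J \<Longrightarrow> (\<lambda>\<omega>. dG i (Z \<omega>)) \<in> borel_measurable M"
    and "i \<in> J \<Longrightarrow> j \<in> J \<Longrightarrow> (\<lambda>\<omega>. ddG i j (Z \<omega>)) \<in> borel_measurable M"
proof -
  have [measurable]: "(\<lambda>\<omega>. P (Z \<omega>)) \<in> borel_measurable M" "(\<lambda>\<omega>. Q (Z \<omega>)) \<in> borel_measurable M"
    unfolding P_def Q_def by measurable
  show "(\<lambda>\<omega>. G (Z \<omega>)) \<in> borel_measurable M"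
    unfolding G_def S_def by measurable
  show "(\<lambda>\<omega>. dG i (Z \<omega>)) \<in> borel_measurable M" if [measurable]: "i \<in> J"
    unfolding dG_def D_def S_def by measurable
  show "(\<lambda>\<omega>. ddG i j (Z \<omega>)) \<in> borel_measurable M" if [measurable]: "i \<in> J" "j \<in> J"
    unfolding ddG_def D_def S_def by measurable
qed

text \<open>Bridges laws of vectors, which live on functions restricted to \<open>J\<close>, and
  evaluation at total functions.\<close>

lemma restrict_cong: 
  assumes "\<And>j. j \<in> J \<Longrightarrow> x j = y j"
  shows "G x = G y" "i \<in> J \<Longrightarrow> dG i x = dG i y" "i \<in> J \<Longrightarrow> j \<in> J \<Longrightarrow> ddG i j x = ddG i j y"
proof -
  have [simp]: "P x = P y" "Q x = Q y" using assms by (auto simp: P_def Q_def)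
  show "G x = G y" "i \<in> J \<Longrightarrow> dG i x = dG i y" "i \<in> J \<Longrightarrow> j \<in> J \<Longrightarrow> ddG i j x = ddG i j y"
    using assms by (auto simp: G_def S_def dG_def ddG_def D_def)
qed

end

section \<open>Monotonicity of expectations along tangent steps\<close>

context gaussian_vector begin

lemma dG_integration_by_parts:
  assumes "log_sum_exp J \<kappa>" and i: "i \<in> J"
  shows "expectation (\<lambda>\<omega>. X i \<omega> * log_sum_exp.dG J \<kappa> i (\<lambda>j. a * X j \<omega> + y j))
    = (\<Sum>j\<in>J. a * expectation (\<lambda>\<omega>. X i \<omega> * X j \<omega>) * expectation (\<lambda>\<omega>. log_sum_exp.ddG J \<kappa> i j (\<lambda>j. a * X j \<omega> + y j)))"
proof -
  interpret L: log_sum_exp J \<kappa> by fact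
  define F where "F x = L.dG i (\<lambda>j. a * x j + y j)" for x
  define F' where "F' j x = a * L.ddG i j (\<lambda>j. a * x j + y j)" for j x
  have r: "F (\<lambda>j\<in>J. x j) = F x" "j \<in> J \<Longrightarrow> F' j (\<lambda>j\<in>J. x j) = F' j x" for x j
    unfolding F_def F'_def using i by (auto intro!: L.restrict_cong arg_cong[where f="\<lambda>x. a * x"])
  have line: "((\<lambda>v. F (\<lambda>j. b j * v + x j)) has_real_derivative (\<Sum>j\<in>J. b j * F' j (\<lambda>j. b j * v + x j))) (at v)"
    for b x :: "'i \<Rightarrow> real" and v
    using L.dG_line_deriv[OF i, where b="\<lambda>j. a * b j" and x="\<lambda>j. a * x j + y j" and v=v]
    by (simp add: F_def F'_def algebra_simps)
  have "expectation (\<lambda>\<omega>. X i \<omega> * F (\<lambda>j\<in>J. X j \<omega>))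
      = (\<Sum>j\<in>J. expectation (\<lambda>\<omega>. X i \<omega> * X j \<omega>) * expectation (\<lambda>\<omega>. F' j (\<lambda>i\<in>J. X i \<omega>)))"
  \<comment> \<open>One constant for both bounds: 1 for the gradient entry,
    \<open>5 * \<bar>a\<bar>\<close> for its derivative after the chain rule.\<close>
  proof (rule integration_by_parts[OF i, where C="1 + \<bar>a\<bar> * 5"])
    show "F \<in> borel_measurable (Pi\<^sub>M J (\<lambda>_. borel))"
      unfolding F_def using i by (intro L.measurable_G) auto
    show "F' j \<in> borel_measurable (Pi\<^sub>M J (\<lambda>_. borel))" if "j \<in> J" for j
      unfolding F'_def using i that by (intro L.measurable_G borel_measurable_times borel_measurable_const) auto
    show "((\<lambda>v. F (\<lambda>j\<in>J. b j * v + x j)) has_real_derivative (\<Sum>j\<in>J. b j * F' j (\<lambda>j\<in>J. b j * v + x j))) (at v)" for x b v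
      unfolding r(1) by (simp only: r(2) cong: sum.cong) (rule line)
    show "isCont (\<lambda>v. F' j (\<lambda>j\<in>J. b j * v + x j)) v" if "j \<in> J" for x b j v
      unfolding r(2)[OF that]
      using L.ddG_line_cont[of v i j "\<lambda>j. a * b j" "\<lambda>j. a * x j + y j"]
      by (simp add: F'_def algebra_simps)
    show "\<bar>F x\<bar> \<le> 1 + \<bar>a\<bar> * 5" for x
      using L.dG_bound[OF i] unfolding F_def by (rule order_trans) simp
    show "\<bar>F' j x\<bar> \<le> 1 + \<bar>a\<bar> * 5" if "j \<in> J" for j x
      using mult_left_mono[OF L.ddG_bound[OF i that, of "\<lambda>j. a * x j + y j"], of "\<bar>a\<bar>"] unfolding F'_def abs_mult by simp
  qed
  also have "\<dots> = (\<Sum>j\<in>J. expectation (\<lambda>\<omega>. X i \<omega> * X j \<omega>) * expectation (\<lambda>\<omega>. F' j (\<lambda>j. X j \<omega>)))"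
    by (intro sum.cong refl) (simp only: r(2))
  finally show ?thesis unfolding r(1) by (simp add: F_def F'_def mult_ac)
qed

end

text \<open>The two vectors may live on different spaces; their lifts to the product space are
  independent.\<close>

locale gaussian_pair = M: gaussian_vector M J X + N: gaussian_vector N J Y + log_sum_exp J \<kappa>
  for M :: "'a measure" and N :: "'b measure" and J :: "'i set" and X Y and \<kappa> :: real
begin

sublocale MN: pair_prob_space M N ..

definition Z :: "real \<Rightarrow> real \<Rightarrow> 'a \<times> 'b \<Rightarrow> 'i \<Rightarrow> real" where
  "Z a g p j = a * X j (fst p) + g * Y j (snd p)"

lemma measurable_XY [measurable]:
  "j \<in> J \<Longrightarrow> (\<lambda>p. X j (fst p)) \<in> borel_measurable (M \<Otimes>\<^sub>M N)"
  "j \<in> J \<Longrightarrow> (\<lambda>p. Y j (snd p)) \<in> borel_measurable (M \<Otimes>\<^sub>M N)"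
  using measurable_compose[OF measurable_fst M.X_measurable] measurable_compose[OF measurable_snd N.X_measurable]
  by blast+

lemma measurable_Z [measurable]: "j \<in> J \<Longrightarrow> (\<lambda>p. Z a g p j) \<in> borel_measurable (M \<Otimes>\<^sub>M N)"
  unfolding Z_def by measurable

lemma integrable_XY:
  assumes "j \<in> J"
  shows "integrable (M \<Otimes>\<^sub>M N) (\<lambda>p. X j (fst p))" "integrable (M \<Otimes>\<^sub>M N) (\<lambda>p. Y j (snd p))"
proof -
  have fst: "integrable (A \<Otimes>\<^sub>M B) (\<lambda>p. f (fst p))" 
    if "prob_space B" "integrable A f" for A :: "'x measure" and B :: "'y measure" and f :: "'x \<Rightarrow> real"
  proof -
    interpret B: prob_space B by fact
    have "integrable (distr (A \<Otimes>\<^sub>M B) A fst) f" using that by (simp add: B.distr_pair_fst)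
    thus ?thesis using that by (subst (asm) integrable_distr_eq) auto
  qed
  show "integrable (M \<Otimes>\<^sub>M N) (\<lambda>p. X j (fst p))"
    by (intro fst N.prob_space_axioms M.X_integrable assms)
  interpret NM: pair_sigma_finite N M ..
  have "integrable (N \<Otimes>\<^sub>M M) (\<lambda>p. Y j (fst p))"
    by (intro fst M.prob_space_axioms N.X_integrable assms)
  thus "integrable (M \<Otimes>\<^sub>M N) (\<lambda>p. Y j (snd p))"
    using NM.integrable_product_swap[of "\<lambda>p. Y j (fst p)"] by (simp add: case_prod_beta')
qed

lemma integrable_G_Z: "integrable (M \<Otimes>\<^sub>M N) (\<lambda>p. G (Z a g p))"
proof (rule Bochner_Integration.integrable_bound)
  show "integrable (M \<Otimes>\<^sub>M N) (\<lambda>p. G (\<lambda>_. 0) + (\<Sum>j\<in>J. \<bar>Z a g p j\<bar>))"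
    unfolding Z_def using integrable_XY by (auto intro!: integrable_abs)
  show "(\<lambda>p. G (Z a g p)) \<in> borel_measurable (M \<Otimes>\<^sub>M N)"
    by (rule measurable_G) simp
  show "AE p in M \<Otimes>\<^sub>M N. norm (G (Z a g p)) \<le> norm (G (\<lambda>_. 0) + (\<Sum>j\<in>J. \<bar>Z a g p j\<bar>))"
  proof (intro AE_I2)
    fix p
    show "norm (G (Z a g p)) \<le> norm (G (\<lambda>_. 0) + (\<Sum>j\<in>J. \<bar>Z a g p j\<bar>))"
      using G_upper[of "Z a g p"] G_nonneg[of "Z a g p"] by simp
  qed
qed

lemma integrable_dG_Z: 
  assumes i: "i \<in> J" and h: "integrable (M \<Otimes>\<^sub>M N) h"
  shows "integrable (M \<Otimes>\<^sub>M N) (\<lambda>p. h p * dG i (Z a g p))"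
proof (rule Bochner_Integration.integrable_bound[OF h])
  note [measurable] = borel_measurable_integrable[OF h]
  have [measurable]: "(\<lambda>p. dG i (Z a g p)) \<in> borel_measurable (M \<Otimes>\<^sub>M N)" 
    by (rule measurable_G(2)[OF _ i]) simp
  show "(\<lambda>p. h p * dG i (Z a g p)) \<in> borel_measurable (M \<Otimes>\<^sub>M N)" by measurable
  show "AE p in M \<Otimes>\<^sub>M N. norm (h p * dG i (Z a g p)) \<le> norm (h p)"
  proof (intro AE_I2)
    fix p
    show "norm (h p * dG i (Z a g p)) \<le> norm (h p)"
      using mult_left_mono[OF dG_bound[OF i, of "Z a g p"], of "\<bar>h p\<bar>"] by (simp add: abs_mult)
  qed
qed

lemma integrable_ddG_Z: 
  assumes ij: "i \<in> J" "j \<in> J"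
  shows "integrable (M \<Otimes>\<^sub>M N) (\<lambda>p. ddG i j (Z a g p))"
proof (rule MN.integrable_const_bound[where B=5])
  show "(\<lambda>p. ddG i j (Z a g p)) \<in> borel_measurable (M \<Otimes>\<^sub>M N)" 
    by (rule measurable_G(3)[OF _ ij]) simp
qed (use ddG_bound[OF ij] in auto)

text \<open>Integrating over \<open>N\<close> last freezes the \<open>Y\<close> part, which becomes
  the shift in \<open>dG_integration_by_parts\<close>.\<close>

lemma expectation_X_dG:
  assumes i: "i \<in> J"
  shows "(\<integral>p. X i (fst p) * dG i (Z a g p) \<partial>(M \<Otimes>\<^sub>M N))
    = (\<Sum>j\<in>J. a * (\<integral>\<omega>. X i \<omega> * X j \<omega> \<partial>M) * (\<integral>p. ddG i j (Z a g p) \<partial>(M \<Otimes>\<^sub>M N)))"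
proof -
  have snd: "(\<integral>p. h p \<partial>(M \<Otimes>\<^sub>M N)) = (\<integral>\<omega>2. \<integral>\<omega>1. h (\<omega>1, \<omega>2) \<partial>M \<partial>N)" 
    "integrable N (\<lambda>\<omega>2. \<integral>\<omega>1. h (\<omega>1, \<omega>2) \<partial>M)"
    if "integrable (M \<Otimes>\<^sub>M N) h" for h :: "_ \<Rightarrow> real"
    using MN.integral_snd[of "\<lambda>x y. h (x, y)"] MN.integrable_snd[of "\<lambda>x y. h (x, y)"] that by (simp_all add: case_prod_beta')
  have "(\<integral>p. X i (fst p) * dG i (Z a g p) \<partial>(M \<Otimes>\<^sub>M N)) = 
    (\<integral>\<omega>2. \<integral>\<omega>1. X i \<omega>1 * dG i (\<lambda>j. a * X j \<omega>1 + g * Y j \<omega>2) \<partial>M \<partial>N)"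
    using snd(1)[OF integrable_dG_Z[OF i integrable_XY(1)[OF i]], of a g] by (simp add: Z_def[abs_def])
  also have "\<dots> = (\<integral>\<omega>2. (\<Sum>j\<in>J. a * (\<integral>\<omega>. X i \<omega> * X j \<omega> \<partial>M) * (\<integral>\<omega>1. ddG i j (Z a g (\<omega>1, \<omega>2)) \<partial>M)) \<partial>N)"
    by (subst M.dG_integration_by_parts[OF log_sum_exp_axioms i]) (simp add: Z_def[abs_def])
  also have "\<dots> = (\<Sum>j\<in>J. a * (\<integral>\<omega>. X i \<omega> * X j \<omega> \<partial>M) * (\<integral>\<omega>2. \<integral>\<omega>1. ddG i j (Z a g (\<omega>1, \<omega>2)) \<partial>M \<partial>N))"
    using snd(2)[OF integrable_ddG_Z[OF i]] 
    by (subst Bochner_Integration.integral_sum) (auto intro!: integrable_mult_right)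
  also have "\<dots> = (\<Sum>j\<in>J. a * (\<integral>\<omega>. X i \<omega> * X j \<omega> \<partial>M) * (\<integral>p. ddG i j (Z a g p) \<partial>(M \<Otimes>\<^sub>M N)))"
    by (intro sum.cong refl) (simp add: snd(1)[OF integrable_ddG_Z[OF i]])
  finally show ?thesis .
qed

lemma expectation_Y_dG:
  assumes i: "i \<in> J"
  shows "(\<integral>p. Y i (snd p) * dG i (Z a g p) \<partial>(M \<Otimes>\<^sub>M N))
    = (\<Sum>j\<in>J. g * (\<integral>\<omega>. Y i \<omega> * Y j \<omega> \<partial>N) * (\<integral>p. ddG i j (Z a g p) \<partial>(M \<Otimes>\<^sub>M N)))"
proof -
  have fst: "(\<integral>p. h p \<partial>(M \<Otimes>\<^sub>M N)) = (\<integral>\<omega>1. \<integral>\<omega>2. h (\<omega>1, \<omega>2) \<partial>N \<partial>M)" 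
    "integrable M (\<lambda>\<omega>1. \<integral>\<omega>2. h (\<omega>1, \<omega>2) \<partial>N)"
    if "integrable (M \<Otimes>\<^sub>M N) h" for h :: "_ \<Rightarrow> real"
    using MN.integral_fst'[OF that] MN.integrable_fst'[OF that] by simp_all
  have "(\<integral>p. Y i (snd p) * dG i (Z a g p) \<partial>(M \<Otimes>\<^sub>M N)) = 
    (\<integral>\<omega>1. \<integral>\<omega>2. Y i \<omega>2 * dG i (\<lambda>j. g * Y j \<omega>2 + a * X j \<omega>1) \<partial>N \<partial>M)"
    using fst(1)[OF integrable_dG_Z[OF i integrable_XY(2)[OF i]], of a g] by (simp add: Z_def[abs_def] add.commute)
  also have "\<dots> = (\<integral>\<omega>1. (\<Sum>j\<in>J. g * (\<integral>\<omega>. Y i \<omega> * Y j \<omega> \<partial>N) * (\<integral>\<omega>2. ddG i j (Z a g (\<omega>1, \<omega>2)) \<partial>N)) \<partial>M)"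
    by (subst N.dG_integration_by_parts[OF log_sum_exp_axioms i]) (simp add: Z_def[abs_def] add.commute)
  also have "\<dots> = (\<Sum>j\<in>J. g * (\<integral>\<omega>. Y i \<omega> * Y j \<omega> \<partial>N) * (\<integral>\<omega>1. \<integral>\<omega>2. ddG i j (Z a g (\<omega>1, \<omega>2)) \<partial>N \<partial>M))"
    using fst(2)[OF integrable_ddG_Z[OF i]] 
    by (subst Bochner_Integration.integral_sum) (auto intro!: integrable_mult_right)
  also have "\<dots> = (\<Sum>j\<in>J. g * (\<integral>\<omega>. Y i \<omega> * Y j \<omega> \<partial>N) * (\<integral>p. ddG i j (Z a g p) \<partial>(M \<Otimes>\<^sub>M N)))"
    by (intro sum.cong refl) (simp add: fst(1)[OF integrable_ddG_Z[OF i]])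
  finally show ?thesis .
qed

text \<open>The mixing coefficients move along a tangent of the circle through \<open>(a, g)\<close>.  Convexity of
  \<^term>\<open>G\<close> then makes the first-order term a lower bound, so no remainder has to be controlled.\<close>

lemma expectation_G_tangent_step:
  assumes incr: "\<And>i j. i \<in> J \<Longrightarrow> j \<in> J \<Longrightarrow>
      (\<integral>\<omega>. (X i \<omega> - X j \<omega>)\<^sup>2 \<partial>M) \<le> (\<integral>\<omega>. (Y i \<omega> - Y j \<omega>)\<^sup>2 \<partial>N)"
    and tangent: "a * a' + g * g' = a\<^sup>2 + g\<^sup>2" and le: "0 \<le> g * (g' - g)"
  shows "(\<integral>p. G (Z a g p) \<partial>(M \<Otimes>\<^sub>M N)) \<le> (\<integral>p. G (Z a' g' p) \<partial>(M \<Otimes>\<^sub>M N))"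
proof -
  define CX where "CX i j = (\<integral>\<omega>. X i \<omega> * X j \<omega> \<partial>M)" for i j
  define CY where "CY i j = (\<integral>\<omega>. Y i \<omega> * Y j \<omega> \<partial>N)" for i j
  define \<Delta> where "\<Delta> i j = CY i j - CX i j" for i j
  define h where "h i j = (\<integral>p. ddG i j (Z a g p) \<partial>(M \<Otimes>\<^sub>M N))" for i j
  have "0 \<le> \<Delta> i i + \<Delta> j j - 2 * \<Delta> i j" if ij: "i \<in> J" "j \<in> J" for i j
  proof -
    have "(\<integral>\<omega>. (X i \<omega> - X j \<omega>)\<^sup>2 \<partial>M) = (\<integral>\<omega>. X i \<omega> * X i \<omega> + X j \<omega> * X j \<omega> - 2 * (X i \<omega> * X j \<omega>) \<partial>M)"
      by (intro Bochner_Integration.integral_cong refl) (simp add: power2_eq_square algebra_simps)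
    also have "\<dots> = CX i i + CX j j - 2 * CX i j"
      using M.X_mult_integrable ij by (simp add: CX_def)
    finally have X: "(\<integral>\<omega>. (X i \<omega> - X j \<omega>)\<^sup>2 \<partial>M) = CX i i + CX j j - 2 * CX i j" .
    have "(\<integral>\<omega>. (Y i \<omega> - Y j \<omega>)\<^sup>2 \<partial>N) = (\<integral>\<omega>. Y i \<omega> * Y i \<omega> + Y j \<omega> * Y j \<omega> - 2 * (Y i \<omega> * Y j \<omega>) \<partial>N)"
      by (intro Bochner_Integration.integral_cong refl) (simp add: power2_eq_square algebra_simps)
    also have "\<dots> = CY i i + CY j j - 2 * CY i j"
      using N.X_mult_integrable ij by (simp add: CY_def)
    finally show ?thesis using incr[OF ij] X by (simp add: \<Delta>_def)
  qed
  hence "0 \<le> (\<integral>p. (\<Sum>i\<in>J. \<Sum>j\<in>J. \<Delta> i j * ddG i j (Z a g p)) \<partial>(M \<Otimes>\<^sub>M N))"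
    by (intro integral_nonneg_AE AE_I2 sum_ddG_nonneg)
  also have "\<dots> = (\<Sum>i\<in>J. \<Sum>j\<in>J. \<Delta> i j * h i j)"
    unfolding h_def by (simp add: integrable_ddG_Z)
  finally have pos: "0 \<le> (g * (g' - g)) * (\<Sum>i\<in>J. \<Sum>j\<in>J. \<Delta> i j * h i j)"
    using le by (rule mult_nonneg_nonneg[rotated])
  \<comment> \<open>Tangency: the displacement is orthogonal to \<open>(a, g)\<close>. The
    covariances of \<open>X\<close> and \<open>Y\<close> therefore enter with opposite coefficients
    and combine into \<Delta>.\<close>
  have t: "(a' - a) * a = - (g * (g' - g))" using tangent by (simp add: power2_eq_square algebra_simps)
  have int: "integrable (M \<Otimes>\<^sub>M N) (\<lambda>p. (a' - a) * (X i (fst p) * dG i (Z a g p)) + (g' - g) * (Y i (snd p) * dG i (Z a g p)))"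
    if "i \<in> J" for i
    using that integrable_dG_Z integrable_XY by simp
  have "(\<Sum>i\<in>J. (\<integral>p. (a' - a) * (X i (fst p) * dG i (Z a g p)) + (g' - g) * (Y i (snd p) * dG i (Z a g p)) \<partial>(M \<Otimes>\<^sub>M N)))
     = (\<Sum>i\<in>J. (a' - a) * (\<Sum>j\<in>J. a * CX i j * h i j) + (g' - g) * (\<Sum>j\<in>J. g * CY i j * h i j))"
    unfolding CX_def CY_def h_def expectation_X_dG[symmetric] expectation_Y_dG[symmetric]
    using integrable_dG_Z integrable_XY
    by (intro sum.cong refl) (simp add: expectation_X_dG[symmetric] expectation_Y_dG[symmetric])
  also have "\<dots> = (\<Sum>i\<in>J. \<Sum>j\<in>J. ((a' - a) * a) * CX i j * h i j + g * (g' - g) * CY i j * h i j)"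
    by (simp add: sum_distrib_left sum.distrib mult_ac)
  also have "\<dots> = (g * (g' - g)) * (\<Sum>i\<in>J. \<Sum>j\<in>J. \<Delta> i j * h i j)"
    unfolding t sum_distrib_left by (intro sum.cong refl) (simp add: \<Delta>_def algebra_simps)
  finally have first: "0 \<le> (\<Sum>i\<in>J. (\<integral>p. (a' - a) * (X i (fst p) * dG i (Z a g p)) + (g' - g) * (Y i (snd p) * dG i (Z a g p)) \<partial>(M \<Otimes>\<^sub>M N)))"
    using pos by simp
  have "(\<integral>p. G (Z a g p) \<partial>(M \<Otimes>\<^sub>M N)) \<le> (\<integral>p. G (Z a g p) \<partial>(M \<Otimes>\<^sub>M N)) +
     (\<integral>p. (\<Sum>i\<in>J. (a' - a) * (X i (fst p) * dG i (Z a g p)) + (g' - g) * (Y i (snd p) * dG i (Z a g p))) \<partial>(M \<Otimes>\<^sub>M N))"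
    using first int by (subst Bochner_Integration.integral_sum) auto
  also have "\<dots> = (\<integral>p. G (Z a g p) + (\<Sum>i\<in>J. (a' - a) * (X i (fst p) * dG i (Z a g p)) + (g' - g) * (Y i (snd p) * dG i (Z a g p))) \<partial>(M \<Otimes>\<^sub>M N))"
    using int integrable_G_Z by (subst Bochner_Integration.integral_add) auto
  also have "\<dots> \<le> (\<integral>p. G (Z a' g' p) \<partial>(M \<Otimes>\<^sub>M N))"
  proof (rule integral_mono)
    show "integrable (M \<Otimes>\<^sub>M N) (\<lambda>p. G (Z a g p) + (\<Sum>i\<in>J. (a' - a) * (X i (fst p) * dG i (Z a g p)) + (g' - g) * (Y i (snd p) * dG i (Z a g p))))"
      using int integrable_G_Z by auto
    fix p
    have "(\<Sum>i\<in>J. dG i (Z a g p) * (Z a' g' p i - Z a g p i)) = (\<Sum>i\<in>J. (a' - a) * (X i (fst p) * dG i (Z a g p)) + (g' - g) * (Y i (snd p) * dG i (Z a g p)))"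
      by (intro sum.cong refl) (simp add: Z_def algebra_simps)
    thus "G (Z a g p) + (\<Sum>i\<in>J. (a' - a) * (X i (fst p) * dG i (Z a g p)) + (g' - g) * (Y i (snd p) * dG i (Z a g p))) \<le> G (Z a' g' p)"
      using G_convex[of "Z a g p" "Z a' g' p"] by simp
  qed (rule integrable_G_Z)
  finally show ?thesis .
qed

end

section \<open>The Sudakov--Fernique inequality\<close>

context gaussian_pair begin

text \<open>A polygon of \<open>n\<close> tangent steps, each turning by \<open>\<delta>\<close> and
  multiplying the radius by \<open>r = 1 / cos \<delta>\<close>, leads from \<open>(1, 0)\<close> to
  \<open>(0, r ^ n)\<close>. It stays in the first quadrant, where the coefficient of
  \<open>Y\<close> never decreases, as the tangent step requires.\<close>

lemma expectation_G_le_dilation: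
  fixes n :: nat
  assumes incr: "\<And>i j. i \<in> J \<Longrightarrow> j \<in> J \<Longrightarrow>
      (\<integral>\<omega>. (X i \<omega> - X j \<omega>)\<^sup>2 \<partial>M) \<le> (\<integral>\<omega>. (Y i \<omega> - Y j \<omega>)\<^sup>2 \<partial>N)"
    and n: "2 \<le> n"
  shows "(\<integral>\<omega>. G (\<lambda>j. X j \<omega>) \<partial>M) \<le> (\<integral>\<omega>. G (\<lambda>j. (1 / cos (pi / (2 * real n))) ^ n * Y j \<omega>) \<partial>N)"
proof -
  define \<delta> where "\<delta> = pi / (2 * n)"
  define r where "r = 1 / cos \<delta>"
  \<comment> \<open>\<open>2 \<le> n\<close> keeps the angle below \<open>pi / 2\<close>, hence the
    cosine positive.\<close>
  have \<delta>: "0 < \<delta>" "\<delta> < pi / 2" and n\<delta>: "n * \<delta> = pi / 2"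
    using n by (auto simp: \<delta>_def field_simps)
  have cos: "0 < cos \<delta>" and sin: "0 < sin \<delta>" using \<delta> by (auto intro: cos_gt_zero sin_gt_zero)
  have r: "0 < r" "r * cos \<delta> = 1" using cos by (auto simp: r_def)
  define A where "A k = (\<integral>p. G (Z (r ^ k * cos (k * \<delta>)) (r ^ k * sin (k * \<delta>)) p) \<partial>(M \<Otimes>\<^sub>M N))" for k :: nat
  have step: "A k \<le> A (Suc k)" if k: "k < n" for k
    unfolding A_def
  proof (rule expectation_G_tangent_step[OF incr])
    define x y where "x = cos (k * \<delta>)" and "y = sin (k * \<delta>)"
    have "k * \<delta> \<le> n * \<delta>" using k \<delta> by (intro mult_right_mono) auto
    hence "0 \<le> k * \<delta>" "k * \<delta> \<le> pi / 2" using \<delta> n\<delta> by auto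
    hence xy: "0 \<le> x" "0 \<le> y" unfolding x_def y_def by (auto intro: cos_ge_zero sin_ge_zero)
    have Suc: "cos (Suc k * \<delta>) = x * cos \<delta> - y * sin \<delta>" "sin (Suc k * \<delta>) = y * cos \<delta> + x * sin \<delta>"
    proof -
      have e: "Suc k * \<delta> = k * \<delta> + \<delta>" by (simp add: distrib_right)
      show "cos (Suc k * \<delta>) = x * cos \<delta> - y * sin \<delta>" "sin (Suc k * \<delta>) = y * cos \<delta> + x * sin \<delta>"
        unfolding e x_def y_def by (simp_all only: cos_add sin_add)
    qed
    have one: "x * x + y * y = 1" using sin_cos_squared_add3[of "k * \<delta>"] by (simp add: x_def y_def)
    have "r ^ k * x * (r ^ Suc k * (x * cos \<delta> - y * sin \<delta>)) + r ^ k * y * (r ^ Suc k * (y * cos \<delta> + x * sin \<delta>))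
       = r ^ k * r ^ k * (r * cos \<delta>) * (x * x + y * y)"
      by (simp add: algebra_simps)
    also have "\<dots> = (r ^ k * x)\<^sup>2 + (r ^ k * y)\<^sup>2"
      unfolding r by (simp add: power2_eq_square algebra_simps)
    finally show "r ^ k * cos (k * \<delta>) * (r ^ Suc k * cos (Suc k * \<delta>)) + r ^ k * sin (k * \<delta>) * (r ^ Suc k * sin (Suc k * \<delta>))
       = (r ^ k * cos (k * \<delta>))\<^sup>2 + (r ^ k * sin (k * \<delta>))\<^sup>2"
      unfolding Suc x_def[symmetric] y_def[symmetric] .
    have "r ^ k * y * (r ^ Suc k * (y * cos \<delta> + x * sin \<delta>) - r ^ k * y)
      = r ^ k * r ^ k * y * (y * (r * cos \<delta>) + x * (r * sin \<delta>) - y)"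
      by (simp add: algebra_simps)
    also have "\<dots> = r ^ k * r ^ k * y * (x * (r * sin \<delta>))" unfolding r by simp
    also have "\<dots> \<ge> 0" using r sin xy by simp
    finally show "0 \<le> r ^ k * sin (k * \<delta>) * (r ^ Suc k * sin (Suc k * \<delta>) - r ^ k * sin (k * \<delta>))"
      unfolding Suc x_def[symmetric] y_def[symmetric] .
  qed
  have "A 0 \<le> A k" if "k \<le> n" for k
    using that by (induction k) (auto intro: order_trans[OF _ step])
  hence "A 0 \<le> A n" by simp
  moreover have "A 0 = (\<integral>\<omega>. G (\<lambda>j. X j \<omega>) \<partial>M)"
    using MN.integral_fst'[OF integrable_G_Z[of 1 0]]
    by (simp add: A_def Z_def[abs_def] N.prob_space)
  moreover have "A n = (\<integral>\<omega>. G (\<lambda>j. r ^ n * Y j \<omega>) \<partial>N)"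
    using MN.integral_fst'[OF integrable_G_Z[of 0 "r ^ n"]]
    by (simp add: A_def n\<delta> Z_def[abs_def] M.prob_space)
  ultimately show ?thesis by (simp add: r_def \<delta>_def)
qed

end


lemma (in gaussian_vector) gaussian_vector_scale: "gaussian_vector M J (\<lambda>j \<omega>. b * X j \<omega>)"
proof
  show "gaussian_rv M (\<lambda>\<omega>. \<Sum>j\<in>J. c j * (b * X j \<omega>))" for c
    using gaussian[of "\<lambda>j. c j * b"] by (simp add: mult.assoc)
qed (use finite_J centered in auto)

section \<open>Oscillation of a finite family and its smooth approximation\<close>

definition oscillation :: "'i set \<Rightarrow> ('i \<Rightarrow> real) \<Rightarrow> real" where
  "oscillation J x = Max ((\<lambda>(i, j). x i - x j) ` (J \<times> J))"

lemma oscillation_ge: "finite J \<Longrightarrow> i \<in> J \<Longrightarrow> j \<in> J \<Longrightarrow> x i - x j \<le> oscillation J x"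
  unfolding oscillation_def by (intro Max_ge) auto

lemma oscillation_obtain:
  assumes "finite J" "J \<noteq> {}"
  obtains i j where "i \<in> J" "j \<in> J" "oscillation J x = x i - x j"
proof -
  have "oscillation J x \<in> (\<lambda>(i, j). x i - x j) ` (J \<times> J)"
    unfolding oscillation_def using assms by (intro Max_in) auto
  thus ?thesis using that by auto
qed

lemma oscillation_nonneg: "finite J \<Longrightarrow> J \<noteq> {} \<Longrightarrow> 0 \<le> oscillation J x"
  using oscillation_ge[of J _ _ x] by fastforce

lemma oscillation_scale:
  assumes "finite J" "J \<noteq> {}" "0 \<le> b"
  shows "oscillation J (\<lambda>j. b * x j) = b * oscillation J x"
proof (rule antisym)
  obtain i j where ij: "i \<in> J" "j \<in> J" "oscillation J (\<lambda>j. b * x j) = b * x i - b * x j"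
    using oscillation_obtain[OF assms(1,2)] by blast
  thus "oscillation J (\<lambda>j. b * x j) \<le> b * oscillation J x"
    using mult_left_mono[OF oscillation_ge[OF assms(1) ij(1,2), of x] assms(3)] by (simp add: right_diff_distrib)
  obtain i j where ij: "i \<in> J" "j \<in> J" "oscillation J x = x i - x j"
    using oscillation_obtain[OF assms(1,2)] by blast
  thus "b * oscillation J x \<le> oscillation J (\<lambda>j. b * x j)"
    using oscillation_ge[OF assms(1) ij(1,2), of "\<lambda>j. b * x j"] by (simp add: right_diff_distrib)
qed

lemma measurable_oscillation:
  assumes "finite J" and [measurable]: "\<And>j. j \<in> J \<Longrightarrow> (\<lambda>\<omega>. Z \<omega> j) \<in> borel_measurable M"
  shows "(\<lambda>\<omega>. oscillation J (Z \<omega>)) \<in> borel_measurable M"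
  unfolding oscillation_def using assms
  by (intro borel_measurable_Max) auto

lemma (in gaussian_vector) integrable_oscillation:
  assumes "J \<noteq> {}"
  shows "integrable M (\<lambda>\<omega>. oscillation J (\<lambda>j. X j \<omega>))"
proof (rule Bochner_Integration.integrable_bound)
  show "integrable M (\<lambda>\<omega>. 2 * (\<Sum>j\<in>J. \<bar>X j \<omega>\<bar>))" using X_integrable by auto
  show "AE \<omega> in M. norm (oscillation J (\<lambda>j. X j \<omega>)) \<le> norm (2 * (\<Sum>j\<in>J. \<bar>X j \<omega>\<bar>))"
  proof (intro AE_I2)
    fix \<omega>
    obtain i j where ij: "i \<in> J" "j \<in> J" "oscillation J (\<lambda>j. X j \<omega>) = X i \<omega> - X j \<omega>"
      using oscillation_obtain[OF finite_J assms] by blast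
    have "\<bar>X k \<omega>\<bar> \<le> (\<Sum>j\<in>J. \<bar>X j \<omega>\<bar>)" if "k \<in> J" for k
      using that finite_J by (intro member_le_sum[where f="\<lambda>j. \<bar>X j \<omega>\<bar>"]) auto
    from this[OF ij(1)] this[OF ij(2)] show "norm (oscillation J (\<lambda>j. X j \<omega>)) \<le> norm (2 * (\<Sum>j\<in>J. \<bar>X j \<omega>\<bar>))"
      unfolding ij by simp
  qed
qed (use finite_J in \<open>auto intro!: measurable_oscillation\<close>)

text \<open>At \<open>b * x\<close>, \<open>S\<close> is a sum of
  \<open>1 + (card J)\<^sup>2\<close> exponentials (with the double sum expanded), the largest of
  which is \<open>exp (b * max c (oscillation J x))\<close>. After division by \<open>b\<close>, the
  error of the approximation is of order \<open>1 / b\<close>.\<close>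

lemma (in log_sum_exp) G_bounds:
  assumes b: "0 < b" and \<kappa>: "\<kappa> = exp (b * c)"
  shows "b * max c (oscillation J x) \<le> G (\<lambda>j. b * x j)"
    and "G (\<lambda>j. b * x j) \<le> b * max c (oscillation J x) + ln (1 + (real (card J))\<^sup>2)"
proof -
  have S_eq: "S z = exp (b * c) + P z * Q z" for z
    by (rule trans[OF S_def]) (simp add: \<kappa>)
  have PQ: "P (\<lambda>j. b * x j) * Q (\<lambda>j. b * x j) = (\<Sum>i\<in>J. \<Sum>j\<in>J. exp (b * (x i - x j)))"
    by (simp add: P_def Q_def sum_product right_diff_distrib flip: exp_add)
  obtain i j where ij: "i \<in> J" "j \<in> J" "oscillation J x = x i - x j"
    using oscillation_obtain[OF finite_J nonempty] by blast
  have "exp (b * oscillation J x) \<le> P (\<lambda>j. b * x j) * Q (\<lambda>j. b * x j)"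
  proof -
    have "exp (b * (x i - x j)) \<le> (\<Sum>j\<in>J. exp (b * (x i - x j)))"
      using finite_J ij by (intro member_le_sum[where f="\<lambda>j. exp (b * (x i - x j))"]) auto
    also have "\<dots> \<le> (\<Sum>i\<in>J. \<Sum>j\<in>J. exp (b * (x i - x j)))"
      using finite_J ij by (intro member_le_sum[where f="\<lambda>i. \<Sum>j\<in>J. exp (b * (x i - x j))"]) (auto intro: sum_nonneg)
    finally show ?thesis unfolding PQ ij .
  qed
  moreover have "0 \<le> P (\<lambda>j. b * x j) * Q (\<lambda>j. b * x j)"
    using P_pos Q_pos by (intro mult_nonneg_nonneg less_imp_le)
  ultimately have "exp (b * max c (oscillation J x)) \<le> S (\<lambda>j. b * x j)"
    unfolding S_eq by (auto simp: max_def intro: add_increasing)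
  thus "b * max c (oscillation J x) \<le> G (\<lambda>j. b * x j)"
    unfolding G_def using S_pos by (simp add: ln_ge_iff)
  define m where "m = max c (oscillation J x)"
  have "(\<Sum>i\<in>J. \<Sum>j\<in>J. exp (b * (x i - x j))) \<le> (\<Sum>i\<in>J. \<Sum>j\<in>J. exp (b * m))"
    using b oscillation_ge[OF finite_J, of _ _ x] by (intro sum_mono) (auto simp: m_def intro: max.coboundedI2)
  also have "\<dots> = (real (card J))\<^sup>2 * exp (b * m)" by (simp add: power2_eq_square)
  finally have "S (\<lambda>j. b * x j) \<le> exp (b * c) + (real (card J))\<^sup>2 * exp (b * m)"
    unfolding S_eq PQ by simp
  also have "exp (b * c) \<le> exp (b * m)" using b by (simp add: m_def)
  finally have "S (\<lambda>j. b * x j) \<le> exp (b * m) * (1 + (real (card J))\<^sup>2)" by (simp add: algebra_simps)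
  hence "G (\<lambda>j. b * x j) \<le> ln (exp (b * m) * (1 + (real (card J))\<^sup>2))"
    unfolding G_def using S_pos by (subst ln_le_cancel_iff) (auto intro!: mult_pos_pos add_pos_nonneg)
  also have "\<dots> = b * m + ln (1 + (real (card J))\<^sup>2)"
    using add_pos_nonneg[of 1 "(real (card J))\<^sup>2"] by (simp add: ln_mult)
  finally show "G (\<lambda>j. b * x j) \<le> b * max c (oscillation J x) + ln (1 + (real (card J))\<^sup>2)"
    by (simp add: m_def)
qed

text \<open>The scale \<open>b\<close> and the number of tangent steps are both taken to be
  \<open>n\<close>. The logarithmic error is then \<open>L / n\<close>, the dilation is
  \<open>r n\<close>, and a single limit removes both.\<close>

lemma Sudakov_Fernique_max:
  assumes "gaussian_vector M J X" "gaussian_vector N J Y" and J: "J \<noteq> {}" and c: "0 \<le> c"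
    and incr: "\<And>i j. i \<in> J \<Longrightarrow> j \<in> J \<Longrightarrow>
      (\<integral>\<omega>. (X i \<omega> - X j \<omega>)\<^sup>2 \<partial>M) \<le> (\<integral>\<omega>. (Y i \<omega> - Y j \<omega>)\<^sup>2 \<partial>N)"
  shows "(\<integral>\<omega>. max c (oscillation J (\<lambda>j. X j \<omega>)) \<partial>M) \<le> (\<integral>\<omega>. max c (oscillation J (\<lambda>j. Y j \<omega>)) \<partial>N)"
proof -
  interpret M: gaussian_vector M J X by fact
  interpret N: gaussian_vector N J Y by fact
  note fin = M.finite_J
  have iX: "integrable M (\<lambda>\<omega>. max c (oscillation J (\<lambda>j. X j \<omega>)))"
    using M.integrable_oscillation[OF J] by auto
  have iY: "integrable N (\<lambda>\<omega>. max c (oscillation J (\<lambda>j. Y j \<omega>)))"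
    using N.integrable_oscillation[OF J] by auto
  define L where "L = ln (1 + (real (card J))\<^sup>2)"
  define r where "r n = (1 / cos (pi / (2 * real n))) ^ n" for n
  have main: "(\<integral>\<omega>. max c (oscillation J (\<lambda>j. X j \<omega>)) \<partial>M)
    \<le> r n * (\<integral>\<omega>. max c (oscillation J (\<lambda>j. Y j \<omega>)) \<partial>N) + L / n" if n: "2 \<le> n" for n :: nat
  proof -
    define b where "b = real n"
    have b: "b > 0" using n by (simp add: b_def)
    have "gaussian_pair M N J (\<lambda>j \<omega>. b * X j \<omega>) (\<lambda>j \<omega>. b * Y j \<omega>) (exp (b * c))"
      using fin J by (intro gaussian_pair.intro M.gaussian_vector_scale N.gaussian_vector_scale log_sum_exp.intro) auto
    then interpret P: gaussian_pair M N J "\<lambda>j \<omega>. b * X j \<omega>" "\<lambda>j \<omega>. b * Y j \<omega>" "exp (b * c)" .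
    have "0 < cos (pi / (2 * real n))" using n by (intro cos_gt_zero) (auto simp: field_simps)
    hence r: "1 \<le> r n" unfolding r_def by (intro one_le_power) (simp add: divide_simps)
    have sq: "(b * u - b * v)\<^sup>2 = b\<^sup>2 * (u - v)\<^sup>2" for u v :: real
      by (simp add: power2_eq_square algebra_simps)
    have "(\<integral>\<omega>. b * max c (oscillation J (\<lambda>j. X j \<omega>)) \<partial>M) \<le> (\<integral>\<omega>. P.G (\<lambda>j. b * X j \<omega>) \<partial>M)"
    proof (rule integral_mono)
      show "integrable M (\<lambda>\<omega>. P.G (\<lambda>j. b * X j \<omega>))"
        using P.MN.integrable_fst'[OF P.integrable_G_Z[of 1 0]] by (simp add: P.Z_def[abs_def] N.prob_space)
    qed (use iX P.G_bounds(1)[OF b refl] in auto)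
    also have "\<dots> \<le> (\<integral>\<omega>. P.G (\<lambda>j. r n * (b * Y j \<omega>)) \<partial>N)"
      unfolding r_def
    proof (rule P.expectation_G_le_dilation[OF _ n])
      fix i j assume "i \<in> J" "j \<in> J"
      from incr[OF this] show "(\<integral>\<omega>. (b * X i \<omega> - b * X j \<omega>)\<^sup>2 \<partial>M) \<le> (\<integral>\<omega>. (b * Y i \<omega> - b * Y j \<omega>)\<^sup>2 \<partial>N)"
        unfolding sq using b by simp
    qed
    also have "\<dots> \<le> (\<integral>\<omega>. b * (r n * max c (oscillation J (\<lambda>j. Y j \<omega>))) + L \<partial>N)"
    proof (rule integral_mono)
      show "integrable N (\<lambda>\<omega>. P.G (\<lambda>j. r n * (b * Y j \<omega>)))"
        using P.MN.integrable_snd[of "\<lambda>x y. P.G (P.Z 0 (r n) (x, y))"] P.integrable_G_Z[of 0 "r n"] 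
        by (simp add: P.Z_def[abs_def] M.prob_space case_prod_beta')
      show "integrable N (\<lambda>\<omega>. b * (r n * max c (oscillation J (\<lambda>j. Y j \<omega>))) + L)" using iY by simp
      fix \<omega>
      have "P.G (\<lambda>j. r n * (b * Y j \<omega>)) = P.G (\<lambda>j. b * (r n * Y j \<omega>))" by (simp add: mult.left_commute)
      also have "\<dots> \<le> b * max c (oscillation J (\<lambda>j. r n * Y j \<omega>)) + L"
        unfolding L_def by (rule P.G_bounds(2)[OF b refl])
      also have "max c (oscillation J (\<lambda>j. r n * Y j \<omega>)) \<le> r n * max c (oscillation J (\<lambda>j. Y j \<omega>))"
      proof -
        \<comment> \<open>The dilation acts on the oscillation but not on \<open>c\<close>; since
          \<open>c\<close> is nonnegative and \<open>r n\<close> is at least 1, the factor can be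
          put in front of the whole maximum.\<close>
        have "c \<le> r n * max c (oscillation J (\<lambda>j. Y j \<omega>))"
          using mult_mono[OF r max.cobounded1[of c "oscillation J (\<lambda>j. Y j \<omega>)"]] r c by simp
        thus ?thesis using r by (simp add: oscillation_scale[OF fin J] mult_left_mono)
      qed
      finally show "P.G (\<lambda>j. r n * (b * Y j \<omega>)) \<le> b * (r n * max c (oscillation J (\<lambda>j. Y j \<omega>))) + L"
        using b by simp
    qed
    also have "\<dots> = b * (r n * (\<integral>\<omega>. max c (oscillation J (\<lambda>j. Y j \<omega>)) \<partial>N)) + L"
      using iY by (simp add: N.prob_space)
    finally show ?thesis using b by (simp add: b_def[symmetric] field_simps)
  qed
  \<comment> \<open>\<open>cos (pi / (2 * n))\<close> differs from 1 by a term of order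
    \<open>1 / n\<^sup>2\<close>, which survives the \<open>n\<close>-th power only to order
    \<open>1 / n\<close>.\<close>
  have "r \<longlonglongrightarrow> 1" unfolding r_def by real_asymp
  moreover have "(\<lambda>n. L / real n) \<longlonglongrightarrow> 0" by real_asymp
  ultimately have "(\<lambda>n. r n * (\<integral>\<omega>. max c (oscillation J (\<lambda>j. Y j \<omega>)) \<partial>N) + L / real n) \<longlonglongrightarrow>
      1 * (\<integral>\<omega>. max c (oscillation J (\<lambda>j. Y j \<omega>)) \<partial>N) + 0"
    by (intro tendsto_intros)
  hence "(\<integral>\<omega>. max c (oscillation J (\<lambda>j. X j \<omega>)) \<partial>M) \<le> 1 * (\<integral>\<omega>. max c (oscillation J (\<lambda>j. Y j \<omega>)) \<partial>N) + 0"
    by (rule LIMSEQ_le_const) (use main in \<open>auto intro!: exI[of _ 2]\<close>)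
  thus ?thesis by simp
qed

section \<open>From hinge functions to increasing convex functions\<close>

text \<open>A convex function on \<open>{0..}\<close> is continuous in the interior and may jump at
  0, but a nonnegative sequence bounded above by the limit 0 is constant.\<close>

lemma convex_on_tendsto_from_below:
  fixes g :: "real \<Rightarrow> real"
  assumes g: "convex_on {0..} g" and x: "\<And>n. 0 \<le> x n" "\<And>n. x n \<le> l" "x \<longlonglongrightarrow> l"
  shows "(\<lambda>n. g (x n)) \<longlonglongrightarrow> g l"
proof (cases "l = 0")
  case True
  hence "x n = 0" for n using x(1,2)[of n] by simp
  thus ?thesis using True by simp
next
  case False
  hence l: "l > 0" using x(1,2)[of 0] by simp
  have "convex_on {0<..} g" using g by (rule convex_on_subset) auto
  hence "continuous_on {0<..} g" by (intro convex_on_continuous) auto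
  hence "isCont g l" using l by (simp add: continuous_on_eq_continuous_at)
  thus ?thesis using x(3) by (rule isCont_tendsto_compose)
qed

text \<open>\<open>hinge_sum g \<delta> n\<close> interpolates, at the points \<open>k * \<delta>\<close> with \<open>1 \<le> k \<le> n\<close>, the function
  \<open>x \<mapsto> g (x - \<delta>) - g 0\<close>; the shift by one grid step makes it a lower approximation of \<open>g - g 0\<close>.\<close>

definition hinge_coeff :: "(real \<Rightarrow> real) \<Rightarrow> real \<Rightarrow> nat \<Rightarrow> real" where
  "hinge_coeff g \<delta> k = (case k of 0 \<Rightarrow> (g \<delta> - g 0) / \<delta>
     | Suc i \<Rightarrow> (g (real (k + 1) * \<delta>) - g (real k * \<delta>)) / \<delta> - (g (real k * \<delta>) - g (real i * \<delta>)) / \<delta>)"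

definition hinge_sum :: "(real \<Rightarrow> real) \<Rightarrow> real \<Rightarrow> nat \<Rightarrow> real \<Rightarrow> real" where
  "hinge_sum g \<delta> n x = (\<Sum>k<n. hinge_coeff g \<delta> k * max 0 (x - real (k + 1) * \<delta>))"

text \<open>The coefficients are successive changes of slope and telescope to the current
  slope.\<close>

lemma sum_hinge_coeff: "(\<Sum>k<Suc n. hinge_coeff g \<delta> k) = (g (real (n + 1) * \<delta>) - g (real n * \<delta>)) / \<delta>"
  by (induction n) (simp_all add: hinge_coeff_def)

text \<open>At the point \<open>real (n + 1) * \<delta>\<close> the \<open>k\<close>-th hinge equals
  \<open>real (n - k) * \<delta>\<close>, so this is the interpolation property with its shift by
  one step. Passing from \<open>n\<close> to \<open>Suc n\<close> adds one slope times
  \<open>\<delta>\<close>.\<close>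

lemma sum_hinge_coeff_weighted:
  assumes "\<delta> > 0"
  shows "(\<Sum>k<n. hinge_coeff g \<delta> k * (real (n - k) * \<delta>)) = g (real n * \<delta>) - g 0"
proof (induction n)
  case (Suc n)
  have "(\<Sum>k<Suc n. hinge_coeff g \<delta> k * (real (Suc n - k) * \<delta>))
      = (\<Sum>k<Suc n. hinge_coeff g \<delta> k * (real (n - k) * \<delta>) + hinge_coeff g \<delta> k * \<delta>)"
    by (intro sum.cong refl) (simp add: Suc_diff_le algebra_simps)
  also have "\<dots> = (\<Sum>k<n. hinge_coeff g \<delta> k * (real (n - k) * \<delta>)) + (\<Sum>k<Suc n. hinge_coeff g \<delta> k) * \<delta>"
    by (simp only: sum.distrib sum_distrib_right sum.lessThan_Suc diff_self_eq_0 of_nat_0 mult_zero_left mult_zero_right add_0_right distrib_right add.assoc)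
  also have "\<dots> = g (real (Suc n) * \<delta>) - g 0"
    unfolding Suc sum_hinge_coeff using assms by simp
  finally show ?case .
qed simp

context
  fixes g :: "real \<Rightarrow> real" and \<delta> :: real
  assumes mono: "mono_on {0..} g" and convex: "convex_on {0..} g" and \<delta>: "0 < \<delta>"
begin

text \<open>The first coefficient is a slope, nonnegative by monotonicity; the others are second
  differences, nonnegative by convexity at a midpoint.\<close>

lemma hinge_coeff_nonneg: "0 \<le> hinge_coeff g \<delta> k"
proof (cases k)
  case 0
  thus ?thesis using \<delta> mono_onD[OF mono, of 0 \<delta>] by (simp add: hinge_coeff_def)
next
  case (Suc i)
  have "g ((1 - 1/2) *\<^sub>R (real i * \<delta>) + (1/2) *\<^sub>R (real (i + 2) * \<delta>)) \<le> (1 - 1/2) * g (real i * \<delta>) + (1/2) * g (real (i + 2) * \<delta>)"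
    using \<delta> by (intro convex_onD[OF convex]) auto
  also have "(1 - 1/2) *\<^sub>R (real i * \<delta>) + (1/2) *\<^sub>R (real (i + 2) * \<delta>) = real (i + 1) * \<delta>"
    by (simp add: algebra_simps)
  finally have "g (real (i + 1) * \<delta>) - g (real i * \<delta>) \<le> g (real (i + 2) * \<delta>) - g (real (i + 1) * \<delta>)" by simp
  hence "(g (real (i + 1) * \<delta>) - g (real i * \<delta>)) / \<delta> \<le> (g (real (i + 2) * \<delta>) - g (real (i + 1) * \<delta>)) / \<delta>"
    using \<delta> by (intro divide_right_mono) auto
  thus ?thesis unfolding hinge_coeff_def Suc by simp
qed

lemma hinge_sum_nonneg: "0 \<le> hinge_sum g \<delta> n x"
  unfolding hinge_sum_def by (intro sum_nonneg mult_nonneg_nonneg hinge_coeff_nonneg) simp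

lemma grid_point:
  assumes "0 \<le> x"
  obtains j :: nat where "real j * \<delta> \<le> x" "x < real (j + 1) * \<delta>"
proof
  have f: "0 \<le> \<lfloor>x / \<delta>\<rfloor>" using assms \<delta> by simp
  have "real (nat \<lfloor>x / \<delta>\<rfloor>) \<le> x / \<delta>" using f by (simp add: of_nat_nat)
  thus "real (nat \<lfloor>x / \<delta>\<rfloor>) * \<delta> \<le> x" using \<delta> by (simp add: field_simps)
  have "x / \<delta> < real (nat \<lfloor>x / \<delta>\<rfloor> + 1)" using f real_of_int_floor_add_one_gt[of "x / \<delta>"] by (simp add: of_nat_nat add.commute)
  thus "x < real (nat \<lfloor>x / \<delta>\<rfloor> + 1) * \<delta>" using \<delta> by (simp add: field_simps)
qed

lemma hinge_sum_le:
  assumes "0 \<le> x"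
  shows "hinge_sum g \<delta> n x \<le> g x - g 0"
proof -
  obtain j :: nat where j: "real j * \<delta> \<le> x" "x < real (j + 1) * \<delta>" using grid_point[OF assms] .
  have pos: "0 \<le> hinge_coeff g \<delta> k * (real (j - k) * \<delta>)" for k
    using \<delta> by (intro mult_nonneg_nonneg hinge_coeff_nonneg) auto
  have le_term: "hinge_coeff g \<delta> k * max 0 (x - real (k + 1) * \<delta>) \<le> hinge_coeff g \<delta> k * (real (j - k) * \<delta>)" for k
  proof (intro mult_left_mono hinge_coeff_nonneg)
    show "max 0 (x - real (k + 1) * \<delta>) \<le> real (j - k) * \<delta>"
    proof (cases "k \<le> j")
      case True
      hence "real (j - k) * \<delta> = real j * \<delta> - real k * \<delta>" by (simp add: of_nat_diff left_diff_distrib)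
      moreover have "0 \<le> real (j - k) * \<delta>" using \<delta> by simp
      moreover have "real (j + 1) * \<delta> = real j * \<delta> + \<delta>" "real (k + 1) * \<delta> = real k * \<delta> + \<delta>"
        by (simp_all add: distrib_right)
      ultimately show ?thesis using j by linarith
    next
      case False
      have "real (j + 1) * \<delta> \<le> real (k + 1) * \<delta>" using False \<delta> by (intro mult_right_mono) auto
      hence "x - real (k + 1) * \<delta> \<le> 0" using j by linarith
      thus ?thesis using \<delta> by simp
    qed
  qed
  have "hinge_sum g \<delta> n x \<le> (\<Sum>k<n. hinge_coeff g \<delta> k * (real (j - k) * \<delta>))"
    unfolding hinge_sum_def by (intro sum_mono le_term)
  \<comment> \<open>Either of \<open>n\<close> and \<open>j\<close> may be larger. Added terms are
    nonnegative, and for \<open>k \<ge> j\<close> the truncated difference \<open>j - k\<close>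
    makes the terms vanish.\<close>
  also have "\<dots> \<le> (\<Sum>k<max n j. hinge_coeff g \<delta> k * (real (j - k) * \<delta>))"
    using pos by (intro sum_mono2) auto
  also have "\<dots> = (\<Sum>k<j. hinge_coeff g \<delta> k * (real (j - k) * \<delta>))"
    by (intro sum.mono_neutral_right) auto
  also have "\<dots> = g (real j * \<delta>) - g 0" by (rule sum_hinge_coeff_weighted[OF \<delta>])
  also have "\<dots> \<le> g x - g 0" using mono_onD[OF mono, of "real j * \<delta>" x] j assms \<delta> by simp
  finally show ?thesis .
qed

text \<open>One of the two steps \<open>\<delta>\<close> comes from the shift in the interpolation,
  the other from rounding \<open>x\<close> down to the grid.\<close>

lemma hinge_sum_ge:
  assumes "0 \<le> x" "x \<le> real n * \<delta>"
  shows "g (max 0 (x - 2 * \<delta>)) - g 0 \<le> hinge_sum g \<delta> n x"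
proof -
  obtain j :: nat where j: "real j * \<delta> \<le> x" "x < real (j + 1) * \<delta>" using grid_point[OF assms(1)] .
  show ?thesis
  proof (cases j)
    case 0
    hence "max 0 (x - 2 * \<delta>) = 0" using j \<delta> by simp
    thus ?thesis using hinge_sum_nonneg by simp
  next
    case (Suc i)
    have "real j * \<delta> \<le> real n * \<delta>" using j assms by linarith
    hence jn: "i \<le> n" using \<delta> Suc by simp
    have "g (max 0 (x - 2 * \<delta>)) - g 0 \<le> g (real i * \<delta>) - g 0"
    proof -
      have "max 0 (x - 2 * \<delta>) \<le> real i * \<delta>" using j \<delta> Suc by (auto simp: algebra_simps)
      thus ?thesis using mono_onD[OF mono, of "max 0 (x - 2 * \<delta>)" "real i * \<delta>"] by simp
    qed
    also have "\<dots> = (\<Sum>k<i. hinge_coeff g \<delta> k * (real (i - k) * \<delta>))"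
      by (rule sum_hinge_coeff_weighted[OF \<delta>, symmetric])
    also have "\<dots> \<le> (\<Sum>k<i. hinge_coeff g \<delta> k * max 0 (x - real (k + 1) * \<delta>))"
      using j \<delta> Suc by (intro sum_mono mult_left_mono hinge_coeff_nonneg) (auto simp: of_nat_diff algebra_simps)
    also have "\<dots> \<le> hinge_sum g \<delta> n x"
      unfolding hinge_sum_def using jn
      by (intro sum_mono2) (auto intro: mult_nonneg_nonneg hinge_coeff_nonneg)
    finally show ?thesis .
  qed
qed

end

text \<open>Mesh \<open>1 / (m + 1)\<close> with \<open>(m + 1)\<^sup>2\<close> hinges: the mesh
  tends to 0 while the covered interval \<open>[0, m + 1]\<close> exhausts the half-line.\<close>

lemma hinge_sum_tendsto:
  assumes g: "mono_on {0..} g" "convex_on {0..} g" and x: "0 \<le> x"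
  shows "(\<lambda>m. hinge_sum g (1 / real (Suc m)) (Suc m * Suc m) x) \<longlonglongrightarrow> g x - g 0"
proof (rule tendsto_sandwich)
  show "\<forall>\<^sub>F m in sequentially. g (max 0 (x - 2 * (1 / real (Suc m)))) - g 0 \<le> hinge_sum g (1 / real (Suc m)) (Suc m * Suc m) x"
  proof (rule eventually_mono[OF eventually_ge_at_top[of "nat \<lceil>x\<rceil>"]])
    fix m assume "nat \<lceil>x\<rceil> \<le> m"
    then have "x \<le> real (Suc m)" by linarith
    also have "real (Suc m) = real (Suc m * Suc m) * (1 / real (Suc m))"
      unfolding of_nat_mult by simp
    finally show "g (max 0 (x - 2 * (1 / real (Suc m)))) - g 0 \<le> hinge_sum g (1 / real (Suc m)) (Suc m * Suc m) x"
      using x by (intro hinge_sum_ge[OF g]) auto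
  qed
  show "\<forall>\<^sub>F m in sequentially. hinge_sum g (1 / real (Suc m)) (Suc m * Suc m) x \<le> g x - g 0"
    using x by (intro always_eventually allI hinge_sum_le[OF g]) auto
  have "(\<lambda>m. max 0 (x - 2 * (1 / real (Suc m)))) \<longlonglongrightarrow> max 0 (x - 2 * 0)"
    by (intro tendsto_intros) (use LIMSEQ_inverse_real_of_nat in \<open>simp add: inverse_eq_divide\<close>)
  hence "(\<lambda>m. max 0 (x - 2 * (1 / real (Suc m)))) \<longlonglongrightarrow> x" using x by simp
  thus "(\<lambda>m. g (max 0 (x - 2 * (1 / real (Suc m)))) - g 0) \<longlonglongrightarrow> g x - g 0"
    using x by (intro tendsto_diff tendsto_const convex_on_tendsto_from_below[OF g(2)]) auto
qed simp

text \<open>Subtracting \<open>c\<close> from \<open>max c (A x)\<close> gives the hinge at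
  \<open>c\<close>, so \<open>le\<close> compares all hinges and hence all nonnegative combinations
  of them. For \<open>B\<close> the hinge sums lie below \<open>g - g 0\<close>; for
  \<open>A\<close> pointwise convergence and Fatou's lemma suffice. Both sides may be
  infinite.\<close>

lemma increasing_convex_order:
  fixes A :: "'a \<Rightarrow> real" and B :: "'b \<Rightarrow> real" and g :: "real \<Rightarrow> real"
  assumes "prob_space M" "prob_space N"
    and A: "integrable M A" "\<And>x. 0 \<le> A x" and B: "integrable N B" "\<And>x. 0 \<le> B x"
    and le: "\<And>c. 0 \<le> c \<Longrightarrow> (\<integral>x. max c (A x) \<partial>M) \<le> (\<integral>x. max c (B x) \<partial>N)"
    and g: "mono_on {0..} g" "convex_on {0..} g"
  shows "(\<integral>\<^sup>+x. ennreal (g (A x) - g 0) \<partial>M) \<le> (\<integral>\<^sup>+x. ennreal (g (B x) - g 0) \<partial>N)"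
proof -
  interpret M: prob_space M by fact
  interpret N: prob_space N by fact
  have [measurable]: "A \<in> borel_measurable M" "B \<in> borel_measurable N" using A B by auto
  have hinge: "(\<integral>\<^sup>+x. ennreal (max 0 (Z x - c)) \<partial>L) = ennreal ((\<integral>x. max c (Z x) \<partial>L) - c)"
    if "prob_space L" "integrable L Z" for L :: "'c measure" and Z c
  proof -
    interpret L: prob_space L by fact
    have i: "integrable L (\<lambda>x. max c (Z x))" using that by auto
    have "max 0 (Z x - c) = max c (Z x) - c" for x by auto
    thus ?thesis using i by (simp add: nn_integral_eq_integral L.prob_space)
  qed
  have sums: "(\<integral>\<^sup>+x. ennreal (hinge_sum g \<delta> n (Z x)) \<partial>L)
      = (\<Sum>k<n. ennreal (hinge_coeff g \<delta> k) * (\<integral>\<^sup>+x. ennreal (max 0 (Z x - real (k + 1) * \<delta>)) \<partial>L))"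
    if [measurable]: "Z \<in> borel_measurable L" and \<delta>: "0 < \<delta>" for L :: "'c measure" and Z \<delta> n
  proof -
    have "ennreal (hinge_sum g \<delta> n z) = (\<Sum>k<n. ennreal (hinge_coeff g \<delta> k) * ennreal (max 0 (z - real (k + 1) * \<delta>)))" for z
      unfolding hinge_sum_def using hinge_coeff_nonneg[OF g \<delta>]
      by (subst sum_ennreal[symmetric]) (auto simp: ennreal_mult intro!: mult_nonneg_nonneg)
    thus ?thesis by (simp add: nn_integral_sum nn_integral_cmult)
  qed
  have delta: "0 < 1 / real (Suc m)" for m by simp
  define u where "u m = hinge_sum g (1 / real (Suc m)) (Suc m * Suc m)" for m
  have step: "(\<integral>\<^sup>+x. ennreal (u m (A x)) \<partial>M) \<le> (\<integral>\<^sup>+x. ennreal (g (B x) - g 0) \<partial>N)" for m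
  proof -
    have "(\<integral>\<^sup>+x. ennreal (u m (A x)) \<partial>M) \<le> (\<integral>\<^sup>+x. ennreal (u m (B x)) \<partial>N)"
    proof -
      have "(\<integral>\<^sup>+x. ennreal (max 0 (A x - c)) \<partial>M) \<le> (\<integral>\<^sup>+x. ennreal (max 0 (B x - c)) \<partial>N)" if "0 \<le> c" for c
        unfolding hinge[OF assms(1) A(1)] hinge[OF assms(2) B(1)] using le[OF that] by (intro ennreal_leI) simp
      thus ?thesis
        unfolding u_def sums[OF \<open>A \<in> borel_measurable M\<close> delta] sums[OF \<open>B \<in> borel_measurable N\<close> delta]
        by (intro sum_mono mult_left_mono) auto
    qed
    also have "\<dots> \<le> (\<integral>\<^sup>+x. ennreal (g (B x) - g 0) \<partial>N)"
      unfolding u_def by (intro nn_integral_mono ennreal_leI hinge_sum_le[OF g] B) simp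
    finally show ?thesis .
  qed
  have [measurable]: "(\<lambda>x. u m (A x)) \<in> borel_measurable M" for m unfolding u_def hinge_sum_def by measurable
  have "(\<integral>\<^sup>+x. ennreal (g (A x) - g 0) \<partial>M) = (\<integral>\<^sup>+x. liminf (\<lambda>m. ennreal (u m (A x))) \<partial>M)"
  proof (intro nn_integral_cong)
    fix x
    have "(\<lambda>m. ennreal (u m (A x))) \<longlonglongrightarrow> ennreal (g (A x) - g 0)"
      unfolding u_def by (intro tendsto_ennrealI hinge_sum_tendsto[OF g] A)
    thus "ennreal (g (A x) - g 0) = liminf (\<lambda>m. ennreal (u m (A x)))"
      by (simp add: lim_imp_Liminf)
  qed
  also have "\<dots> \<le> liminf (\<lambda>m. \<integral>\<^sup>+x. ennreal (u m (A x)) \<partial>M)"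
    by (intro nn_integral_liminf) simp
  also have "\<dots> \<le> liminf (\<lambda>m::nat. \<integral>\<^sup>+x. ennreal (g (B x) - g 0) \<partial>N)"
    by (intro Liminf_mono always_eventually allI step)
  also have "\<dots> = (\<integral>\<^sup>+x. ennreal (g (B x) - g 0) \<partial>N)" by (simp add: Liminf_const)
  finally show ?thesis .
qed

section \<open>Passage to continuous processes\<close>

text \<open>The oscillation is the maximum of \<open>x\<close> plus the maximum of
  \<open>- x\<close>, and these have equal expectations by symmetry of the law.\<close>

lemma (in gaussian_vector) expectation_Max:
  assumes J: "J \<noteq> {}"
  shows "integrable M (\<lambda>\<omega>. Max ((\<lambda>j. X j \<omega>) ` J))"
    and "expectation (\<lambda>\<omega>. Max ((\<lambda>j. X j \<omega>) ` J)) = expectation (\<lambda>\<omega>. oscillation J (\<lambda>j. X j \<omega>)) / 2"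
proof -
  define m where "m x = Max ((\<lambda>j. x j) ` J)" for x :: "'i \<Rightarrow> real"
  have m_ge: "x j \<le> m x" if "j \<in> J" for x j unfolding m_def using that finite_J by (intro Max_ge) auto
  have m_in: "\<exists>j\<in>J. m x = x j" for x
  proof -
    have "m x \<in> (\<lambda>j. x j) ` J" unfolding m_def using finite_J J by (intro Max_in) auto
    thus ?thesis by blast
  qed
  have m_restrict: "m (\<lambda>j\<in>J. x j) = m x" for x unfolding m_def by (intro arg_cong[where f=Max]) auto
  have [measurable]: "m \<in> borel_measurable (Pi\<^sub>M J (\<lambda>_. borel))"
    unfolding m_def using finite_J by (intro borel_measurable_Max) auto
  have osc: "oscillation J x = m x + m (\<lambda>j. - x j)" for x
  proof (rule antisym)
    obtain i j where "i \<in> J" "j \<in> J" "oscillation J x = x i - x j"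
      using oscillation_obtain[OF finite_J J] by blast
    thus "oscillation J x \<le> m x + m (\<lambda>j. - x j)" using m_ge[of i x] m_ge[of j "\<lambda>j. - x j"] by simp
    obtain i j where "i \<in> J" "j \<in> J" "m x = x i" "m (\<lambda>j. - x j) = - x j" using m_in by metis
    thus "m x + m (\<lambda>j. - x j) \<le> oscillation J x" using oscillation_ge[OF finite_J, of i j x] by simp
  qed
  have int: "integrable M (\<lambda>\<omega>. m (\<lambda>j. c * X j \<omega>))" if c: "c = 1 \<or> c = - 1" for c
  proof (rule Bochner_Integration.integrable_bound)
    show "integrable M (\<lambda>\<omega>. \<Sum>j\<in>J. \<bar>X j \<omega>\<bar>)" using X_integrable by auto
    show "(\<lambda>\<omega>. m (\<lambda>j. c * X j \<omega>)) \<in> borel_measurable M"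
      unfolding m_def using finite_J by (intro borel_measurable_Max) auto
    show "AE \<omega> in M. norm (m (\<lambda>j. c * X j \<omega>)) \<le> norm (\<Sum>j\<in>J. \<bar>X j \<omega>\<bar>)"
    proof (intro AE_I2)
      fix \<omega>
      obtain j where j: "j \<in> J" "m (\<lambda>j. c * X j \<omega>) = c * X j \<omega>" using m_in by blast
      have "\<bar>X j \<omega>\<bar> \<le> (\<Sum>j\<in>J. \<bar>X j \<omega>\<bar>)"
        using j finite_J by (intro member_le_sum[where f="\<lambda>j. \<bar>X j \<omega>\<bar>"]) auto
      thus "norm (m (\<lambda>j. c * X j \<omega>)) \<le> norm (\<Sum>j\<in>J. \<bar>X j \<omega>\<bar>)" using c unfolding j(2) by (auto simp: abs_mult)
    qed
  qed
  have minus [measurable]: "(\<lambda>\<omega>. \<lambda>j\<in>J. - X j \<omega>) \<in> measurable M (Pi\<^sub>M J (\<lambda>_. borel))"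
    by (rule measurable_restrict) simp
  have "expectation (\<lambda>\<omega>. m (\<lambda>j\<in>J. X j \<omega>)) = expectation (\<lambda>\<omega>. m (\<lambda>j\<in>J. - X j \<omega>))"
    using integral_distr[OF vector_measurable, of m] integral_distr[OF minus, of m] distr_uminus by simp
  hence sym: "expectation (\<lambda>\<omega>. m (\<lambda>j. X j \<omega>)) = expectation (\<lambda>\<omega>. m (\<lambda>j. - X j \<omega>))"
    unfolding m_restrict .
  have "expectation (\<lambda>\<omega>. oscillation J (\<lambda>j. X j \<omega>)) = expectation (\<lambda>\<omega>. m (\<lambda>j. X j \<omega>)) + expectation (\<lambda>\<omega>. m (\<lambda>j. - X j \<omega>))"
    unfolding osc using int[of 1] int[of "- 1"] by simp
  with sym show "expectation (\<lambda>\<omega>. Max ((\<lambda>j. X j \<omega>) ` J)) = expectation (\<lambda>\<omega>. oscillation J (\<lambda>j. X j \<omega>)) / 2"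
    by (simp add: m_def)
  show "integrable M (\<lambda>\<omega>. Max ((\<lambda>j. X j \<omega>) ` J))" using int[of 1] by (simp add: m_def)
qed

section \<open>Suprema of continuous paths as limits over grids\<close>

definition grid :: "real \<Rightarrow> nat \<Rightarrow> real set" where
  "grid T n = (\<lambda>k. T * real k / real (Suc n)) ` {..Suc n}"

lemma finite_grid: "finite (grid T n)" and zero_in_grid: "0 \<in> grid T n"
  unfolding grid_def by (auto intro: image_eqI[where x=0])

lemma grid_subset:
  assumes "0 \<le> T" 
  shows "grid T n \<subseteq> {0..T}"
proof
  fix t assume "t \<in> grid T n"
  then obtain k where k: "k \<le> Suc n" "t = T * real k / real (Suc n)" by (auto simp: grid_def)
  have "T * real k \<le> T * real (Suc n)" using k assms by (intro mult_left_mono) auto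
  hence "T * real k / real (Suc n) \<le> T" by (subst pos_divide_le_eq) simp_all
  thus "t \<in> {0..T}" using k(2) assms by simp
qed

lemma grid_approx:
  assumes T: "0 < T" and t: "t \<in> {0..T}"
  obtains p where "\<And>n. p n \<in> grid T n" "p \<longlonglongrightarrow> t"
proof
  define k where "k n = nat \<lfloor>t * real (Suc n) / T\<rfloor>" for n
  define p where "p n = T * real (k n) / real (Suc n)" for n
  have pos: "0 \<le> \<lfloor>t * real (Suc n) / T\<rfloor>" for n using t T by simp
  have k: "real (k n) \<le> t * real (Suc n) / T" "t * real (Suc n) / T \<le> real (k n) + 1" for n
    using pos[of n] real_of_int_floor_add_one_gt[of "t * real (Suc n) / T"] by (auto simp: k_def of_nat_nat)
  have "t * real (Suc n) / T \<le> real (Suc n)" for n using t T by (simp add: divide_simps mult.commute mult_left_mono)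
  hence "real (k n) \<le> real (Suc n)" for n using k(1)[of n] by (rule order_trans[rotated])
  thus "p n \<in> grid T n" for n
    unfolding p_def grid_def by (intro image_eqI[of _ _ "k n"] refl) (simp only: of_nat_le_iff atMost_iff)
  have upper: "p n \<le> t" for n using k(1)[of n] T by (simp add: p_def divide_simps mult.commute)
  have lower: "t - T / real (Suc n) \<le> p n" for n
  proof -
    have "t * real (Suc n) \<le> T * (real (k n) + 1)" using k(2)[of n] T by (simp add: pos_divide_le_eq mult.commute)
    hence "t \<le> T * (real (k n) + 1) / real (Suc n)" by (simp only: pos_le_divide_eq of_nat_0_less_iff zero_less_Suc)
    also have "\<dots> = p n + T / real (Suc n)" by (simp only: p_def distrib_left add_divide_distrib mult_1_right)
    finally show ?thesis by simp
  qed
  show "p \<longlonglongrightarrow> t"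
  proof (rule tendsto_sandwich[OF always_eventually always_eventually])
    have "(\<lambda>n. t - T * (1 / real (Suc n))) \<longlonglongrightarrow> t - T * 0"
      by (intro tendsto_intros) (use LIMSEQ_inverse_real_of_nat in \<open>simp add: inverse_eq_divide\<close>)
    thus "(\<lambda>n. t - T / real (Suc n)) \<longlonglongrightarrow> t" by simp
    show "(\<lambda>n::nat. t) \<longlonglongrightarrow> t" by simp
  qed (use upper lower in auto)
qed

text \<open>The grids are not nested, so instead of monotonicity the proof uses grid points
  approaching a maximizer \<open>t0\<close> and a minimizer \<open>s0\<close>, which exist by
  compactness.\<close>

lemma grid_tendsto_SUP:
  fixes f :: "real \<Rightarrow> real"
  assumes T: "0 < T" and f: "continuous_on {0..T} f"
  shows "oscillation (grid T n) f \<le> (SUP (t, s) \<in> {0..T} \<times> {0..T}. f t - f s)"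
    and "(\<lambda>n. oscillation (grid T n) f) \<longlonglongrightarrow> (SUP (t, s) \<in> {0..T} \<times> {0..T}. f t - f s)"
    and "Max (f ` grid T n) \<le> (SUP t \<in> {0..T}. f t)"
    and "(\<lambda>n. Max (f ` grid T n)) \<longlonglongrightarrow> (SUP t \<in> {0..T}. f t)"
    and "f 0 \<le> (SUP t \<in> {0..T}. f t)"
proof -
  have ne: "{0..T} \<noteq> {}" using T by simp
  obtain t0 where t0: "t0 \<in> {0..T}" "\<And>t. t \<in> {0..T} \<Longrightarrow> f t \<le> f t0"
    using continuous_attains_sup[OF compact_Icc ne f] by blast
  obtain s0 where s0: "s0 \<in> {0..T}" "\<And>t. t \<in> {0..T} \<Longrightarrow> f s0 \<le> f t"
    using continuous_attains_inf[OF compact_Icc ne f] by blast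
  have sup1: "(SUP t \<in> {0..T}. f t) = f t0"
    by (rule cSup_eq_maximum) (use t0 in auto)
  have sup2: "(SUP (t, s) \<in> {0..T} \<times> {0..T}. f t - f s) = f t0 - f s0"
  proof (rule cSup_eq_maximum)
    show "f t0 - f s0 \<in> (\<lambda>(t, s). f t - f s) ` ({0..T} \<times> {0..T})" using t0 s0 by (auto intro!: image_eqI[where x="(t0, s0)"])
    fix y assume "y \<in> (\<lambda>(t, s). f t - f s) ` ({0..T} \<times> {0..T})"
    then obtain t s where "t \<in> {0..T}" "s \<in> {0..T}" "y = f t - f s" by auto
    thus "y \<le> f t0 - f s0" using t0(2)[of t] s0(2)[of s] by simp
  qed
  note sub = subsetD[OF grid_subset[OF less_imp_le[OF T]]]
  have ne': "grid T n \<noteq> {}" for n using zero_in_grid by blast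
  have tend: "(\<lambda>n. f (p n)) \<longlonglongrightarrow> f t" if "\<And>n. p n \<in> grid T n" "p \<longlonglongrightarrow> t" "t \<in> {0..T}" for p t
    by (rule continuous_on_tendsto_compose[OF f that(2,3)], rule always_eventually) (use that(1) sub in blast)
  obtain p where p: "\<And>n. p n \<in> grid T n" "p \<longlonglongrightarrow> t0" using grid_approx[OF T t0(1)] by blast
  obtain q where q: "\<And>n. q n \<in> grid T n" "q \<longlonglongrightarrow> s0" using grid_approx[OF T s0(1)] by blast
  show osc_le: "oscillation (grid T n) f \<le> (SUP (t, s) \<in> {0..T} \<times> {0..T}. f t - f s)" for n
  proof -
    obtain t s where ts: "t \<in> grid T n" "s \<in> grid T n" "oscillation (grid T n) f = f t - f s"
      using oscillation_obtain[OF finite_grid ne'] by blast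
    thus ?thesis unfolding sup2 ts(3) using t0(2)[OF sub[OF ts(1)]] s0(2)[OF sub[OF ts(2)]] by simp
  qed
  show "(\<lambda>n. oscillation (grid T n) f) \<longlonglongrightarrow> (SUP (t, s) \<in> {0..T} \<times> {0..T}. f t - f s)"
  proof (rule tendsto_sandwich[OF always_eventually always_eventually])
    show "(\<lambda>n. f (p n) - f (q n)) \<longlonglongrightarrow> (SUP (t, s) \<in> {0..T} \<times> {0..T}. f t - f s)"
      unfolding sup2 by (intro tendsto_diff tend p q t0 s0)
    show "\<forall>n. f (p n) - f (q n) \<le> oscillation (grid T n) f"
      using oscillation_ge[OF finite_grid p(1) q(1)] by blast
    show "(\<lambda>n::nat. SUP (t, s) \<in> {0..T} \<times> {0..T}. f t - f s) \<longlonglongrightarrow> (SUP (t, s) \<in> {0..T} \<times> {0..T}. f t - f s)" by simp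
  qed (use osc_le in blast)
  show max_le: "Max (f ` grid T n) \<le> (SUP t \<in> {0..T}. f t)" for n
    unfolding sup1 using finite_grid ne' t0(2) sub by (subst Max_le_iff) auto
  show "(\<lambda>n. Max (f ` grid T n)) \<longlonglongrightarrow> (SUP t \<in> {0..T}. f t)"
  proof (rule tendsto_sandwich[OF always_eventually always_eventually])
    show "(\<lambda>n. f (p n)) \<longlonglongrightarrow> (SUP t \<in> {0..T}. f t)"
      unfolding sup1 by (intro tend p t0)
    show "\<forall>n. f (p n) \<le> Max (f ` grid T n)" using p(1) finite_grid by (auto intro!: Max_ge)
    show "(\<lambda>n::nat. SUP t \<in> {0..T}. f t) \<longlonglongrightarrow> (SUP t \<in> {0..T}. f t)" by simp
  qed (use max_le in blast)
  show "f 0 \<le> (SUP t \<in> {0..T}. f t)" unfolding sup1 using t0 T by simp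
qed

text \<open>The extended expectation of a variable bounded below, written through one nonnegative
  integral, so that no difference of two possibly infinite terms has to be compared.\<close>

lemma ext_expectation_shift:
  assumes "prob_space M" and f' [measurable]: "f' \<in> borel_measurable M"
    and eq: "AE \<omega> in M. f \<omega> = f' \<omega>" and ge: "AE \<omega> in M. a \<le> f \<omega>"
  shows "ext_expectation M f = enn2ereal (\<integral>\<^sup>+\<omega>. ennreal (f \<omega> - a) \<partial>M) + ereal a"
proof -
  interpret prob_space M by fact
  define P Q I where "P = (\<integral>\<^sup>+\<omega>. ennreal (f' \<omega>) \<partial>M)" and "Q = (\<integral>\<^sup>+\<omega>. ennreal (- f' \<omega>) \<partial>M)"
    and "I = (\<integral>\<^sup>+\<omega>. ennreal (f' \<omega> - a) \<partial>M)"
  have ge': "AE \<omega> in M. a \<le> f' \<omega>" using eq ge by eventually_elim simp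
  have "(\<integral>\<^sup>+\<omega>. ennreal (f \<omega>) \<partial>M) = P" "(\<integral>\<^sup>+\<omega>. ennreal (- f \<omega>) \<partial>M) = Q"
    "(\<integral>\<^sup>+\<omega>. ennreal (f \<omega> - a) \<partial>M) = I"
    unfolding P_def Q_def I_def using eq by (auto intro!: nn_integral_cong_AE elim!: eventually_mono)
  note fold = this
  \<comment> \<open>Positive and negative parts of \<open>x - a = x - a\<close>, moved across so
    that every term is nonnegative; it can be integrated even when the integrals are
    infinite.\<close>
  have "ennreal (x - a) + (ennreal (- x) + ennreal a) = ennreal x + ennreal (- a)" if "a \<le> x" for x
    using that by (cases "0 \<le> x"; cases "0 \<le> a") (auto simp: ennreal_neg simp flip: ennreal_plus)
  hence "(\<integral>\<^sup>+\<omega>. ennreal (f' \<omega> - a) + (ennreal (- f' \<omega>) + ennreal a) \<partial>M) = (\<integral>\<^sup>+\<omega>. ennreal (f' \<omega>) + ennreal (- a) \<partial>M)"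
    using ge' by (intro nn_integral_cong_AE) (auto elim!: eventually_mono)
  hence balance: "I + (Q + ennreal a) = P + ennreal (- a)"
    unfolding P_def Q_def I_def by (simp add: nn_integral_add emeasure_space_1)
  \<comment> \<open>The lower bound \<open>a\<close> makes the negative part finite, so the
    subtraction in \<open>ext_expectation\<close> is meaningful.\<close>
  have "Q \<le> (\<integral>\<^sup>+\<omega>. ennreal (- a) \<partial>M)"
    unfolding Q_def using ge' by (intro nn_integral_mono_AE) (auto elim!: eventually_mono intro: ennreal_leI)
  hence "Q \<le> ennreal (- a)" by (simp add: emeasure_space_1)
  hence "Q \<noteq> top" by (auto simp: top_unique)
  then obtain q where q: "0 \<le> q" "Q = ennreal q" by (cases Q) auto
  have "enn2ereal P - enn2ereal Q = enn2ereal I + ereal a"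
  proof (cases I)
    case top
    hence "P + ennreal (- a) = top" using balance by simp
    hence "P = top" by (simp add: ennreal_add_eq_top)
    thus ?thesis using top q by simp
  next
    case (real i)
    hence "P \<noteq> top" using balance q by auto
    then obtain p where p: "0 \<le> p" "P = ennreal p" by (cases P) auto
    have "ennreal (i + (q + max 0 a)) = ennreal (p + max 0 (- a))"
    proof -
      have "ennreal a = ennreal (max 0 a)" "ennreal (- a) = ennreal (max 0 (- a))"
        by (simp_all add: max_def ennreal_neg)
      with balance real p q show ?thesis by (simp add: ennreal_plus del: ennreal_max_0 ennreal_max_0')
    qed
    hence "i + (q + max 0 a) = p + max 0 (- a)"
      using real p q by (subst (asm) ennreal_inj) auto
    hence "p - q = i + a" by (auto simp: max_def split: if_splits)
    thus ?thesis using real p q by simp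
  qed
  thus ?thesis unfolding ext_expectation_def fold .
qed

section \<open>Increments of bifractional Brownian motion\<close>

lemma power2_powr: "(x\<^sup>2) powr a = x powr (2 * a)" if "0 \<le> x" for x a :: real
proof -
  have "(x\<^sup>2) powr a = x powr (a + a)"
    using that by (simp only: power2_eq_square powr_mult powr_add)
  thus ?thesis by (simp only: mult_2)
qed

lemma power2_powr_mult: "(x\<^sup>2) powr (a - 1) * x = x powr (2 * a - 1)" if "0 < x" for x a :: real
proof -
  have "(x\<^sup>2) powr (a - 1) * x = x powr (2 * (a - 1)) * x powr 1"
    using that by (simp only: power2_powr less_imp_le powr_one)
  also have "\<dots> = x powr (2 * (a - 1) + 1)" by (simp only: powr_add)
  finally show ?thesis by (simp only: algebra_simps) simp
qed

text \<open>Subadditivity of \<open>z powr a\<close>: on the unit interval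
  \<open>z \<le> z powr a\<close>, applied to the two fractions \<open>(y - x) / y\<close> and
  \<open>x / y\<close>, which sum to 1.\<close>

lemma powr_diff_le_diff_powr: 
  fixes a x y :: real
  assumes "0 < a" "a \<le> 1" "0 \<le> x" "x \<le> y"
  shows "y powr a - x powr a \<le> (y - x) powr a"
proof (cases "y = 0")
  case False
  hence y: "y > 0" using assms by simp
  have le: "z \<le> z powr a" if "0 \<le> z" "z \<le> 1" for z
    using powr_mono'[of a 1 z] that assms by simp
  have "1 = (y - x) / y + x / y" using y by (simp add: field_simps)
  also have "\<dots> \<le> ((y - x) / y) powr a + (x / y) powr a"
    using y assms by (intro add_mono le) auto
  also have "\<dots> = ((y - x) powr a + x powr a) / y powr a"
    using y assms by (simp add: powr_divide add_divide_distrib)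
  finally show ?thesis using y by (simp add: field_simps)
qed (use assms in auto)

lemma two_powr_le_sum_powr:
  fixes p q s :: real
  assumes "0 \<le> q" "q \<le> p" "1 \<le> s"
  shows "2 * p powr s \<le> (p + q) powr s + (p - q) powr s"
proof (cases "q = p")
  case True
  have "2 * p powr s \<le> 2 powr s * p powr s"
    using assms powr_mono[of 1 s 2] by (intro mult_right_mono) auto
  thus ?thesis using True assms by (simp add: powr_mult flip: mult_2)
next
  case False
  with assms have "p - q > 0" "p + q > 0" by auto
  hence "((1 - 1/2) *\<^sub>R (p + q) + (1/2) *\<^sub>R (p - q)) powr s \<le> (1 - 1/2) * (p + q) powr s + (1/2) * (p - q) powr s"
    by (intro convex_onD[OF powr_convex[OF assms(3)]]) auto
  thus ?thesis by (simp add: field_simps)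
qed

text \<open>The arithmetic mean dominates the geometric mean of the two powers, which is
  \<open>((p + q) * (p - q)) powr (s / 2)\<close>. As \<open>s\<close> is nonpositive, replacing the
  base by the larger \<open>p\<^sup>2\<close> only decreases it.\<close>

lemma two_powr_le_sum_powr_neg:
  fixes p q s :: real
  assumes "0 \<le> q" "q < p" "s \<le> 0"
  shows "2 * p powr s \<le> (p + q) powr s + (p - q) powr s"
proof -
  have pos: "p - q > 0" "p + q > 0" "p > 0" using assms by auto
  define a b where "a = (p + q) powr (s/2)" and "b = (p - q) powr (s/2)"
  have sq: "(p + q) powr s = a\<^sup>2" "(p - q) powr s = b\<^sup>2"
    by (simp_all add: a_def b_def power2_eq_square flip: powr_add)
  have "q * q < p * p" using assms by (intro mult_strict_mono) auto
  hence "(p\<^sup>2) powr (s/2) \<le> ((p + q) * (p - q)) powr (s/2)"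
    using pos assms by (intro powr_mono2') (auto simp: algebra_simps power2_eq_square)
  also have "\<dots> = a * b" using pos by (simp add: a_def b_def powr_mult)
  also have "(p\<^sup>2) powr (s/2) = p powr s"
    using pos by (simp add: power2_powr)
  finally have "p powr s \<le> a * b" .
  moreover have "2 * (a * b) \<le> a\<^sup>2 + b\<^sup>2" using sum_squares_bound[of a b] by simp
  ultimately show ?thesis unfolding sq by linarith
qed

text \<open>With \<open>u = p + q\<close> and \<open>v = p - q\<close> this is the increment
  estimate for bifractional Brownian motion, with \<open>(u - v)\<^sup>2\<close> in place of the
  time difference to the power \<open>2 * H\<close>. In both regimes \<open>p\<close> is lowered to
  \<open>q\<close>, where the inequality is explicit.\<close>

lemma sum_squares_powr_le:
  fixes p q K :: real
  assumes q: "0 \<le> q" and pq: "q \<le> p" and K: "0 < K" "K \<le> 1"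
  shows "2 * (p\<^sup>2 + q\<^sup>2) powr K \<le> (p + q) powr (2*K) + (p - q) powr (2*K) + (2 * q\<^sup>2) powr K"
proof (cases "q = 0")
  case True
  have "(p\<^sup>2) powr K = p powr (2*K)" using pq q
    by (simp add: power2_powr)
  thus ?thesis using True K by simp
next
  case False
  with q have q: "q > 0" by simp
  have sq: "(x\<^sup>2) powr K = x powr (2*K)" if "x > 0" for x
    using that by (simp add: power2_powr)
  show ?thesis
  proof (cases "2 * K \<ge> 1")
    \<comment> \<open>Here \<open>z powr (2 * K)\<close> is convex, which replaces the two shifted
      powers by \<open>2 * p powr (2 * K)\<close> and leaves a monotone function. At
      \<open>q\<close> the surplus is \<open>(2 - 2 powr K) * q powr (2 * K)\<close>.\<close>
    case True
    define f where "f x = x powr (2*K) - (x\<^sup>2 + q\<^sup>2) powr K" for x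
    have "f q \<le> f p"
    proof (rule DERIV_nonneg_imp_nondecreasing[OF pq])
      fix x assume x: "q \<le> x" "x \<le> p"
      with q have "x > 0" by simp
      have D: "(f has_real_derivative (2 * K * x powr (2*K - of_nat 1) * 1 - K * (x\<^sup>2 + q\<^sup>2) powr (K - of_nat 1) * (2 * x))) (at x)"
        unfolding f_def using \<open>x > 0\<close> q
        by (intro DERIV_diff DERIV_fun_powr) (auto intro!: derivative_eq_intros add_pos_pos)
      have "(x\<^sup>2 + q\<^sup>2) powr (K - 1) * x \<le> (x\<^sup>2) powr (K - 1) * x"
        using \<open>x > 0\<close> K by (intro mult_right_mono powr_mono2') auto
      moreover have "(x\<^sup>2) powr (K - 1) * x = x powr (2*K - 1)"
        using \<open>x > 0\<close> by (rule power2_powr_mult)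
      ultimately have "2 * K * (x powr (2*K - 1)) \<ge> 2 * K * ((x\<^sup>2 + q\<^sup>2) powr (K - 1) * x)"
        using K by (intro mult_left_mono) auto
      moreover have "(f has_real_derivative 2 * K * (x powr (2*K - 1)) - 2 * K * ((x\<^sup>2 + q\<^sup>2) powr (K - 1) * x)) (at x)"
        by (rule DERIV_cong[OF D]) (simp add: algebra_simps)
      ultimately show "\<exists>y. (f has_real_derivative y) (at x) \<and> 0 \<le> y"
        by (intro exI[of _ "2 * K * (x powr (2*K - 1)) - 2 * K * ((x\<^sup>2 + q\<^sup>2) powr (K - 1) * x)"] conjI; linarith?)
    qed
    moreover have "2 * q powr (2*K) \<ge> 2 powr K * q powr (2*K)"
      using powr_mono[of K 1 2] K by (intro mult_right_mono) auto
    moreover have "(2 * q\<^sup>2) powr K = 2 powr K * q powr (2*K)"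
      using q by (simp add: powr_mult sq)
    moreover have "2 * p powr (2*K) \<le> (p + q) powr (2*K) + (p - q) powr (2*K)"
      using True q pq by (intro two_powr_le_sum_powr) auto
    moreover have "f q = q powr (2*K) - (2 * q\<^sup>2) powr K" by (simp add: f_def)
    ultimately show ?thesis unfolding f_def by linarith
  next
    \<comment> \<open>Now the power is not convex, but its derivative, with negative exponent
      \<open>2 * K - 1\<close>, is. The shifted powers therefore stay inside \<open>f\<close>, and
      their derivatives are compared.\<close>
    case False
    define f where "f x = (x + q) powr (2*K) + (x - q) powr (2*K) - 2 * (x\<^sup>2 + q\<^sup>2) powr K" for x
    have "f q \<le> f p"
    \<comment> \<open>\<open>(x - q) powr (2 * K)\<close> has infinite slope at
      \<open>x = q\<close>, so derivatives are taken in the open interval, with continuity up to the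
      ends.\<close>
    proof (rule DERIV_nonneg_imp_increasing_open[OF pq])
      show "continuous_on {q..p} f" unfolding f_def using q K
        by (intro continuous_on_diff continuous_on_add continuous_on_mult continuous_on_powr' continuous_intros) auto
      fix x assume x: "q < x" "x < p"
      with q have "x > 0" by simp
      have D: "(f has_real_derivative (2 * K * (x + q) powr (2*K - of_nat 1) * 1 + 2 * K * (x - q) powr (2*K - of_nat 1) * 1
          - 2 * (K * (x\<^sup>2 + q\<^sup>2) powr (K - of_nat 1) * (2 * x)))) (at x)"
        unfolding f_def using \<open>x > 0\<close> q x
        by (intro DERIV_diff DERIV_add DERIV_cmult DERIV_fun_powr) (auto intro!: derivative_eq_intros add_pos_pos)
      have "(x\<^sup>2 + q\<^sup>2) powr (K - 1) * x \<le> (x\<^sup>2) powr (K - 1) * x"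
        using \<open>x > 0\<close> K by (intro mult_right_mono powr_mono2') auto
      moreover have "(x\<^sup>2) powr (K - 1) * x = x powr (2*K - 1)"
        using \<open>x > 0\<close> by (rule power2_powr_mult)
      moreover have "2 * x powr (2*K - 1) \<le> (x + q) powr (2*K - 1) + (x - q) powr (2*K - 1)"
        using False q x by (intro two_powr_le_sum_powr_neg) auto
      ultimately have "2 * K * ((x + q) powr (2*K - 1) + (x - q) powr (2*K - 1)) 
          \<ge> 2 * K * (2 * ((x\<^sup>2 + q\<^sup>2) powr (K - 1) * x))"
        using K by (intro mult_left_mono) auto
      moreover have "(f has_real_derivative 2 * K * ((x + q) powr (2*K - 1) + (x - q) powr (2*K - 1))
          - 2 * K * (2 * ((x\<^sup>2 + q\<^sup>2) powr (K - 1) * x))) (at x)"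
        by (rule DERIV_cong[OF D]) (simp add: algebra_simps)
      ultimately show "\<exists>y. (f has_real_derivative y) (at x) \<and> 0 \<le> y"
        by (intro exI[of _ "2 * K * ((x + q) powr (2*K - 1) + (x - q) powr (2*K - 1))
          - 2 * K * (2 * ((x\<^sup>2 + q\<^sup>2) powr (K - 1) * x))"] conjI; linarith?)
    qed
    moreover have "(2 * q\<^sup>2) powr K \<le> (2 * q) powr (2*K)"
    proof -
      have "(2 * q\<^sup>2) powr K \<le> ((2 * q)\<^sup>2) powr K"
        using K by (intro powr_mono2) (auto simp: power_mult_distrib)
      also have "\<dots> = (2 * q) powr (2*K)" using q by (intro sq) simp
      finally show ?thesis .
    qed
    moreover have "f q = (2 * q) powr (2*K) - 2 * (2 * q\<^sup>2) powr K" by (simp add: f_def)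
    ultimately show ?thesis unfolding f_def by linarith
  qed
qed

text \<open>The left side contains the power of the time difference with coefficient
  \<open>2 * 2 powr (-K)\<close>. One half is the claimed bound; the other pays for the excess of
  the mixed term over the diagonal ones. This is \<open>sum_squares_powr_le\<close> for
  \<open>u = t powr H\<close> and \<open>v = s powr H\<close>, with \<open>u - v\<close> bounded
  through subadditivity.\<close>

lemma bifractional_increment_ge:
  fixes H K s t :: real
  assumes H: "0 < H" "H < 1" and K: "0 < K" "K \<le> 1" and st: "0 \<le> s" "0 \<le> t"
  shows "bifractional_cov H K t t + bifractional_cov H K s s - 2 * bifractional_cov H K s t
    \<ge> 2 powr (-K) * \<bar>t - s\<bar> powr (2 * H * K)"
  using st
proof (induction s t rule: linorder_wlog)
  case (sym a b)
  thus ?case by (simp add: bifractional_cov_def add.commute abs_minus_commute mult.commute)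
next
  case (le s t)
  define u v where "u = t powr H" and "v = s powr H"
  have uv: "0 \<le> v" "v \<le> u" unfolding u_def v_def using le H by (auto intro: powr_mono2)
  have t2: "t powr (2*H) = u\<^sup>2" "s powr (2*H) = v\<^sup>2"
    by (simp_all add: u_def v_def power2_eq_square flip: powr_add)
  have diag: "bifractional_cov H K x x = (x powr (2*H)) powr K" for x
  proof -
    have "(x powr (2*H) + x powr (2*H)) powr K = 2 powr K * (x powr (2*H)) powr K"
      by (simp only: mult_2[symmetric] powr_mult)
    thus ?thesis using H K by (simp add: bifractional_cov_def)
  qed
  have mono: "u - v \<le> (t - s) powr H"
    unfolding u_def v_def using powr_diff_le_diff_powr[of H s t] le H by simp
  have "(u - v)\<^sup>2 \<le> ((t - s) powr H)\<^sup>2"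
    using mono uv by (intro power_mono) auto
  hence "((u - v)\<^sup>2) powr K \<le> (((t - s) powr H)\<^sup>2) powr K"
    using K by (intro powr_mono2) auto
  also have "\<dots> = \<bar>t - s\<bar> powr (2 * H * K)"
    using le by (simp add: power2_powr powr_powr mult_ac)
  finally have d: "((u - v)\<^sup>2) powr K \<le> \<bar>t - s\<bar> powr (2 * H * K)" .
  have "2 * (((u + v)/2)\<^sup>2 + ((u - v)/2)\<^sup>2) powr K \<le>
     ((u + v)/2 + (u - v)/2) powr (2*K) + ((u + v)/2 - (u - v)/2) powr (2*K) + (2 * ((u - v)/2)\<^sup>2) powr K"
    using uv K by (intro sum_squares_powr_le) auto
  also have "((u + v)/2)\<^sup>2 + ((u - v)/2)\<^sup>2 = (u\<^sup>2 + v\<^sup>2) / 2"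
    by (simp add: power2_eq_square field_simps)
  also have "(u + v)/2 + (u - v)/2 = u" by (simp add: field_simps)
  also have "(u + v)/2 - (u - v)/2 = v" by (simp add: field_simps)
  also have "2 * ((u - v)/2)\<^sup>2 = (u - v)\<^sup>2 / 2" by (simp add: power2_eq_square field_simps)
  finally have "2 * ((u\<^sup>2 + v\<^sup>2) powr K / 2 powr K) \<le> u powr (2*K) + v powr (2*K) + ((u - v)\<^sup>2) powr K / 2 powr K"
    by (simp add: powr_divide)
  also have "\<dots> \<le> u powr (2*K) + v powr (2*K) + \<bar>t - s\<bar> powr (2 * H * K) / 2 powr K"
    using d by (intro add_left_mono divide_right_mono) auto
  finally have "2 * ((u\<^sup>2 + v\<^sup>2) powr K / 2 powr K) \<le> (u\<^sup>2) powr K + (v\<^sup>2) powr K + \<bar>t - s\<bar> powr (2 * H * K) / 2 powr K"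
    using uv by (simp add: power2_powr)
  thus ?case unfolding diag by (simp add: bifractional_cov_def t2 abs_minus_commute powr_minus divide_simps)
qed

section \<open>Comparison of processes\<close>

text \<open>In the limit over grids, Fatou's lemma handles \<open>X\<close>, and for
  \<open>Y\<close> the grid functionals lie below the suprema over the interval; uniform
  integrability never enters. The second claim is the comparison at level \<open>c = 0\<close>,
  halved by \<open>expectation_Max\<close>.\<close>

lemma process_comparison:
  fixes X :: "real \<Rightarrow> 'a \<Rightarrow> real" and Y :: "real \<Rightarrow> 'b \<Rightarrow> real"
  assumes M: "prob_space M" and N: "prob_space N" and T: "0 < T"
    and X: "\<And>J. finite J \<Longrightarrow> J \<subseteq> {0..T} \<Longrightarrow> gaussian_vector M J X"
    and Y: "\<And>J. finite J \<Longrightarrow> J \<subseteq> {0..T} \<Longrightarrow> gaussian_vector N J Y"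
    and X_cont: "AE \<omega> in M. continuous_on {0..T} (\<lambda>t. X t \<omega>)"
    and Y_cont: "AE \<omega> in N. continuous_on {0..T} (\<lambda>t. Y t \<omega>)"
    and X0: "AE \<omega> in M. X 0 \<omega> = 0" and Y0: "AE \<omega> in N. Y 0 \<omega> = 0"
    and incr: "\<And>s t. s \<in> {0..T} \<Longrightarrow> t \<in> {0..T} \<Longrightarrow>
      (\<integral>\<omega>. (X s \<omega> - X t \<omega>)\<^sup>2 \<partial>M) \<le> (\<integral>\<omega>. (Y s \<omega> - Y t \<omega>)\<^sup>2 \<partial>N)"
  shows "\<And>g. mono_on {0..} g \<Longrightarrow> convex_on {0..} g \<Longrightarrow>
      ext_expectation M (\<lambda>\<omega>. g (SUP (t, s) \<in> {0..T} \<times> {0..T}. X t \<omega> - X s \<omega>))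
      \<le> ext_expectation N (\<lambda>\<omega>. g (SUP (t, s) \<in> {0..T} \<times> {0..T}. Y t \<omega> - Y s \<omega>))"
    and "ext_expectation M (\<lambda>\<omega>. SUP t \<in> {0..T}. X t \<omega>) \<le> ext_expectation N (\<lambda>\<omega>. SUP t \<in> {0..T}. Y t \<omega>)"
proof -
  note sub = grid_subset[OF less_imp_le[OF T]]
  note sup = grid_tendsto_SUP[OF T]
  have vX: "gaussian_vector M (grid T n) X" and vY: "gaussian_vector N (grid T n) Y" for n
    by (intro X Y finite_grid sub)+
  have ne: "grid T n \<noteq> {}" for n using zero_in_grid by blast
  note mX = gaussian_vector.X_measurable[OF vX] and mY = gaussian_vector.X_measurable[OF vY]
  have osc_m: "(\<lambda>\<omega>. oscillation (grid T n) (\<lambda>t. X t \<omega>)) \<in> borel_measurable M"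
    "(\<lambda>\<omega>. oscillation (grid T n) (\<lambda>t. Y t \<omega>)) \<in> borel_measurable N" for n
    using mX mY by (auto intro!: measurable_oscillation finite_grid)
  have Max_m: "(\<lambda>\<omega>. Max ((\<lambda>t. X t \<omega>) ` grid T n)) \<in> borel_measurable M"
    "(\<lambda>\<omega>. Max ((\<lambda>t. Y t \<omega>) ` grid T n)) \<in> borel_measurable N" for n
    using mX mY by (auto intro!: borel_measurable_Max finite_grid)
  have Fatou: "(\<integral>\<^sup>+\<omega>. ennreal (F \<omega>) \<partial>M) \<le> (\<integral>\<^sup>+\<omega>. ennreal (F' \<omega>) \<partial>N)"
    if [measurable]: "\<And>n. f n \<in> borel_measurable M" and lim: "AE \<omega> in M. (\<lambda>n. f n \<omega>) \<longlonglongrightarrow> F \<omega>"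
      and le: "\<And>n. (\<integral>\<^sup>+\<omega>. ennreal (f n \<omega>) \<partial>M) \<le> (\<integral>\<^sup>+\<omega>. ennreal (f' n \<omega>) \<partial>N)"
      and le': "\<And>n. AE \<omega> in N. f' n \<omega> \<le> F' \<omega>" for f :: "nat \<Rightarrow> 'a \<Rightarrow> real" and F f' F'
  proof -
    have "(\<integral>\<^sup>+\<omega>. ennreal (F \<omega>) \<partial>M) = (\<integral>\<^sup>+\<omega>. liminf (\<lambda>n. ennreal (f n \<omega>)) \<partial>M)"
      using lim by (intro nn_integral_cong_AE)
        (auto elim!: eventually_mono intro!: lim_imp_Liminf[symmetric] tendsto_ennrealI)
    also have "\<dots> \<le> liminf (\<lambda>n. \<integral>\<^sup>+\<omega>. ennreal (f n \<omega>) \<partial>M)"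
      by (intro nn_integral_liminf) simp
    also have "\<dots> \<le> liminf (\<lambda>n::nat. \<integral>\<^sup>+\<omega>. ennreal (F' \<omega>) \<partial>N)"
    proof (intro Liminf_mono always_eventually allI)
      fix n
      have "(\<integral>\<^sup>+\<omega>. ennreal (f' n \<omega>) \<partial>N) \<le> (\<integral>\<^sup>+\<omega>. ennreal (F' \<omega>) \<partial>N)"
        using le'[of n] by (intro nn_integral_mono_AE) (auto elim!: eventually_mono intro: ennreal_leI)
      with le[of n] show "(\<integral>\<^sup>+\<omega>. ennreal (f n \<omega>) \<partial>M) \<le> (\<integral>\<^sup>+\<omega>. ennreal (F' \<omega>) \<partial>N)" by (rule order_trans)
    qed
    finally show ?thesis by (simp add: Liminf_const)
  qed
  show "ext_expectation M (\<lambda>\<omega>. g (SUP (t, s) \<in> {0..T} \<times> {0..T}. X t \<omega> - X s \<omega>))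
      \<le> ext_expectation N (\<lambda>\<omega>. g (SUP (t, s) \<in> {0..T} \<times> {0..T}. Y t \<omega> - Y s \<omega>))"
    if g: "mono_on {0..} g" "convex_on {0..} g" for g
  proof -
    define oscX where "oscX \<omega> = (SUP (t, s) \<in> {0..T} \<times> {0..T}. X t \<omega> - X s \<omega>)" for \<omega>
    define oscY where "oscY \<omega> = (SUP (t, s) \<in> {0..T} \<times> {0..T}. Y t \<omega> - Y s \<omega>)" for \<omega>
    \<comment> \<open>\<open>g\<close> is controlled on \<open>{0..}\<close> only; this extension is
      monotone on the whole line and hence Borel measurable.\<close>
    define h where "h x = g (max 0 x)" for x
    have h: "h x = g x" if "0 \<le> x" for x using that by (simp add: h_def)
    have "mono h" unfolding h_def by (intro monoI mono_onD[OF g(1)]) auto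
    hence [measurable]: "h \<in> borel_measurable borel" by (rule borel_measurable_mono)
    note osc_nonneg = oscillation_nonneg[OF finite_grid ne]
    have lim: "0 \<le> l" "(\<lambda>n. g (oscillation (grid T n) f)) \<longlonglongrightarrow> g l"
      if "(\<lambda>n. oscillation (grid T n) f) \<longlonglongrightarrow> l" "\<And>n. oscillation (grid T n) f \<le> l" for f l
      using osc_nonneg[of 0 f] that(2)[of 0]
      by (auto intro!: convex_on_tendsto_from_below[OF g(2)] osc_nonneg that)
    have shift: "ext_expectation L (\<lambda>\<omega>. g (SUP (t, s) \<in> {0..T} \<times> {0..T}. Z t \<omega> - Z s \<omega>))
       = enn2ereal (\<integral>\<^sup>+\<omega>. ennreal (g (SUP (t, s) \<in> {0..T} \<times> {0..T}. Z t \<omega> - Z s \<omega>) - g 0) \<partial>L) + ereal (g 0)"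
      if L: "prob_space L" and cont: "AE \<omega> in L. continuous_on {0..T} (\<lambda>t. Z t \<omega>)"
        and [measurable]: "\<And>n. (\<lambda>\<omega>. oscillation (grid T n) (\<lambda>t. Z t \<omega>)) \<in> borel_measurable L"
      for L :: "'c measure" and Z :: "real \<Rightarrow> 'c \<Rightarrow> real"
    proof (rule ext_expectation_shift[OF L])
      \<comment> \<open>A supremum over uncountably many times need not be measurable, but almost
        surely it is the limit of the grid oscillations.\<close>
      show "(\<lambda>\<omega>. h (lim (\<lambda>n. oscillation (grid T n) (\<lambda>t. Z t \<omega>)))) \<in> borel_measurable L"
        by measurable
      show "AE \<omega> in L. g (SUP (t, s) \<in> {0..T} \<times> {0..T}. Z t \<omega> - Z s \<omega>) = h (lim (\<lambda>n. oscillation (grid T n) (\<lambda>t. Z t \<omega>)))"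
        using cont
      proof eventually_elim
        case (elim \<omega>)
        show ?case using limI[OF sup(2)[OF elim]] lim(1)[OF sup(2)[OF elim] sup(1)[OF elim]] by (simp add: h)
      qed
      show "AE \<omega> in L. g 0 \<le> g (SUP (t, s) \<in> {0..T} \<times> {0..T}. Z t \<omega> - Z s \<omega>)"
        using cont
      proof eventually_elim
        case (elim \<omega>)
        show ?case using lim(1)[OF sup(2)[OF elim] sup(1)[OF elim]] by (intro mono_onD[OF g(1)]) auto
      qed
    qed
    have "(\<integral>\<^sup>+\<omega>. ennreal (g (oscX \<omega>) - g 0) \<partial>M) \<le> (\<integral>\<^sup>+\<omega>. ennreal (g (oscY \<omega>) - g 0) \<partial>N)"
    proof (rule Fatou[where f="\<lambda>n \<omega>. g (oscillation (grid T n) (\<lambda>t. X t \<omega>)) - g 0"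
            and f'="\<lambda>n \<omega>. g (oscillation (grid T n) (\<lambda>t. Y t \<omega>)) - g 0"])
      fix n
      have "(\<lambda>\<omega>. h (oscillation (grid T n) (\<lambda>t. X t \<omega>)) - g 0) \<in> borel_measurable M"
        using osc_m(1)[of n] by measurable
      thus "(\<lambda>\<omega>. g (oscillation (grid T n) (\<lambda>t. X t \<omega>)) - g 0) \<in> borel_measurable M"
        by (simp add: h osc_nonneg)
      show "(\<integral>\<^sup>+\<omega>. ennreal (g (oscillation (grid T n) (\<lambda>t. X t \<omega>)) - g 0) \<partial>M)
        \<le> (\<integral>\<^sup>+\<omega>. ennreal (g (oscillation (grid T n) (\<lambda>t. Y t \<omega>)) - g 0) \<partial>N)"
        using sub[of n]
        by (intro increasing_convex_order[OF M N _ _ _ _ _ g] osc_nonneg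
              gaussian_vector.integrable_oscillation[OF vX ne] gaussian_vector.integrable_oscillation[OF vY ne]
              Sudakov_Fernique_max[OF vX vY ne] incr) auto
      show "AE \<omega> in N. g (oscillation (grid T n) (\<lambda>t. Y t \<omega>)) - g 0 \<le> g (oscY \<omega>) - g 0"
        using Y_cont
      proof eventually_elim
        case (elim \<omega>)
        show ?case unfolding oscY_def using sup(1)[OF elim, of n] osc_nonneg[of n "\<lambda>t. Y t \<omega>"]
          by (intro diff_right_mono mono_onD[OF g(1)]) auto
      qed
    next
      show "AE \<omega> in M. (\<lambda>n. g (oscillation (grid T n) (\<lambda>t. X t \<omega>)) - g 0) \<longlonglongrightarrow> g (oscX \<omega>) - g 0"
        using X_cont
      proof eventually_elim
        case (elim \<omega>)
        show ?case unfolding oscX_def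
          by (intro tendsto_diff tendsto_const lim(2)[OF sup(2)[OF elim] sup(1)[OF elim]])
      qed
    qed
    hence "enn2ereal (\<integral>\<^sup>+\<omega>. ennreal (g (oscX \<omega>) - g 0) \<partial>M) + ereal (g 0)
        \<le> enn2ereal (\<integral>\<^sup>+\<omega>. ennreal (g (oscY \<omega>) - g 0) \<partial>N) + ereal (g 0)"
      by (intro add_right_mono) (simp add: less_eq_ennreal.rep_eq)
    thus ?thesis
      unfolding shift[OF M X_cont osc_m(1)] shift[OF N Y_cont osc_m(2)] oscX_def oscY_def .
  qed
  show "ext_expectation M (\<lambda>\<omega>. SUP t \<in> {0..T}. X t \<omega>) \<le> ext_expectation N (\<lambda>\<omega>. SUP t \<in> {0..T}. Y t \<omega>)"
  proof -
    \<comment> \<open>Paths starting at 0 have a nonnegative supremum, so the lower bound for the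
      shift is 0.\<close>
    have shift: "ext_expectation L (\<lambda>\<omega>. SUP t \<in> {0..T}. Z t \<omega>) = enn2ereal (\<integral>\<^sup>+\<omega>. ennreal ((SUP t \<in> {0..T}. Z t \<omega>) - 0) \<partial>L) + ereal 0"
      if L: "prob_space L" and cont: "AE \<omega> in L. continuous_on {0..T} (\<lambda>t. Z t \<omega>)" and Z0: "AE \<omega> in L. Z 0 \<omega> = 0"
        and [measurable]: "\<And>n. (\<lambda>\<omega>. Max ((\<lambda>t. Z t \<omega>) ` grid T n)) \<in> borel_measurable L"
      for L :: "'c measure" and Z :: "real \<Rightarrow> 'c \<Rightarrow> real"
    proof (rule ext_expectation_shift[OF L])
      show "(\<lambda>\<omega>. lim (\<lambda>n. Max ((\<lambda>t. Z t \<omega>) ` grid T n))) \<in> borel_measurable L"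
        by measurable
      show "AE \<omega> in L. (SUP t \<in> {0..T}. Z t \<omega>) = lim (\<lambda>n. Max ((\<lambda>t. Z t \<omega>) ` grid T n))"
        using cont by eventually_elim (simp add: limI[OF sup(4)])
      show "AE \<omega> in L. 0 \<le> (SUP t \<in> {0..T}. Z t \<omega>)"
        using cont Z0
      proof eventually_elim
        case (elim \<omega>)
        thus ?case using sup(5)[OF elim(1)] by simp
      qed
    qed
    have Max_nonneg: "0 \<le> Max ((\<lambda>t. z t) ` grid T n)" if "z 0 = 0" for z :: "real \<Rightarrow> real" and n
      using that Max_ge[of "z ` grid T n" "z 0"] finite_grid zero_in_grid by auto
    have "(\<integral>\<^sup>+\<omega>. ennreal ((SUP t \<in> {0..T}. X t \<omega>) - 0) \<partial>M) \<le> (\<integral>\<^sup>+\<omega>. ennreal ((SUP t \<in> {0..T}. Y t \<omega>) - 0) \<partial>N)"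
    proof (rule Fatou[where f="\<lambda>n \<omega>. Max ((\<lambda>t. X t \<omega>) ` grid T n)" and f'="\<lambda>n \<omega>. Max ((\<lambda>t. Y t \<omega>) ` grid T n)"])
      fix n
      show "(\<lambda>\<omega>. Max ((\<lambda>t. X t \<omega>) ` grid T n)) \<in> borel_measurable M" by (rule Max_m)
      have "(\<integral>\<^sup>+\<omega>. ennreal (Max ((\<lambda>t. X t \<omega>) ` grid T n)) \<partial>M) = ennreal (\<integral>\<omega>. Max ((\<lambda>t. X t \<omega>) ` grid T n) \<partial>M)"
        using X0 by (intro nn_integral_eq_integral gaussian_vector.expectation_Max[OF vX ne]) (auto elim!: eventually_mono intro: Max_nonneg)
      also have "\<dots> \<le> ennreal (\<integral>\<omega>. Max ((\<lambda>t. Y t \<omega>) ` grid T n) \<partial>N)"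
      proof (intro ennreal_leI)
        have "(\<integral>\<omega>. max 0 (oscillation (grid T n) (\<lambda>t. X t \<omega>)) \<partial>M) \<le> (\<integral>\<omega>. max 0 (oscillation (grid T n) (\<lambda>t. Y t \<omega>)) \<partial>N)"
          using sub[of n] by (intro Sudakov_Fernique_max[OF vX vY ne] incr) auto
        thus "(\<integral>\<omega>. Max ((\<lambda>t. X t \<omega>) ` grid T n) \<partial>M) \<le> (\<integral>\<omega>. Max ((\<lambda>t. Y t \<omega>) ` grid T n) \<partial>N)"
          unfolding gaussian_vector.expectation_Max(2)[OF vX ne] gaussian_vector.expectation_Max(2)[OF vY ne]
          by (simp add: max_absorb2 oscillation_nonneg[OF finite_grid ne])
      qed
      also have "\<dots> = (\<integral>\<^sup>+\<omega>. ennreal (Max ((\<lambda>t. Y t \<omega>) ` grid T n)) \<partial>N)"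
        using Y0 by (intro nn_integral_eq_integral[symmetric] gaussian_vector.expectation_Max[OF vY ne]) (auto elim!: eventually_mono intro: Max_nonneg)
      finally show "(\<integral>\<^sup>+\<omega>. ennreal (Max ((\<lambda>t. X t \<omega>) ` grid T n)) \<partial>M) \<le> (\<integral>\<^sup>+\<omega>. ennreal (Max ((\<lambda>t. Y t \<omega>) ` grid T n)) \<partial>N)" .
      show "AE \<omega> in N. Max ((\<lambda>t. Y t \<omega>) ` grid T n) \<le> (SUP t \<in> {0..T}. Y t \<omega>) - 0"
        using Y_cont by eventually_elim (simp add: sup(3))
    next
      show "AE \<omega> in M. (\<lambda>n. Max ((\<lambda>t. X t \<omega>) ` grid T n)) \<longlonglongrightarrow> (SUP t \<in> {0..T}. X t \<omega>) - 0"
        using X_cont by eventually_elim (simp add: sup(4))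
    qed
    thus ?thesis
      unfolding shift[OF M X_cont X0 Max_m(1)] shift[OF N Y_cont Y0 Max_m(2)]
      by (intro add_right_mono) (simp add: less_eq_ennreal.rep_eq)
  qed
qed

section \<open>Covariance consequences of the process definitions, and the theorem\<close>

lemma centered_gaussian_process_vector:
  assumes "prob_space M" "centered_gaussian_process M I C X" "finite J" "J \<subseteq> I"
  shows "gaussian_vector M J X"
proof -
  interpret prob_space M by fact
  show ?thesis
    using assms(2-4)
    by unfold_locales (auto simp: centered_gaussian_process_def gaussian_process_def)
qed

lemma centered_gaussian_process_cov:
  assumes M: "prob_space M" and X: "centered_gaussian_process M I C X" and st: "s \<in> I" "t \<in> I"
  shows "(\<integral>\<omega>. X s \<omega> * X t \<omega> \<partial>M) = C s t"
    and "(\<integral>\<omega>. (X s \<omega> - X t \<omega>)\<^sup>2 \<partial>M) = C s s + C t t - 2 * C s t"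
proof -
  interpret gaussian_vector M "{s, t}" X
    using centered_gaussian_process_vector[OF M X, of "{s, t}"] st by simp
  have C: "(\<integral>\<omega>. X a \<omega> * X b \<omega> \<partial>M) = C a b" if "a \<in> {s, t}" "b \<in> {s, t}" for a b
    using X st that centered[OF that(1)] centered[OF that(2)] unfolding centered_gaussian_process_def cov_def by auto
  show "(\<integral>\<omega>. X s \<omega> * X t \<omega> \<partial>M) = C s t" by (rule C) auto
  have "(\<integral>\<omega>. (X s \<omega> - X t \<omega>)\<^sup>2 \<partial>M) = (\<integral>\<omega>. X s \<omega> * X s \<omega> + X t \<omega> * X t \<omega> - 2 * (X s \<omega> * X t \<omega>) \<partial>M)"
    by (intro Bochner_Integration.integral_cong refl) (simp add: power2_eq_square algebra_simps)
  also have "\<dots> = C s s + C t t - 2 * C s t"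
    using X_mult_integrable by (simp add: C)
  finally show "(\<integral>\<omega>. (X s \<omega> - X t \<omega>)\<^sup>2 \<partial>M) = C s s + C t t - 2 * C s t" .
qed

lemma centered_gaussian_process_AE_zero:
  assumes M: "prob_space M" and X: "centered_gaussian_process M I C X" and t: "t \<in> I" "C t t = 0"
  shows "AE \<omega> in M. X t \<omega> = 0"
proof -
  interpret gaussian_vector M "{t}" X
    using centered_gaussian_process_vector[OF M X, of "{t}"] t by simp
  have "(\<integral>\<omega>. (X t \<omega>)\<^sup>2 \<partial>M) = 0"
    using centered_gaussian_process_cov(1)[OF M X t(1) t(1)] t(2) by (simp add: power2_eq_square)
  thus ?thesis
    using X_square_integrable[of t] by (simp add: integral_nonneg_eq_0_iff_AE)
qed

theorem theorem2p6:
  fixes H K T :: real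
    and M :: "'a measure" and N :: "'b measure"
    and W :: "real \<Rightarrow> 'a \<Rightarrow> real" and B Y :: "real \<Rightarrow> 'b \<Rightarrow> real"
  assumes "0 < H" "H < 1" "0 < K" "K \<le> 1" "0 < T"
    and "prob_space M" and "prob_space N"
    and "bifractional_brownian_motion M {0..T} H K W"
    and "ae_continuous_paths M {0..T} W"
    and "fractional_brownian_motion N {0..T} (H * K) B"
    and "ae_continuous_paths N {0..T} B"
    and "\<And>t \<omega>. t \<in> {0..T} \<Longrightarrow> Y t \<omega> = 2 powr (- (K / 2)) * B t \<omega>"
  shows "(\<forall>g :: real \<Rightarrow> real. mono_on {0..} g \<and> convex_on {0..} g \<longrightarrow>
            ext_expectation M (\<lambda>\<omega>. g (SUP (t, s) \<in> {0..T} \<times> {0..T}. W t \<omega> - W s \<omega>))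
            \<ge> ext_expectation N (\<lambda>\<omega>. g (SUP (t, s) \<in> {0..T} \<times> {0..T}. Y t \<omega> - Y s \<omega>))) \<and>
         ext_expectation M (\<lambda>\<omega>. SUP t \<in> {0..T}. W t \<omega>)
            \<ge> ext_expectation N (\<lambda>\<omega>. SUP t \<in> {0..T}. Y t \<omega>)"
proof -
  note M = \<open>prob_space M\<close> and N = \<open>prob_space N\<close> and T = \<open>0 < T\<close>
  define b where "b = 2 powr (- (K / 2))"
  have b2: "b\<^sup>2 = 2 powr (- K)"
    by (simp add: b_def power2_eq_square flip: powr_add)
  have W: "centered_gaussian_process M {0..T} (bifractional_cov H K) W"
    and B: "centered_gaussian_process N {0..T} (fractional_cov (H * K)) B"
    using assms by (auto simp: bifractional_brownian_motion_def fractional_brownian_motion_def)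
  have W_cont: "AE \<omega> in M. continuous_on {0..T} (\<lambda>t. W t \<omega>)"
    and B_cont: "AE \<omega> in N. continuous_on {0..T} (\<lambda>t. B t \<omega>)"
    using assms by (auto simp: ae_continuous_paths_def)
  have Y: "Y t \<omega> = b * B t \<omega>" if "t \<in> {0..T}" for t \<omega> using assms that by (simp add: b_def)
  have SUP2: "(SUP (t, s) \<in> {0..T} \<times> {0..T}. Y t \<omega> - Y s \<omega>) = (SUP (t, s) \<in> {0..T} \<times> {0..T}. b * B t \<omega> - b * B s \<omega>)" for \<omega>
    by (intro SUP_cong) (auto simp: Y)
  have SUP1: "(SUP t \<in> {0..T}. Y t \<omega>) = (SUP t \<in> {0..T}. b * B t \<omega>)" for \<omega>
    by (intro SUP_cong) (auto simp: Y)
  \<comment> \<open>The scaled fractional process has the smaller increments and takes the place of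
    \<open>X\<close>, with the two probability spaces exchanged accordingly.\<close>
  note cmp = process_comparison[OF N M T, where X="\<lambda>t \<omega>. b * B t \<omega>" and Y=W]
  have prem: "\<And>J. finite J \<Longrightarrow> J \<subseteq> {0..T} \<Longrightarrow> gaussian_vector N J (\<lambda>t \<omega>. b * B t \<omega>)"
    "\<And>J. finite J \<Longrightarrow> J \<subseteq> {0..T} \<Longrightarrow> gaussian_vector M J W"
    "AE \<omega> in N. continuous_on {0..T} (\<lambda>t. b * B t \<omega>)"
    "AE \<omega> in N. b * B 0 \<omega> = 0"
    "AE \<omega> in M. W 0 \<omega> = 0"
    "\<And>s t. s \<in> {0..T} \<Longrightarrow> t \<in> {0..T} \<Longrightarrow>
      (\<integral>\<omega>. (b * B s \<omega> - b * B t \<omega>)\<^sup>2 \<partial>N) \<le> (\<integral>\<omega>. (W s \<omega> - W t \<omega>)\<^sup>2 \<partial>M)"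
  proof -
    show "gaussian_vector N J (\<lambda>t \<omega>. b * B t \<omega>)" if "finite J" "J \<subseteq> {0..T}" for J
      using gaussian_vector.gaussian_vector_scale[OF centered_gaussian_process_vector[OF N B that]] .
    show "gaussian_vector M J W" if "finite J" "J \<subseteq> {0..T}" for J
      using centered_gaussian_process_vector[OF M W that] .
    show "AE \<omega> in N. continuous_on {0..T} (\<lambda>t. b * B t \<omega>)"
      using B_cont by eventually_elim (intro continuous_intros)
    have "AE \<omega> in N. B 0 \<omega> = 0"
      using T assms by (intro centered_gaussian_process_AE_zero[OF N B]) (auto simp: fractional_cov_def)
    thus "AE \<omega> in N. b * B 0 \<omega> = 0" by eventually_elim simp
    show "AE \<omega> in M. W 0 \<omega> = 0"
      using T assms by (intro centered_gaussian_process_AE_zero[OF M W]) (auto simp: bifractional_cov_def)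
    fix s t assume st: "s \<in> {0..T}" "t \<in> {0..T}"
    have "(b * B s \<omega> - b * B t \<omega>)\<^sup>2 = b\<^sup>2 * (B s \<omega> - B t \<omega>)\<^sup>2" for \<omega>
      by (simp add: power_mult_distrib flip: right_diff_distrib)
    hence "(\<integral>\<omega>. (b * B s \<omega> - b * B t \<omega>)\<^sup>2 \<partial>N) = b\<^sup>2 * (\<integral>\<omega>. (B s \<omega> - B t \<omega>)\<^sup>2 \<partial>N)" by simp
    also have "\<dots> = b\<^sup>2 * \<bar>t - s\<bar> powr (2 * H * K)"
      unfolding centered_gaussian_process_cov(2)[OF N B st] by (simp add: fractional_cov_def mult.assoc field_simps)
    also have "\<dots> \<le> bifractional_cov H K t t + bifractional_cov H K s s - 2 * bifractional_cov H K s t"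
      unfolding b2 using st assms by (intro bifractional_increment_ge) auto
    also have "\<dots> = (\<integral>\<omega>. (W s \<omega> - W t \<omega>)\<^sup>2 \<partial>M)"
      unfolding centered_gaussian_process_cov(2)[OF M W st] by simp
    finally show "(\<integral>\<omega>. (b * B s \<omega> - b * B t \<omega>)\<^sup>2 \<partial>N) \<le> (\<integral>\<omega>. (W s \<omega> - W t \<omega>)\<^sup>2 \<partial>M)" .
  qed
  show ?thesis
    unfolding SUP1 SUP2
    using cmp[OF prem(1,2,3) W_cont prem(4,5,6)] by blast
qed

end
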